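(* Let $X$ be a Euclidean polyhedral space of pure dimension $n$ and $U\subset X$ a balanced open subset. Let $(f_i)_{i\ge0}$ be a sequence of weakly concave functions on $U$ and $C\subset U$ a dense subset such that for every $x\in C$ the sequence $(f_i(x))_i$ converges to a real number. Then $(f_i)_{i\ge0}$ converges pointwise on all of $U$ to a function $f$, the limit $f$ is weakly concave, and the convergence is uniform on compact subsets of $U$.
   Context: Polyhedral spaces. Let $X$ be a second countable topological space. A polyhedral structure $\Pi$ on $X$ is a locally finite covering of $X$ by distinct closed subsets $\sigma$ (polyhedra), each with a finite-dimensional vector space $M_\sigma$ of continuous real functions on $\sigma$ such that, with $N_\sigma=\operatorname{Hom}(M_\sigma,\mathbb{R})$, the evaluation map $\phi_\sigma\colon\sigma\to N_\sigma$ is a homeomorphism onto a full-dimensional convex polyhedron of an affine hyperplane of $N_\sigma$ not containing $0$. Faces of $\sigma$ are preimages of faces of $\phi_\sigma(\sigma)$ (including the empty face); every face of a polyhedron is a polyhedron of $\Pi$ with function space the restrictions of $M_\sigma$; any two polyhedra meet in a common face. Each polyhedron has an affine structure, dimension, facets. $\Pi'$ subdivides $\Pi$ if each polyhedron of $\Pi'$ lies in one of $\Pi$ with affine inclusion; structures are equivalent if they have a common subdivision. A polyhedral space is $X$ with an equivalence class of structures; a polyhedral complex on $X$ is a member; $X$ has pure dimension $n$ if all maximal polyhedra have dimension $n$. $\tau\prec\sigma$ means $\tau$ is a face of $\sigma$. A Euclidean polyhedral space is a polyhedral space $X$ with a finite-dimensional Euclidean vector space $N_X$ and a map $\iota\colon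 X\to N_X$ with image in an affine hyperplane $H_X\not\ni0$ such that some polyhedral complex has $\iota$ injective and affine on each polyhedron; only such complexes are considered. For a nonempty facet $\tau$ of $\sigma$, $v_{\sigma\setminus\tau}$ is the unit vector orthogonal to the affine span of $\iota(\tau)$, parallel to that of $\iota(\sigma)$, pointing towards $\iota(\sigma)$. Weights and cycles. $\Pi|_W$: polyhedra meeting an open $W$; $\Pi|_W(k)$: those of dimension $k$. A $k$-dimensional weight $c\colon\Pi|_W(k)\to\mathbb{R}$ is positive if $c\ge0$, a Minkowski weight if $\sum_{\sigma\in\Pi|_W(k),\sigma\succ\tau}c(\sigma)v_{\sigma\setminus\tau}=0$ for all $\tau\in\Pi|_W(k-1)$. A piecewise affine function on $W$ defined on $\Pi$ is affine on each $\sigma\cap W$; with $g=g_\sigma\circ\iota$ there ($g_\sigma$ linear), $(g\cdot c)(\tau)=-\sum_{\sigma\succ\tau}c(\sigma)g_\sigma(v_{\sigma\setminus\tau})$. Minkowski cycles: Minkowski weights modulo pullback to subdivisions ($c_{\Pi'}(\sigma')=c(\sigma)$ if $\sigma'\subset\sigma$ of equal dimension, else $0$); positive if represented by a positive weight; $g\cdot[c]=[g\cdot c]$. A balancing condition on $U$ is an $n$-dimensional Minkowski cycle $\beta_U$ represented by a weight $b$ with $b(\sigma)>0$ for all $\sigma\in\Pi|_U(n)$; $U$ with $\beta_U$ is balanced. A piecewise affine $g$ on $U$ is concave (PA sense) if $g\cdot\gamma$ is positive for every open $W\subset U$ and every positive Minkowski cycle $\gamma$ on $W$. A $k$-dimensional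 Minkowski cycle on $U$ is $\beta_U$-positive if it is $\sum_j\alpha_jg_{1,j}\cdots g_{n-k,j}\cdot\beta_U$ with $\alpha_j>0$, $g_{i,j}$ concave piecewise affine; a weight is $\beta_U$-positive if it represents one. Weak concavity. A convex combination in $U$ is $(x,(x_i)_{i\in I},(\nu_i)_{i\in I})$, $I$ finite, $x,x_i\in U$, $\nu_i\ge0$, $\sum\nu_i=1$, $\sum\nu_i\iota(x_i)=\iota(x)$. It is balanced if there are a polyhedral complex $\Pi$, $\tau\in\Pi$ with $x\in\tau$, and $\sigma_i\in\Pi$ with $\sigma_i\succ\tau$, $\sigma_i\subset U$, $x_i\in\sigma_i$, such that, with $k=\dim\tau+1$, the $\sigma_i$ are the distinct $k$-dimensional polyhedra of $\Pi$ having $\tau$ as a face, and there is a $\beta_U$-positive $k$-dimensional Minkowski weight $c$ on $\Pi|_U$ with $\nu_i\,d(x_i,\tau)=c(\sigma_i)$ ($d$ = distance from $\iota(x_i)$ to the affine span of $\iota(\tau)$). A function $f\colon U\to\mathbb{R}$ is weakly concave if $f(x)\ge\sum\nu_if(x_i)$ for every balanced convex combination in $U$. *)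

theory Defs
  imports "HOL-Analysis.Analysis"
begin

text \<open>Euclidean polyhedral spaces.  The space X is the type 'x (second countable),
  iota : X -> N_X.  In the Euclidean setting the function space M_sigma of a polyhedron
  is forced to be the pullbacks of linear functionals on N_X, so a (Euclidean) polyhedral
  complex is encoded by its family of polyhedra.\<close>

definition pdim :: "('x \<Rightarrow> 'v::euclidean_space) \<Rightarrow> 'x set \<Rightarrow> int" where
  "pdim \<iota> \<sigma> = aff_dim (\<iota> ` \<sigma>)"

definition pface :: "('x \<Rightarrow> 'v::euclidean_space) \<Rightarrow> 'x set \<Rightarrow> 'x set \<Rightarrow> bool" where
  "pface \<iota> \<tau> \<sigma> \<longleftrightarrow> (\<exists>F. F face_of (\<iota> ` \<sigma>) \<and> \<tau> = {x \<in> \<sigma>. \<iota> x \<in> F})"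

definition eucl_complex :: "('x::topological_space \<Rightarrow> 'v::euclidean_space) \<Rightarrow> 'x set set \<Rightarrow> bool" where
  "eucl_complex \<iota> Q \<longleftrightarrow>
     (\<forall>\<sigma>\<in>Q. closed \<sigma>) \<and> \<Union>Q = UNIV \<and>
     (\<forall>x. \<exists>W. open W \<and> x \<in> W \<and> finite {\<sigma>\<in>Q. \<sigma> \<inter> W \<noteq> {}}) \<and>
     (\<forall>\<sigma>\<in>Q. inj_on \<iota> \<sigma> \<and> polyhedron (\<iota> ` \<sigma>) \<and> (\<exists>g. homeomorphism \<sigma> (\<iota> ` \<sigma>) \<iota> g)) \<and>
     (\<forall>\<sigma>\<in>Q. \<forall>F. F face_of (\<iota> ` \<sigma>) \<longrightarrow> {x \<in> \<sigma>. \<iota> x \<in> F} \<in> Q) \<and>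
     (\<forall>\<sigma>\<in>Q. \<forall>\<tau>\<in>Q. pface \<iota> (\<sigma> \<inter> \<tau>) \<sigma> \<and> pface \<iota> (\<sigma> \<inter> \<tau>) \<tau>)"

text \<open>Pi' subdivides Pi (affineness of the inclusions is automatic here).\<close>
definition subdiv :: "'x set set \<Rightarrow> 'x set set \<Rightarrow> bool" where
  "subdiv Q' Q \<longleftrightarrow> (\<forall>\<sigma>'\<in>Q'. \<exists>\<sigma>\<in>Q. \<sigma>' \<subseteq> \<sigma>)"

text \<open>Pi belongs to the polyhedral structure of X (represented by the complex Pi0).\<close>
definition in_class :: "('x::topological_space \<Rightarrow> 'v::euclidean_space) \<Rightarrow> 'x set set \<Rightarrow> 'x set set \<Rightarrow> bool" where
  "in_class \<iota> Q0 Q \<longleftrightarrow> eucl_complex \<iota> Q \<and>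
     (\<exists>Q''. eucl_complex \<iota> Q'' \<and> subdiv Q'' Q \<and> subdiv Q'' Q0)"

definition restr :: "('x \<Rightarrow> 'v::euclidean_space) \<Rightarrow> 'x set set \<Rightarrow> 'x set \<Rightarrow> int \<Rightarrow> 'x set set" where
  "restr \<iota> Q W k = {\<sigma>\<in>Q. \<sigma> \<inter> W \<noteq> {} \<and> pdim \<iota> \<sigma> = k}"

definition nvec :: "('x \<Rightarrow> 'v::euclidean_space) \<Rightarrow> 'x set \<Rightarrow> 'x set \<Rightarrow> 'v" where
  "nvec \<iota> \<sigma> \<tau> = (THE u. norm u = 1 \<and>
      u \<in> span {y - z | y z. y \<in> \<iota> ` \<sigma> \<and> z \<in> \<iota> ` \<sigma>} \<and>
      (\<forall>y\<in>\<iota> ` \<tau>. \<forall>z\<in>\<iota> ` \<tau>. u \<bullet> (y - z) = 0) \<and>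
      (\<exists>y\<in>\<iota> ` \<sigma>. \<exists>z\<in>\<iota> ` \<tau>. u \<bullet> (y - z) > 0))"

definition minkowski :: "('x \<Rightarrow> 'v::euclidean_space) \<Rightarrow> 'x set set \<Rightarrow> 'x set \<Rightarrow> int \<Rightarrow> ('x set \<Rightarrow> real) \<Rightarrow> bool" where
  "minkowski \<iota> Q W k c \<longleftrightarrow>
     (\<forall>\<tau>\<in>restr \<iota> Q W (k - 1).
        (\<Sum>\<sigma>\<in>{\<sigma>\<in>restr \<iota> Q W k. \<tau> \<subseteq> \<sigma>}. c \<sigma> *\<^sub>R nvec \<iota> \<sigma> \<tau>) = 0)"

definition PA_on :: "('x \<Rightarrow> 'v::euclidean_space) \<Rightarrow> 'x set set \<Rightarrow> 'x set \<Rightarrow> ('x \<Rightarrow> real) \<Rightarrow> bool" where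
  "PA_on \<iota> Q W g \<longleftrightarrow> (\<forall>\<sigma>\<in>Q. \<exists>l. linear l \<and> (\<forall>x\<in>\<sigma> \<inter> W. g x = l (\<iota> x)))"

definition lin_piece :: "('x \<Rightarrow> 'v::euclidean_space) \<Rightarrow> 'x set \<Rightarrow> 'x set \<Rightarrow> ('x \<Rightarrow> real) \<Rightarrow> ('v \<Rightarrow> real)" where
  "lin_piece \<iota> \<sigma> W g = (SOME l. linear l \<and> (\<forall>x\<in>\<sigma> \<inter> W. g x = l (\<iota> x)))"

definition mult :: "('x \<Rightarrow> 'v::euclidean_space) \<Rightarrow> 'x set set \<Rightarrow> 'x set \<Rightarrow> int \<Rightarrow> ('x \<Rightarrow> real)
     \<Rightarrow> ('x set \<Rightarrow> real) \<Rightarrow> ('x set \<Rightarrow> real)" where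
  "mult \<iota> Q W k g c = (\<lambda>\<tau>. - (\<Sum>\<sigma>\<in>{\<sigma>\<in>restr \<iota> Q W k. \<tau> \<subseteq> \<sigma>}.
        c \<sigma> * lin_piece \<iota> \<sigma> W g (nvec \<iota> \<sigma> \<tau>)))"

primrec mults :: "('x \<Rightarrow> 'v::euclidean_space) \<Rightarrow> 'x set set \<Rightarrow> 'x set \<Rightarrow> int \<Rightarrow> ('x \<Rightarrow> real) list
     \<Rightarrow> ('x set \<Rightarrow> real) \<Rightarrow> ('x set \<Rightarrow> real)" where
  "mults \<iota> Q W d [] c = c"
| "mults \<iota> Q W d (g # gs) c = mult \<iota> Q W (d - int (length gs)) g (mults \<iota> Q W d gs c)"

definition pullback :: "('x \<Rightarrow> 'v::euclidean_space) \<Rightarrow> 'x set set \<Rightarrow> ('x set \<Rightarrow> real) \<Rightarrow> ('x set \<Rightarrow> real)" where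
  "pullback \<iota> Q c = (\<lambda>\<sigma>'. if \<exists>\<sigma>\<in>Q. \<sigma>' \<subseteq> \<sigma> \<and> pdim \<iota> \<sigma> = pdim \<iota> \<sigma>'
      then c (SOME \<sigma>. \<sigma> \<in> Q \<and> \<sigma>' \<subseteq> \<sigma> \<and> pdim \<iota> \<sigma> = pdim \<iota> \<sigma>') else 0)"

definition cyc_eq :: "('x::topological_space \<Rightarrow> 'v::euclidean_space) \<Rightarrow> 'x set set \<Rightarrow> 'x set \<Rightarrow> int
     \<Rightarrow> 'x set set \<Rightarrow> ('x set \<Rightarrow> real) \<Rightarrow> 'x set set \<Rightarrow> ('x set \<Rightarrow> real) \<Rightarrow> bool" where
  "cyc_eq \<iota> Q0 W k Q1 c1 Q2 c2 \<longleftrightarrow>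
     (\<exists>Q'. in_class \<iota> Q0 Q' \<and> subdiv Q' Q1 \<and> subdiv Q' Q2 \<and>
        (\<forall>\<sigma>\<in>restr \<iota> Q' W k. pullback \<iota> Q1 c1 \<sigma> = pullback \<iota> Q2 c2 \<sigma>))"

definition pos_cycle :: "('x::topological_space \<Rightarrow> 'v::euclidean_space) \<Rightarrow> 'x set set \<Rightarrow> 'x set \<Rightarrow> int
     \<Rightarrow> 'x set set \<Rightarrow> ('x set \<Rightarrow> real) \<Rightarrow> bool" where
  "pos_cycle \<iota> Q0 W k Q c \<longleftrightarrow>
     (\<exists>Q' c'. in_class \<iota> Q0 Q' \<and> minkowski \<iota> Q' W k c' \<and>
        (\<forall>\<sigma>\<in>restr \<iota> Q' W k. c' \<sigma> \<ge> 0) \<and> cyc_eq \<iota> Q0 W k Q c Q' c')"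

definition concave_PA :: "('x::topological_space \<Rightarrow> 'v::euclidean_space) \<Rightarrow> 'x set set \<Rightarrow> 'x set
     \<Rightarrow> ('x \<Rightarrow> real) \<Rightarrow> bool" where
  "concave_PA \<iota> Q0 U g \<longleftrightarrow>
     (\<exists>Q. in_class \<iota> Q0 Q \<and> PA_on \<iota> Q U g) \<and>
     (\<forall>W Q k c. open W \<and> W \<subseteq> U \<and> in_class \<iota> Q0 Q \<and> PA_on \<iota> Q W g \<and>
        minkowski \<iota> Q W k c \<and> pos_cycle \<iota> Q0 W k Q c \<longrightarrow>
        pos_cycle \<iota> Q0 W (k - 1) Q (mult \<iota> Q W k g c))"

text \<open>the k-dimensional weight c on Pi|_U represents a beta_U-positive Minkowski cycle,
  where beta_U is represented by the n-dimensional weight b on the complex Pib\<close>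
definition beta_pos :: "('x::topological_space \<Rightarrow> 'v::euclidean_space) \<Rightarrow> 'x set set \<Rightarrow> int \<Rightarrow> 'x set
     \<Rightarrow> 'x set set \<Rightarrow> ('x set \<Rightarrow> real) \<Rightarrow> int \<Rightarrow> 'x set set \<Rightarrow> ('x set \<Rightarrow> real) \<Rightarrow> bool" where
  "beta_pos \<iota> Q0 n U Qb b k Q c \<longleftrightarrow>
     minkowski \<iota> Q U k c \<and> k \<le> n \<and>
     (\<exists>J::nat set. \<exists>\<alpha> gs Q'. finite J \<and> J \<noteq> {} \<and> in_class \<iota> Q0 Q' \<and> subdiv Q' Qb \<and>
        (\<forall>j\<in>J. \<alpha> j > 0 \<and> int (length (gs j)) = n - k \<and>
           (\<forall>g\<in>set (gs j). concave_PA \<iota> Q0 U g \<and> PA_on \<iota> Q' U g)) \<and>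
        cyc_eq \<iota> Q0 U k Q c Q'
          (\<lambda>\<sigma>. \<Sum>j\<in>J. \<alpha> j * mults \<iota> Q' U n (gs j) (pullback \<iota> Qb b) \<sigma>))"

definition balanced_cc :: "('x::topological_space \<Rightarrow> 'v::euclidean_space) \<Rightarrow> 'x set set \<Rightarrow> int \<Rightarrow> 'x set
     \<Rightarrow> 'x set set \<Rightarrow> ('x set \<Rightarrow> real) \<Rightarrow> 'x \<Rightarrow> nat set \<Rightarrow> (nat \<Rightarrow> 'x) \<Rightarrow> (nat \<Rightarrow> real) \<Rightarrow> bool" where
  "balanced_cc \<iota> Q0 n U Qb b x I xs \<nu> \<longleftrightarrow>
     finite I \<and> x \<in> U \<and> (\<forall>i\<in>I. xs i \<in> U \<and> \<nu> i \<ge> 0) \<and> sum \<nu> I = 1 \<and>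
     (\<Sum>i\<in>I. \<nu> i *\<^sub>R \<iota> (xs i)) = \<iota> x \<and>
     (\<exists>Q \<tau> \<sigma>s c. in_class \<iota> Q0 Q \<and> \<tau> \<in> Q \<and> x \<in> \<tau> \<and>
        (\<forall>i\<in>I. \<sigma>s i \<in> Q \<and> pface \<iota> \<tau> (\<sigma>s i) \<and> \<sigma>s i \<subseteq> U \<and> xs i \<in> \<sigma>s i) \<and>
        bij_betw \<sigma>s I {\<sigma>\<in>Q. pdim \<iota> \<sigma> = pdim \<iota> \<tau> + 1 \<and> pface \<iota> \<tau> \<sigma>} \<and>
        beta_pos \<iota> Q0 n U Qb b (pdim \<iota> \<tau> + 1) Q c \<and>
        (\<forall>i\<in>I. \<nu> i * infdist (\<iota> (xs i)) (affine hull (\<iota> ` \<tau>)) = c (\<sigma>s i)))"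

definition weakly_concave :: "('x::topological_space \<Rightarrow> 'v::euclidean_space) \<Rightarrow> 'x set set \<Rightarrow> int \<Rightarrow> 'x set
     \<Rightarrow> 'x set set \<Rightarrow> ('x set \<Rightarrow> real) \<Rightarrow> ('x \<Rightarrow> real) \<Rightarrow> bool" where
  "weakly_concave \<iota> Q0 n U Qb b f \<longleftrightarrow>
     (\<forall>x I xs \<nu>. balanced_cc \<iota> Q0 n U Qb b x I xs \<nu> \<longrightarrow> f x \<ge> (\<Sum>i\<in>I. \<nu> i * f (xs i)))"

definition eucl_poly_space :: "('x::second_countable_topology \<Rightarrow> 'v::euclidean_space) \<Rightarrow> 'x set set \<Rightarrow> bool" where
  "eucl_poly_space \<iota> Q0 \<longleftrightarrow> eucl_complex \<iota> Q0 \<and>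
     (\<exists>a \<beta>. a \<noteq> 0 \<and> \<beta> \<noteq> 0 \<and> (\<forall>x. a \<bullet> \<iota> x = \<beta>))"

definition pure_dim :: "('x \<Rightarrow> 'v::euclidean_space) \<Rightarrow> 'x set set \<Rightarrow> int \<Rightarrow> bool" where
  "pure_dim \<iota> Q0 n \<longleftrightarrow> (\<forall>\<sigma>\<in>Q0. (\<forall>\<tau>\<in>Q0. \<sigma> \<subseteq> \<tau> \<longrightarrow> \<tau> = \<sigma>) \<longrightarrow> pdim \<iota> \<sigma> = n)"

definition balancing :: "('x::topological_space \<Rightarrow> 'v::euclidean_space) \<Rightarrow> 'x set set \<Rightarrow> int \<Rightarrow> 'x set
     \<Rightarrow> 'x set set \<Rightarrow> ('x set \<Rightarrow> real) \<Rightarrow> bool" where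
  "balancing \<iota> Q0 n U Qb b \<longleftrightarrow> in_class \<iota> Q0 Qb \<and> minkowski \<iota> Qb U n b \<and>
     (\<forall>\<sigma>\<in>restr \<iota> Qb U n. b \<sigma> > 0)"

end

(*
Weakly concave functions are tested at every point x of U against one-dimensional positive cycles.
Let sigma be a maximal cell containing x, d a unit direction from x into its relative interior, and
e_1, ..., e_(n-1) an orthonormal completion of d in the directions of sigma.  The functions
g_j = min(0, <e_j, iota - iota x>) are concave and piecewise affine, and g_1 ... g_(n-1) beta is a
positive one-dimensional cycle, supported in the hyperplanes orthogonal to the e_j, whose weight on
the edge from x in direction d is positive.  Here one needs that g c is again balanced if c is, which
is the classical computation at a codimension two cell, and that balancing survives subdivision.

In the interior of sigma the only edges of this cycle point in the directions d and -d, so f is concave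
there.  At a boundary point x the cycle bounds f(x + t d) above by f(x) + O(t), with a constant that
depends only on f(x) and on the values of f at finitely many points of U; these may be taken in
strata of larger dimension than that of x.  Hence f is concave on sigma near x, the sequence is
bounded at every point (from below by descending induction on the dimension of the stratum), and it
is equicontinuous at every point of U.  An equicontinuous sequence that converges on a dense set
converges everywhere and locally uniformly.
*)
theory Submission
  imports Defs
begin

section \<open>Directions and inward normals of facets\<close>

text \<open>A balanced combination tests a function only on edges at x that are whole cells inside
  U. Hence every complex is first cut near x by hyperplanes orthogonal to a basis, through x and at
  distance \<epsilon> on both sides: x becomes a vertex and all cells at x become small. The tents
  then leave only edges whose projection to the directions of \<sigma> is a multiple of d, in
  whichever cell at x the edge lies. Nothing is known beforehand about the values of f on the
  boundary of a cell, so concavity on the closed cell cannot be inherited from the open one by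
  semicontinuity. Its substitute is the inequality f(x + t(p - x)) \<le> f(x) + t \<Sum> \<omega>
  (f(x) - f(y)), in which the points y and the coefficients \<omega> do not depend on t or f. Read
  as a bound for the left side it gives concavity up to the boundary and a one-sided Lipschitz
  estimate; solved for f(x) it gives lower bounds for the whole sequence. Upper bounds follow from
  these by concavity, with a point of C placed between the given point and another point of the
  cell.\<close>

definition dirs :: "'v::euclidean_space set \<Rightarrow> 'v set" where
  "dirs S = span {y - z | y z. y \<in> S \<and> z \<in> S}"

lemma subspace_dirs [simp]: "subspace (dirs S)"
  by (simp add: dirs_def)

lemma diff_in_dirs: "y \<in> S \<Longrightarrow> z \<in> S \<Longrightarrow> y - z \<in> dirs S"
  unfolding dirs_def by (rule span_base) blast

lemma dirs_mono: "S \<subseteq> T \<Longrightarrow> dirs S \<subseteq> dirs T"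
  unfolding dirs_def by (rule span_mono) blast

lemma dirs_eq_span: assumes "a \<in> S" shows "dirs S = span ((\<lambda>y. y - a) ` S)"
proof
  have "y - z \<in> span ((\<lambda>y. y - a) ` S)" if "y \<in> S" "z \<in> S" for y z
  proof -
    have "(y - a) - (z - a) \<in> span ((\<lambda>y. y - a) ` S)"
      using that by (intro span_diff span_base) auto
    then show ?thesis by simp
  qed
  then show "dirs S \<subseteq> span ((\<lambda>y. y - a) ` S)"
    unfolding dirs_def by (intro span_minimal) auto
  show "span ((\<lambda>y. y - a) ` S) \<subseteq> dirs S"
    using assms by (intro span_minimal) (auto simp: diff_in_dirs)
qed

lemma aff_dim_dirs: assumes "S \<noteq> {}" shows "aff_dim S = int (dim (dirs S))"
proof -
  obtain a where a: "a \<in> S" using assms by blast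
  have "aff_dim S = int (dim ((+) (- a) ` S))"
    using a by (intro aff_dim_eq_dim) (simp add: hull_inc)
  also have "(+) (- a) ` S = (\<lambda>y. y - a) ` S" by (auto simp: image_iff)
  finally show ?thesis by (simp add: dirs_eq_span[OF a] dim_span)
qed

lemma affine_hull_dirs: assumes "a \<in> S" shows "affine hull S = {v. v - a \<in> dirs S}"
proof -
  have "affine hull S = (\<lambda>x. a + x) ` span ((\<lambda>x. - a + x) ` (S - {a}))"
    by (rule affine_hull_span2[OF assms])
  also have "span ((\<lambda>x. - a + x) ` (S - {a})) = span ((\<lambda>y. y - a) ` S)"
  proof -
    have "insert 0 ((\<lambda>x. - a + x) ` (S - {a})) = insert 0 ((\<lambda>y. y - a) ` S)" by (auto simp: image_iff)
    then show ?thesis by (metis span_insert_0)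
  qed
  finally have "affine hull S = (\<lambda>x. a + x) ` dirs S" by (simp add: dirs_eq_span[OF assms])
  moreover have "v \<in> (\<lambda>x. a + x) ` D \<longleftrightarrow> v - a \<in> D" for v and D :: "'a set"
    by (metis (no_types, lifting) add_diff_cancel_left' diff_add_cancel add.commute image_iff)
  ultimately show ?thesis by blast
qed

lemma dirs_subset_eq: assumes "T \<subseteq> S" "T \<noteq> {}" "aff_dim T = aff_dim S" shows "dirs T = dirs S"
proof -
  have "S \<noteq> {}" using assms by auto
  then have "dim (dirs T) = dim (dirs S)"
    using assms aff_dim_dirs[of T] aff_dim_dirs[of S] by simp
  then show ?thesis using dirs_mono[OF assms(1)]
    by (intro subspace_dim_equal) auto
qed

lemma dirs_sing [simp]: "dirs {a} = {0}"
  by (simp add: dirs_eq_span[of a])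

lemma orth_dirs: assumes "\<forall>y\<in>T. \<forall>z\<in>T. u \<bullet> (y - z) = 0" "t \<in> dirs T" shows "u \<bullet> t = 0"
proof -
  have "t \<in> span {y - z | y z. y \<in> T \<and> z \<in> T}" using assms(2) unfolding dirs_def .
  then show ?thesis
    by (induction rule: span_induct_alt) (use assms(1) in \<open>auto simp: inner_add_right\<close>)
qed

text \<open>The predicate under the \<open>THE\<close> of \<open>nvec\<close>, for subsets of the
  vector space; \<open>dirs\<close> is the span that occurs there. A single pair of points witnesses
  the sign, and \<open>is_nvec_pos\<close> extends it to all points of S outside T.\<close>

definition is_nvec :: "'v::euclidean_space set \<Rightarrow> 'v set \<Rightarrow> 'v \<Rightarrow> bool" where
  "is_nvec S T u \<longleftrightarrow> norm u = 1 \<and> u \<in> dirs S \<and> (\<forall>y\<in>T. \<forall>z\<in>T. u \<bullet> (y - z) = 0) \<and>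
     (\<exists>y\<in>S. \<exists>z\<in>T. u \<bullet> (y - z) > 0)"

text \<open>By dimension count a unit vector of E orthogonal to the hyperplane D spans E together
  with D. All splittings into a normal and a tangential part rest on this.\<close>

lemma codim1_decomp:
  fixes D E :: "'v::euclidean_space set"
  assumes D: "subspace D" "subspace E" "D \<subseteq> E" "dim E = Suc (dim D)"
    and u: "u \<in> E" "norm u = 1" "\<And>t. t \<in> D \<Longrightarrow> u \<bullet> t = 0" and w: "w \<in> E"
  obtains t where "t \<in> D" "w = (u \<bullet> w) *\<^sub>R u + t"
proof -
  have uu: "u \<bullet> u = 1" using u(2) by (simp add: norm_eq_1)
  have unD: "u \<notin> span D" using u(3)[of u] uu D(1) by (metis span_eq_iff zero_neq_one)
  have "span (insert u D) = E"
  proof (rule subspace_dim_equal)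
    show "span (insert u D) \<subseteq> E" using D u by (intro span_minimal) auto
    have "dim (span (insert u D)) = Suc (dim D)" using unD by (simp add: dim_insert)
    then show "dim (span (insert u D)) \<ge> dim E" using D by simp
  qed (use D in auto)
  then have "w \<in> span (insert u D)" using w by simp
  then obtain k where k: "w - k *\<^sub>R u \<in> span D" by (auto simp: span_breakdown_eq)
  then have k': "w - k *\<^sub>R u \<in> D" using D(1) by (metis span_eq_iff)
  then have "u \<bullet> (w - k *\<^sub>R u) = 0" using u(3) by blast
  then have "k = u \<bullet> w" by (simp add: inner_diff_right uu)
  then show thesis using that[OF k'] by simp
qed

lemma facet_dims:
  assumes "T facet_of S"
  shows "T \<subseteq> S" "T \<noteq> {}" "S \<noteq> {}" "dirs T \<subseteq> dirs S" "dim (dirs S) = Suc (dim (dirs T))"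
proof -
  show 1: "T \<subseteq> S" "T \<noteq> {}" using assms by (auto simp: facet_of_def face_of_imp_subset)
  then show 2: "S \<noteq> {}" by auto
  show "dirs T \<subseteq> dirs S" by (rule dirs_mono) fact
  show "dim (dirs S) = Suc (dim (dirs T))"
    using assms aff_dim_dirs[OF 1(2)] aff_dim_dirs[OF 2] by (simp add: facet_of_def)
qed

lemma facet_ne: "T facet_of S \<Longrightarrow> T \<noteq> S"
  by (auto simp: facet_of_def)

lemma is_nvec_orth: "is_nvec S T u \<Longrightarrow> t \<in> dirs T \<Longrightarrow> u \<bullet> t = 0"
  unfolding is_nvec_def using orth_dirs by blast

lemma unit_orth_unique:
  fixes D E :: "'v::euclidean_space set"
  assumes D: "subspace D" "subspace E" "D \<subseteq> E" "dim E = Suc (dim D)"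
    and u: "u \<in> E" "norm u = 1" "\<And>t. t \<in> D \<Longrightarrow> u \<bullet> t = 0"
    and v: "v \<in> E" "norm v = 1" "\<And>t. t \<in> D \<Longrightarrow> v \<bullet> t = 0"
  shows "v = u \<or> v = - u"
proof -
  obtain t where t: "t \<in> D" "v = (u \<bullet> v) *\<^sub>R u + t" by (rule codim1_decomp[OF D u v(1)])
  have "v \<bullet> t = 0" "u \<bullet> t = 0" using u v t by auto
  then have "t \<bullet> t = 0" using t(2) by (metis inner_left_distrib inner_scaleR_left mult_zero_right add_0)
  then have e: "v = (u \<bullet> v) *\<^sub>R u" using t by simp
  then have "\<bar>u \<bullet> v\<bar> = 1" using u v by (metis mult.right_neutral norm_scaleR)
  then have "u \<bullet> v = 1 \<or> u \<bullet> v = -1" by linarith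
  then show ?thesis using e by (metis scaleR_one scaleR_minus1_left)
qed

lemma facet_affine_Int:
  assumes "convex S" "T facet_of S" "v \<in> S" "z \<in> T" "v - z \<in> dirs T" shows "v \<in> T"
proof -
  have "T = affine hull T \<inter> S" using assms(1,2) face_of_imp_eq_affine_Int[of S T] by (simp add: facet_of_def)
  then show ?thesis using assms affine_hull_dirs[of z T] by auto
qed

text \<open>A point y on the wrong side would be joined to \<open>y0\<close> by a segment that meets
  the affine hull of T inside S, hence meets T; since T is a face, y would then belong to T.\<close>

lemma is_nvec_pos:
  assumes "convex S" "T facet_of S" "is_nvec S T u" "y \<in> S" "y \<notin> T" "z \<in> T"
  shows "u \<bullet> (y - z) > 0"
proof -
  note d = facet_dims[OF assms(2)]
  have u: "u \<in> dirs S" "norm u = 1" "\<And>t. t \<in> dirs T \<Longrightarrow> u \<bullet> t = 0"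
    using assms(3) is_nvec_orth unfolding is_nvec_def by blast+
  obtain y0 z0 where y0: "y0 \<in> S" "z0 \<in> T" "u \<bullet> (y0 - z0) > 0" using assms(3) unfolding is_nvec_def by blast
  have "u \<bullet> (z0 - z) = 0" using assms(3,6) y0(2) unfolding is_nvec_def by blast
  then have p0: "u \<bullet> (y0 - z) > 0" using y0(3) by (simp add: inner_diff_right)
  show ?thesis
  proof (rule ccontr)
    assume "\<not> ?thesis"
    then have n: "u \<bullet> (y - z) \<le> 0" by simp
    let ?p = "u \<bullet> (y0 - z)" and ?q = "- (u \<bullet> (y - z))"
    \<comment> \<open>The zero of the affine function u \<bullet> (v - z) on the segment from
      \<open>y0\<close>, where it is positive, to y, where it is nonpositive.\<close>
    define l where "l = ?p / (?p + ?q)"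
    have l: "0 < l" "l \<le> 1" using p0 n by (auto simp: l_def field_simps)
    define v where "v = (1 - l) *\<^sub>R y0 + l *\<^sub>R y"
    have vS: "v \<in> S" using assms(1,4) y0(1) l unfolding v_def by (intro convexD) auto
    have "v - z = (1 - l) *\<^sub>R (y0 - z) + l *\<^sub>R (y - z)" by (simp add: v_def algebra_simps)
    then have "u \<bullet> (v - z) = (1 - l) * ?p - l * ?q" by (simp add: inner_add_right)
    also have "\<dots> = ?p - l * (?p + ?q)" by (simp add: algebra_simps)
    also have "\<dots> = 0" using p0 n by (simp add: l_def)
    finally have uv: "u \<bullet> (v - z) = 0" .
    have "v - z \<in> dirs S" using vS assms(6) d(1) diff_in_dirs by blast
    then obtain t where "t \<in> dirs T" "v - z = (u \<bullet> (v - z)) *\<^sub>R u + t"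
      using codim1_decomp[OF subspace_dirs subspace_dirs d(4,5) u] by blast
    then have "v - z \<in> dirs T" using uv by simp
    then have vT: "v \<in> T" using facet_affine_Int assms vS by blast
    show False
    proof (cases "l = 1")
      case True then show False using vT assms(5) by (simp add: v_def)
    next
      case False
      have "y0 \<noteq> y" using p0 n by auto
      then have "v \<in> open_segment y0 y" using l False unfolding in_segment v_def by auto
      then have "y \<in> T" using assms(2) y0(1) assms(4) vT unfolding facet_of_def face_of_def by blast
      then show False using assms(5) by simp
    qed
  qed
qed

text \<open>A nonzero vector of \<open>dirs S\<close> orthogonal to \<open>dirs T\<close> cannot
  annihilate y - z for y in S outside T, since y would then lie in the affine hull of T and so in T.
  Only its sign is left to choose, and \<open>is_nvec_pos\<close> settles it.\<close>

lemma is_nvec_ex1: assumes "convex S" "T facet_of S" shows "\<exists>!u. is_nvec S T u"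
proof (rule ex_ex1I)
  note d = facet_dims[OF assms(2)]
  have "dirs T \<subset> dirs S" using d(4,5) by force
  then obtain x where x: "x \<in> dirs S" "x \<noteq> 0" "\<And>y. y \<in> dirs T \<Longrightarrow> orthogonal x y"
    using orthogonal_to_subspace_exists_gen[of "dirs T" "dirs S"] 
    by (metis span_eq_iff subspace_dirs)
  obtain y where y: "y \<in> S" "y \<notin> T"
    using facet_ne[OF assms(2)] d(1) by blast
  obtain z where z: "z \<in> T" using d by blast
  have ne: "x \<bullet> (y - z) \<noteq> 0"
  proof
    assume "x \<bullet> (y - z) = 0"
    define u where "u = x /\<^sub>R norm x"
    have u: "u \<in> dirs S" "norm u = 1" "\<And>t. t \<in> dirs T \<Longrightarrow> u \<bullet> t = 0"
      using x by (auto simp: u_def orthogonal_def subspace_scale)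
    obtain t where "t \<in> dirs T" "y - z = (u \<bullet> (y - z)) *\<^sub>R u + t"
      using codim1_decomp[OF subspace_dirs subspace_dirs d(4,5) u, of "y - z"] y z d(1) diff_in_dirs
      by blast
    moreover have "u \<bullet> (y - z) = 0" using \<open>x \<bullet> (y - z) = 0\<close> by (simp add: u_def)
    ultimately have "y - z \<in> dirs T" by simp
    then show False using facet_affine_Int assms y z by blast
  qed
  define u where "u = (sgn (x \<bullet> (y - z)) / norm x) *\<^sub>R x"
  have "u \<bullet> (y - z) > 0" using ne x by (auto simp: u_def sgn_real_def)
  moreover have "norm u = 1" using ne x by (simp add: u_def sgn_real_def)
  moreover have "u \<in> dirs S" using x by (simp add: u_def subspace_scale)
  moreover have "u \<bullet> (y' - z') = 0" if "y' \<in> T" "z' \<in> T" for y' z'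
    using x(3)[OF diff_in_dirs[OF that]] by (simp add: u_def orthogonal_def)
  ultimately show "\<exists>u. is_nvec S T u" unfolding is_nvec_def using y z by blast
next
  fix u v assume a: "is_nvec S T u" "is_nvec S T v"
  note d = facet_dims[OF assms(2)]
  have "v = u \<or> v = - u"
    by (rule unit_orth_unique[OF subspace_dirs subspace_dirs d(4,5)])
      (use a is_nvec_orth[OF a(1)] is_nvec_orth[OF a(2)] in \<open>simp_all add: is_nvec_def\<close>)
  moreover have "v \<noteq> - u"
  proof
    assume "v = - u"
    obtain y z where y: "y \<in> S" "z \<in> T" "v \<bullet> (y - z) > 0" using a(2) unfolding is_nvec_def by blast
    have "y \<notin> T" using y a(2) unfolding is_nvec_def by force
    then have "u \<bullet> (y - z) > 0" using is_nvec_pos[OF assms a(1)] y by blast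
    then show False using y \<open>v = - u\<close> by simp
  qed
  ultimately show "u = v" by blast
qed

lemma nvec_eqI:
  assumes "convex (\<iota> ` \<sigma>)" "(\<iota> ` \<tau>) facet_of (\<iota> ` \<sigma>)" "is_nvec (\<iota> ` \<sigma>) (\<iota> ` \<tau>) u"
  shows "nvec \<iota> \<sigma> \<tau> = u"
  using is_nvec_ex1[OF assms(1,2)] assms(3)
  unfolding nvec_def is_nvec_def dirs_def by (rule the1_equality)

lemma nvec_is_nvec:
  assumes "convex (\<iota> ` \<sigma>)" "(\<iota> ` \<tau>) facet_of (\<iota> ` \<sigma>)"
  shows "is_nvec (\<iota> ` \<sigma>) (\<iota> ` \<tau>) (nvec \<iota> \<sigma> \<tau>)"
  using is_nvec_ex1[OF assms] nvec_eqI[OF assms] by metis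

lemma is_nvec_decomp:
  assumes "T facet_of S" "is_nvec S T u" "w \<in> dirs S"
  obtains t where "t \<in> dirs T" "w = (u \<bullet> w) *\<^sub>R u + t"
proof -
  note d = facet_dims[OF assms(1)]
  have u: "u \<in> dirs S" "norm u = 1" "\<And>t. t \<in> dirs T \<Longrightarrow> u \<bullet> t = 0"
    using assms(2) is_nvec_orth unfolding is_nvec_def by blast+
  show thesis using codim1_decomp[OF subspace_dirs subspace_dirs d(4,5) u assms(3)] that by blast
qed

lemma rel_interior_dirs:
  assumes "z \<in> rel_interior T"
  obtains e where "e > 0" "\<And>t. t \<in> dirs T \<Longrightarrow> norm t \<le> e \<Longrightarrow> z + t \<in> T"
proof -
  obtain e where e: "z \<in> T" "e > 0" "cball z e \<inter> affine hull T \<subseteq> T"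
    using assms by (auto simp: mem_rel_interior_cball)
  have "z + t \<in> T" if "t \<in> dirs T" "norm t \<le> e" for t
  proof -
    have "z + t \<in> affine hull T" using that affine_hull_dirs[OF e(1)] by simp
    moreover have "z + t \<in> cball z e" using that by (simp add: dist_norm)
    ultimately show ?thesis using e(3) by blast
  qed
  then show thesis using that e(2) by blast
qed

text \<open>A point y of S off T lies over z only up to a tangential error t. As z is relatively
  interior to T, the error can be compensated by starting at z - h t, which is still in T.\<close>

lemma facet_inward:
  assumes "convex S" "T facet_of S" "is_nvec S T u" "z \<in> rel_interior T"
  obtains l where "l > 0" "\<And>s. 0 \<le> s \<Longrightarrow> s \<le> l \<Longrightarrow> z + s *\<^sub>R u \<in> S"
proof -
  note d = facet_dims[OF assms(2)]
  have zT: "z \<in> T" using assms(4) rel_interior_subset by blast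
  obtain y where y: "y \<in> S" "y \<notin> T"
    using facet_ne[OF assms(2)] d(1) by blast
  have p: "u \<bullet> (y - z) > 0" using is_nvec_pos assms(1-3) y zT by blast
  obtain t where t: "t \<in> dirs T" "y - z = (u \<bullet> (y - z)) *\<^sub>R u + t"
    using is_nvec_decomp[OF assms(2,3), of "y - z"] diff_in_dirs y zT d(1) by blast
  obtain e where e: "e > 0" "\<And>t. t \<in> dirs T \<Longrightarrow> norm t \<le> e \<Longrightarrow> z + t \<in> T"
    using rel_interior_dirs[OF assms(4)] by blast
  define h where "h = e / (norm t + 1)"
  have "norm t + 1 > 0" by (simp add: add_nonneg_pos)
  then have h: "h > 0" "h * norm t \<le> e" using e(1) by (simp_all add: h_def field_simps)
  have "z + (- h) *\<^sub>R t \<in> T" using t h subspace_scale[OF subspace_dirs t(1), of "- h"] by (intro e(2)) auto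
  then have zS: "z + (- h) *\<^sub>R t \<in> S" using d by blast
  \<comment> \<open>With weights 1 / (1 + h) on z - h t and h / (1 + h) on y the multiples of t
    cancel; l is the remaining coefficient of u.\<close>
  define l where "l = h * (u \<bullet> (y - z)) / (1 + h)"
  have "(1 / (1 + h)) *\<^sub>R (z + (- h) *\<^sub>R t) + (h / (1 + h)) *\<^sub>R y \<in> S"
    using assms(1) zS y(1) h by (intro convexD) (auto simp: field_simps)
  moreover have "(1 / (1 + h)) *\<^sub>R (z + (- h) *\<^sub>R t) + (h / (1 + h)) *\<^sub>R y = z + l *\<^sub>R u"
  proof -
    have y: "y = z + (u \<bullet> (y - z)) *\<^sub>R u + t" using t(2) by (simp add: algebra_simps)
    have eq: "(1 / (1 + h)) *\<^sub>R (z + (- h) *\<^sub>R t) + (h / (1 + h)) *\<^sub>R (z + c *\<^sub>R u + t) =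
       (1 / (1 + h) + h / (1 + h)) *\<^sub>R z + (h * c / (1 + h)) *\<^sub>R u" for c
      by (simp add: algebra_simps)
    have "1 / (1 + h) + h / (1 + h) = 1" using h by (simp add: field_simps)
    then show ?thesis using eq[of "u \<bullet> (y - z)"] y by (simp add: l_def)
  qed
  ultimately have lS: "z + l *\<^sub>R u \<in> S" by simp
  have l0: "l > 0" using p h by (simp add: l_def)
  have "z + s *\<^sub>R u \<in> S" if "0 \<le> s" "s \<le> l" for s
  proof -
    have "(1 - s / l) *\<^sub>R z + (s / l) *\<^sub>R (z + l *\<^sub>R u) \<in> S"
      using assms(1) lS zT d(1) that l0 by (intro convexD) auto
    moreover have "(1 - s / l) *\<^sub>R z + (s / l) *\<^sub>R (z + l *\<^sub>R u) = z + s *\<^sub>R u"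
      using l0 by (simp add: algebra_simps)
    ultimately show ?thesis by simp
  qed
  then show thesis using that l0 by blast
qed

section \<open>Codimension two faces of a polyhedron\<close>

lemma face_aff_dim_eq: "convex S \<Longrightarrow> T face_of S \<Longrightarrow> aff_dim T = aff_dim S \<Longrightarrow> T = S"
  using face_of_aff_dim_lt by fastforce

lemma facet_of_convex: "T facet_of S \<Longrightarrow> convex T"
  unfolding facet_of_def using face_of_imp_convex by blast

text \<open>G is not contained in F, so some y in G has w \<bullet> (y - z) > 0. Up to directions of
  R, which w annihilates, y - z is a positive multiple of u.\<close>

lemma ridge_facet_inner_pos:
  assumes "convex S" "F facet_of S" "G facet_of S" "F \<noteq> G" "R facet_of F" "R facet_of G"
    and w: "is_nvec S F w" and u: "is_nvec G R u"
  shows "w \<bullet> u > 0"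
proof -
  have cG: "convex G" "convex F" using facet_of_convex assms(2,3) by blast+
  note dR = facet_dims[OF assms(5)] facet_dims[OF assms(6)]
  obtain z where z: "z \<in> R" using dR by blast
  have ne: "\<not> G \<subseteq> F"
  proof
    assume "G \<subseteq> F"
    then have "G face_of F" using face_of_face[of F S G] assms(2,3) by (auto simp: facet_of_def)
    then have "G = F" using face_aff_dim_eq[of F G] cG assms(2,3) by (auto simp: facet_of_def)
    then show False using assms(4) by simp
  qed
  then obtain y where y: "y \<in> G" "y \<notin> F" by blast
  have yS: "y \<in> S" using y facet_dims(1)[OF assms(3)] by blast
  have zF: "z \<in> F" "z \<in> G" using z dR by blast+
  have pw: "w \<bullet> (y - z) > 0" using is_nvec_pos assms(1,2) w yS y zF by blast
  have pu: "u \<bullet> (y - z) > 0" using is_nvec_pos[OF cG(1) assms(6) u y(1)] y z dR by blast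
  obtain t where t: "t \<in> dirs R" "y - z = (u \<bullet> (y - z)) *\<^sub>R u + t"
    using is_nvec_decomp[OF assms(6) u, of "y - z"] y zF diff_in_dirs by blast
  have "w \<bullet> t = 0" using is_nvec_orth[OF w] t(1) dR by blast
  then have "w \<bullet> (y - z) = (u \<bullet> (y - z)) * (w \<bullet> u)"
    using t(2) by (metis add.right_neutral inner_add_right inner_scaleR_right)
  then show ?thesis using pw pu by (simp add: zero_less_mult_iff)
qed

text \<open>Orthogonally to R, the directions of S form a plane with orthonormal basis u, w, and v
  lies in that plane.\<close>

lemma ridge_decomp:
  assumes "convex S" "F facet_of S" "G facet_of S" "R facet_of F" "R facet_of G"
    and w: "is_nvec S F w" and u: "is_nvec F R u" and v: "is_nvec G R v"
  shows "v = (u \<bullet> v) *\<^sub>R u + (w \<bullet> v) *\<^sub>R w"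
proof -
  note dR = facet_dims[OF assms(4)] facet_dims[OF assms(5)] facet_dims[OF assms(2)] facet_dims[OF assms(3)]
  have v': "v \<in> dirs S" using v dR unfolding is_nvec_def by blast
  then obtain t where t: "t \<in> dirs F" "v = (w \<bullet> v) *\<^sub>R w + t" using is_nvec_decomp[OF assms(2) w] by blast
  then obtain r where r: "r \<in> dirs R" "t = (u \<bullet> t) *\<^sub>R u + r" using is_nvec_decomp[OF assms(4) u] by blast
  have uw: "w \<bullet> u = 0" using is_nvec_orth[OF w] u unfolding is_nvec_def by blast
  have o: "u \<bullet> r = 0" "w \<bullet> r = 0" "v \<bullet> r = 0" "w \<bullet> u = 0"
    using is_nvec_orth[OF u r(1)] is_nvec_orth[OF v r(1)] is_nvec_orth[OF w] uw r(1) dR by blast+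
  have e: "v = (w \<bullet> v) *\<^sub>R w + ((u \<bullet> t) *\<^sub>R u + r)" using t(2) r(2) by simp
  then have "v \<bullet> r = r \<bullet> r" using o by (metis add_0 inner_add_left inner_scaleR_left mult_zero_right)
  then have "r = 0" using o by simp
  have "u \<bullet> v = u \<bullet> t" using t(2) uw by (metis add_0 inner_add_right inner_commute inner_scaleR_right mult_zero_right)
  then show ?thesis using e \<open>r = 0\<close> by (simp add: add.commute)
qed

lemma facet_of_facet_face:
  assumes "R face_of S" "R \<noteq> {}" "aff_dim R = aff_dim S - 2" "F facet_of S" "R \<subseteq> F"
  shows "R facet_of F"
  using assms face_of_face[of F S R] by (auto simp: facet_of_def)

text \<open>R is the intersection of the facets around it, and a single facet is too large. A third
  facet is impossible because the section orthogonal to R is a plane wedge: seen from F, each of the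
  other two edge vectors would have to come strictly before the other.\<close>

lemma ridge_two_facets:
  assumes S: "polyhedron S" and R: "R face_of S" "R \<noteq> {}" "aff_dim R = aff_dim S - 2"
  obtains F G where "F facet_of S" "G facet_of S" "F \<noteq> G" "{H. H facet_of S \<and> R \<subseteq> H} = {F, G}"
proof -
  have cS: "convex S" using S polyhedron_imp_convex by blast
  have RS: "R \<noteq> S" using R by auto
  let ?A = "{H. H facet_of S \<and> R \<subseteq> H}"
  have int: "R = \<Inter>?A" using face_of_polyhedron[OF S R(1,2) RS] .
  obtain F where F: "F facet_of S" "R \<subseteq> F" using face_of_polyhedron_subset_facet[OF S R(1,2) RS] .
  have "?A \<noteq> {F}"
  proof
    assume "?A = {F}"
    then have "R = F" using int by simp
    then show False using F R by (simp add: facet_of_def)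
  qed
  then obtain G where G: "G facet_of S" "R \<subseteq> G" "F \<noteq> G" using F by blast
  have "H = F \<or> H = G" if H: "H facet_of S" "R \<subseteq> H" for H
  proof (rule ccontr)
    assume ne: "\<not> (H = F \<or> H = G)"
    note f = facet_of_facet_face[OF R F] facet_of_facet_face[OF R G(1,2)] facet_of_facet_face[OF R H]
    have c: "convex F" "convex G" "convex H" using F G H facet_of_convex by blast+
    obtain wF wG wH where w: "is_nvec S F wF" "is_nvec S G wG" "is_nvec S H wH"
      using is_nvec_ex1[OF cS] F(1) G(1) H(1) by metis
    obtain uF uG uH where u: "is_nvec F R uF" "is_nvec G R uG" "is_nvec H R uH"
      using is_nvec_ex1 c f by metis
    have p: "wF \<bullet> uG > 0" "wF \<bullet> uH > 0" "wG \<bullet> uF > 0" "wG \<bullet> uH > 0" "wH \<bullet> uF > 0" "wH \<bullet> uG > 0"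
      using ridge_facet_inner_pos[OF cS] F G H ne f w u by metis+
    have eG: "uG = (uF \<bullet> uG) *\<^sub>R uF + (wF \<bullet> uG) *\<^sub>R wF" and eH: "uH = (uF \<bullet> uH) *\<^sub>R uF + (wF \<bullet> uH) *\<^sub>R wF"
      using ridge_decomp[OF cS F(1) _ f(1)] G H f w u by metis+
    have oG: "wG \<bullet> uG = 0" and oH: "wH \<bullet> uH = 0"
      using is_nvec_orth w u unfolding is_nvec_def by blast+
    \<comment> \<open>Coordinates of \<open>uG\<close> and \<open>uH\<close> in the basis
      \<open>uF\<close>, \<open>wF\<close>. The sign of s b - r a tells which of them makes the
      smaller angle with \<open>uF\<close>; the normal of G forces one sign and the normal of H the
      other.\<close>
    define a s b r where d: "a = uF \<bullet> uG" "s = wF \<bullet> uG" "b = uF \<bullet> uH" "r = wF \<bullet> uH"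
    have sr: "s > 0" "r > 0" using p d by auto
    have 1: "a * (wG \<bullet> uF) + s * (wG \<bullet> wF) = 0" using oG eG d by (metis inner_add_right inner_scaleR_right)
    have 2: "b * (wG \<bullet> uF) + r * (wG \<bullet> wF) > 0" using p(4) eH d by (metis inner_add_right inner_scaleR_right)
    have 3: "b * (wH \<bullet> uF) + r * (wH \<bullet> wF) = 0" using oH eH d by (metis inner_add_right inner_scaleR_right)
    have 4: "a * (wH \<bullet> uF) + s * (wH \<bullet> wF) > 0" using p(6) eG d by (metis inner_add_right inner_scaleR_right)
    have "s * (b * (wG \<bullet> uF) + r * (wG \<bullet> wF)) = (s * b - r * a) * (wG \<bullet> uF)"
      using 1 by algebra
    then have "(s * b - r * a) * (wG \<bullet> uF) > 0" using 2 sr by (metis mult_pos_pos)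
    then have A: "s * b - r * a > 0" using p(3) by (simp add: zero_less_mult_iff)
    have "r * (a * (wH \<bullet> uF) + s * (wH \<bullet> wF)) = (r * a - s * b) * (wH \<bullet> uF)"
      using 3 by algebra
    then have "(r * a - s * b) * (wH \<bullet> uF) > 0" using 4 sr by (metis mult_pos_pos)
    then have B: "r * a - s * b > 0" using p(5) by (simp add: zero_less_mult_iff)
    show False using A B by simp
  qed
  then have "?A = {F, G}" using F G by blast
  then show thesis using that F G by blast
qed

text \<open>With k = u \<bullet> u' and s the sine of the angle between u and u', w = (u' - k u) / s
  and w' = (u - k u') / s. Both sides become (h(u') u + h(u) u' - k h(u) u - k h(u') u') /
  s.\<close>

lemma ridge_linear_exchange:
  assumes "convex S" "F facet_of S" "G facet_of S" "F \<noteq> G" "R facet_of F" "R facet_of G"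
    and w: "is_nvec S F w" "is_nvec S G w'" and u: "is_nvec F R u" "is_nvec G R u'"
    and h: "linear h"
  shows "h w *\<^sub>R u + h w' *\<^sub>R u' = h u *\<^sub>R w + h u' *\<^sub>R (w'::'v::euclidean_space)"
proof -
  interpret h: linear h by fact
  define k s r where d: "k = u \<bullet> u'" "s = w \<bullet> u'" "r = w' \<bullet> u"
  have e1: "u' = k *\<^sub>R u + s *\<^sub>R w" using ridge_decomp[OF assms(1,2,3,5,6) w(1) u] d by simp
  have e2: "u = k *\<^sub>R u' + r *\<^sub>R w'" using ridge_decomp[OF assms(1,3,2,6,5) w(2) u(2,1)] d by (simp add: inner_commute)
  have p: "s > 0" "r > 0"
    using ridge_facet_inner_pos[OF assms(1,2,3,4,5,6) w(1) u(2)]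
      ridge_facet_inner_pos[OF assms(1,3,2) _ assms(6,5) w(2) u(1)] assms(4) d by auto
  have n: "u \<bullet> u = 1" "u' \<bullet> u' = 1" "w \<bullet> w = 1" "w' \<bullet> w' = 1"
    using u w by (auto simp: is_nvec_def norm_eq_1)
  have o: "w \<bullet> u = 0" "w' \<bullet> u' = 0" using is_nvec_orth w u unfolding is_nvec_def by blast+
  have "u' \<bullet> u' = (k *\<^sub>R u + s *\<^sub>R w) \<bullet> (k *\<^sub>R u + s *\<^sub>R w)" using e1 by simp
  then have s2: "k\<^sup>2 + s\<^sup>2 = 1" using n o by (simp add: inner_simps inner_commute power2_eq_square)
  have "u \<bullet> u = (k *\<^sub>R u' + r *\<^sub>R w') \<bullet> (k *\<^sub>R u' + r *\<^sub>R w')" using e2 by simp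
  then have r2: "k\<^sup>2 + r\<^sup>2 = 1" using n o by (simp add: inner_simps inner_commute power2_eq_square)
  have "s\<^sup>2 = r\<^sup>2" using s2 r2 by simp
  then have rs: "r = s" using p by (simp add: power2_eq_iff)
  have "(1/s) *\<^sub>R u' = (1/s) *\<^sub>R (k *\<^sub>R u + s *\<^sub>R w)" using e1 by simp
  then have w1: "w = (1/s) *\<^sub>R u' - (k/s) *\<^sub>R u" using p by (simp add: algebra_simps)
  have "(1/s) *\<^sub>R u = (1/s) *\<^sub>R (k *\<^sub>R u' + s *\<^sub>R w')" using e2 rs by simp
  then have w2: "w' = (1/s) *\<^sub>R u - (k/s) *\<^sub>R u'" using p by (simp add: algebra_simps)
  have hw: "h w = (1/s) * h u' - (k/s) * h u" "h w' = (1/s) * h u - (k/s) * h u'"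
    unfolding w1 w2 by (simp_all add: h.diff h.scale)
  show ?thesis unfolding hw unfolding w1 w2 by (simp add: algebra_simps)
qed

section \<open>Cells of a complex and subdivisions\<close>

lemma pface_iff:
  assumes "inj_on \<iota> \<sigma>"
  shows "pface \<iota> \<tau> \<sigma> \<longleftrightarrow> \<tau> \<subseteq> \<sigma> \<and> (\<iota> ` \<tau>) face_of (\<iota> ` \<sigma>)"
proof
  assume "pface \<iota> \<tau> \<sigma>"
  then obtain F where F: "F face_of (\<iota> ` \<sigma>)" "\<tau> = {x \<in> \<sigma>. \<iota> x \<in> F}" unfolding pface_def by blast
  then have "F \<subseteq> \<iota> ` \<sigma>" by (simp add: face_of_imp_subset)
  then have "\<iota> ` \<tau> = F" using F(2) by auto
  then show "\<tau> \<subseteq> \<sigma> \<and> (\<iota> ` \<tau>) face_of (\<iota> ` \<sigma>)" using F by auto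
next
  assume r: "\<tau> \<subseteq> \<sigma> \<and> (\<iota> ` \<tau>) face_of (\<iota> ` \<sigma>)"
  moreover have "\<tau> = {x \<in> \<sigma>. \<iota> x \<in> \<iota> ` \<tau>}" using r assms by (auto dest: inj_onD)
  ultimately show "pface \<iota> \<tau> \<sigma>" unfolding pface_def by blast
qed

lemma eucl_complexD:
  assumes "eucl_complex \<iota> Q"
  shows complex_closed: "\<forall>\<sigma>\<in>Q. closed \<sigma>"
    and complex_Union: "\<Union>Q = UNIV"
    and complex_locfin: "\<exists>W. open W \<and> x \<in> W \<and> finite {\<sigma>\<in>Q. \<sigma> \<inter> W \<noteq> {}}"
    and complex_cells: "\<forall>\<sigma>\<in>Q. inj_on \<iota> \<sigma> \<and> polyhedron (\<iota> ` \<sigma>) \<and> (\<exists>g. homeomorphism \<sigma> (\<iota> ` \<sigma>) \<iota> g)"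
    and complex_faces: "\<forall>\<sigma>\<in>Q. \<forall>F. F face_of (\<iota> ` \<sigma>) \<longrightarrow> {x \<in> \<sigma>. \<iota> x \<in> F} \<in> Q"
    and complex_pface: "\<forall>\<sigma>\<in>Q. \<forall>\<tau>\<in>Q. pface \<iota> (\<sigma> \<inter> \<tau>) \<sigma> \<and> pface \<iota> (\<sigma> \<inter> \<tau>) \<tau>"
proof -
  note E = assms[unfolded eucl_complex_def]
  show "\<forall>\<sigma>\<in>Q. closed \<sigma>" by (rule E[THEN conjunct1])
  show "\<Union>Q = UNIV" by (rule E[THEN conjunct2, THEN conjunct1])
  show "\<exists>W. open W \<and> x \<in> W \<and> finite {\<sigma>\<in>Q. \<sigma> \<inter> W \<noteq> {}}"
    by (rule E[THEN conjunct2, THEN conjunct2, THEN conjunct1, THEN spec])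
  show "\<forall>\<sigma>\<in>Q. inj_on \<iota> \<sigma> \<and> polyhedron (\<iota> ` \<sigma>) \<and> (\<exists>g. homeomorphism \<sigma> (\<iota> ` \<sigma>) \<iota> g)"
    by (rule E[THEN conjunct2, THEN conjunct2, THEN conjunct2, THEN conjunct1])
  show "\<forall>\<sigma>\<in>Q. \<forall>F. F face_of (\<iota> ` \<sigma>) \<longrightarrow> {x \<in> \<sigma>. \<iota> x \<in> F} \<in> Q"
    by (rule E[THEN conjunct2, THEN conjunct2, THEN conjunct2, THEN conjunct2, THEN conjunct1])
  show "\<forall>\<sigma>\<in>Q. \<forall>\<tau>\<in>Q. pface \<iota> (\<sigma> \<inter> \<tau>) \<sigma> \<and> pface \<iota> (\<sigma> \<inter> \<tau>) \<tau>"
    by (rule E[THEN conjunct2, THEN conjunct2, THEN conjunct2, THEN conjunct2, THEN conjunct2])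
qed

lemma complex_cell:
  assumes "eucl_complex \<iota> Q" "\<sigma> \<in> Q"
  shows cell_closed: "closed \<sigma>" and cell_inj: "inj_on \<iota> \<sigma>" and cell_polyhedron: "polyhedron (\<iota> ` \<sigma>)"
    and cell_convex: "convex (\<iota> ` \<sigma>)" and cell_homeo: "\<exists>g. homeomorphism \<sigma> (\<iota> ` \<sigma>) \<iota> g"
proof -
  note * = bspec[OF complex_cells[OF assms(1)] assms(2)]
  show "closed \<sigma>" by (rule bspec[OF complex_closed[OF assms(1)] assms(2)])
  show "inj_on \<iota> \<sigma>" by (rule *[THEN conjunct1])
  show p: "polyhedron (\<iota> ` \<sigma>)" by (rule *[THEN conjunct2, THEN conjunct1])
  show "\<exists>g. homeomorphism \<sigma> (\<iota> ` \<sigma>) \<iota> g" by (rule *[THEN conjunct2, THEN conjunct2])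
  show "convex (\<iota> ` \<sigma>)" by (rule polyhedron_imp_convex[OF p])
qed

lemma complex_cover: "eucl_complex \<iota> Q \<Longrightarrow> \<exists>\<sigma>\<in>Q. x \<in> \<sigma>"
  using complex_Union by blast

lemma complex_face:
  "eucl_complex \<iota> Q \<Longrightarrow> \<sigma> \<in> Q \<Longrightarrow> F face_of (\<iota> ` \<sigma>) \<Longrightarrow> {x \<in> \<sigma>. \<iota> x \<in> F} \<in> Q"
  using complex_faces by blast

lemma complex_face_cell:
  assumes "eucl_complex \<iota> Q" "\<sigma> \<in> Q" "F face_of (\<iota> ` \<sigma>)"
  obtains \<tau> where "\<tau> \<in> Q" "\<tau> \<subseteq> \<sigma>" "\<iota> ` \<tau> = F"
proof -
  have "F \<subseteq> \<iota> ` \<sigma>" using assms(3) face_of_imp_subset by blast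
  then have "\<iota> ` {x \<in> \<sigma>. \<iota> x \<in> F} = F" by auto
  then show thesis using that complex_face[OF assms] by blast
qed

lemma complex_Int:
  assumes "eucl_complex \<iota> Q" "\<sigma> \<in> Q" "\<tau> \<in> Q"
  shows "(\<iota> ` (\<sigma> \<inter> \<tau>)) face_of (\<iota> ` \<sigma>)" "\<sigma> \<inter> \<tau> \<in> Q"
proof -
  have "pface \<iota> (\<sigma> \<inter> \<tau>) \<sigma>" using complex_pface[OF assms(1)] assms(2,3) by blast
  then show 1: "(\<iota> ` (\<sigma> \<inter> \<tau>)) face_of (\<iota> ` \<sigma>)" using pface_iff cell_inj[OF assms(1,2)] by blast
  have "{x \<in> \<sigma>. \<iota> x \<in> \<iota> ` (\<sigma> \<inter> \<tau>)} = \<sigma> \<inter> \<tau>" using cell_inj[OF assms(1,2)] by (auto dest: inj_onD)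
  then show "\<sigma> \<inter> \<tau> \<in> Q" using complex_face[OF assms(1,2) 1] by simp
qed

lemma cell_face: 
  assumes "eucl_complex \<iota> Q" "\<sigma> \<in> Q" "\<tau> \<in> Q" "\<tau> \<subseteq> \<sigma>"
  shows "(\<iota> ` \<tau>) face_of (\<iota> ` \<sigma>)"
  using complex_Int(1)[OF assms(1-3)] assms(4) by (simp add: Int_absorb1)

lemma cell_facet: 
  assumes "eucl_complex \<iota> Q" "\<sigma> \<in> Q" "\<tau> \<in> Q" "\<tau> \<subseteq> \<sigma>" "\<tau> \<noteq> {}" "pdim \<iota> \<sigma> = pdim \<iota> \<tau> + 1"
  shows "(\<iota> ` \<tau>) facet_of (\<iota> ` \<sigma>)"
  using cell_face[OF assms(1-4)] assms(5,6) by (simp add: facet_of_def pdim_def)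

lemma pdim_mono: "\<sigma> \<subseteq> \<tau> \<Longrightarrow> pdim \<iota> \<sigma> \<le> pdim \<iota> \<tau>"
  unfolding pdim_def by (intro aff_dim_subset image_mono)

lemma pdim_nonneg: "\<sigma> \<noteq> {} \<Longrightarrow> pdim \<iota> \<sigma> \<ge> 0"
  unfolding pdim_def using aff_dim_dirs[of "\<iota> ` \<sigma>"] by simp

lemma cell_eq_dim:
  assumes "eucl_complex \<iota> Q" "\<sigma> \<in> Q" "\<tau> \<in> Q" "\<tau> \<subseteq> \<sigma>" "pdim \<iota> \<tau> = pdim \<iota> \<sigma>"
  shows "\<tau> = \<sigma>"
proof -
  have "\<iota> ` \<tau> = \<iota> ` \<sigma>"
    using face_aff_dim_eq cell_convex[OF assms(1,2)] cell_face[OF assms(1-4)] assms(5) by (simp add: pdim_def)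
  then show ?thesis using cell_inj[OF assms(1,2)] assms(4) by (metis inj_on_image_eq_iff order_refl)
qed

text \<open>A point outside the relative interior lies on some facet, and there the dimension has
  dropped.\<close>

lemma polyhedron_point_face:
  assumes "polyhedron S" "v \<in> S"
  obtains G where "G face_of S" "v \<in> rel_interior (G::'v::euclidean_space set)"
proof -
  have "\<exists>G. G face_of S \<and> v \<in> rel_interior G" using assms
  proof (induction "nat (aff_dim S)" arbitrary: S rule: less_induct)
    case less
    show ?case
    proof (cases "v \<in> rel_interior S")
      case True then show ?thesis using face_of_refl polyhedron_imp_convex[OF less(2)] by blast
    next
      case False
      have "v \<in> rel_frontier S"
        using False less(2,3) by (simp add: rel_frontier_def polyhedron_imp_closed)
      then obtain F where F: "F facet_of S" "v \<in> F"
        using rel_frontier_of_polyhedron[OF less(2)] by blast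
      then have Ff: "F face_of S" by (simp add: facet_of_def)
      have "aff_dim F = aff_dim S - 1" using F by (simp add: facet_of_def)
      \<comment> \<open>F is nonempty, so its dimension is not -1 and the \<open>nat\<close> measure
        really decreases.\<close>
      moreover have "aff_dim F \<ge> 0" using F(2) aff_dim_dirs[of F] by force
      ultimately have "nat (aff_dim F) < nat (aff_dim S)" by simp
      from less(1)[OF this face_of_polyhedron_polyhedron[OF less(2) Ff] F(2)]
      show ?thesis using Ff face_of_trans by blast
    qed
  qed
  then show thesis using that by blast
qed

lemma mincell:
  assumes "eucl_complex \<iota> Q" "z \<in> \<sigma>" "\<sigma> \<in> Q"
  obtains \<rho> where "\<rho> \<in> Q" "z \<in> \<rho>" "\<rho> \<subseteq> \<sigma>" "\<iota> z \<in> rel_interior (\<iota> ` \<rho>)"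
proof -
  obtain G where G: "G face_of (\<iota> ` \<sigma>)" "\<iota> z \<in> rel_interior G"
    using polyhedron_point_face[OF cell_polyhedron[OF assms(1,3)]] assms(2) by blast
  obtain \<rho> where r: "\<rho> \<in> Q" "\<rho> \<subseteq> \<sigma>" "\<iota> ` \<rho> = G" using complex_face_cell[OF assms(1,3) G(1)] .
  have "\<iota> z \<in> \<iota> ` \<rho>" using G(2) r(3) rel_interior_subset by blast
  then have "z \<in> \<rho>" using cell_inj[OF assms(1,3)] assms(2) r(2) by (auto dest: inj_onD)
  then show thesis using that r G(2) by blast
qed

text \<open>\<rho> is only required to be a subset of a cell of Q, since it will be a cell of a
  subdivision. The face \<open>\<sigma>1 \<inter> \<sigma>\<close> of \<open>\<sigma>1\<close> meets
  the relative interior of \<rho> at z and therefore contains \<rho>.\<close>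

lemma mincell_sub:
  assumes "eucl_complex \<iota> Q" "\<rho> \<subseteq> \<sigma>1" "\<sigma>1 \<in> Q" "z \<in> \<rho>" "\<iota> z \<in> rel_interior (\<iota> ` \<rho>)" "\<sigma> \<in> Q" "z \<in> \<sigma>"
  shows "\<rho> \<subseteq> \<sigma>"
proof -
  have "\<iota> ` \<rho> \<subseteq> \<iota> ` (\<sigma>1 \<inter> \<sigma>)"
    by (rule subset_of_face_of[OF complex_Int(1)[OF assms(1,3,6)]]) (use assms in auto)
  then show ?thesis using cell_inj[OF assms(1,3)] assms(2) 
    by (metis Int_lower1 inj_on_image_subset_iff le_inf_iff)
qed

lemma finite_cells_at: assumes "eucl_complex \<iota> Q" shows "finite {\<sigma>\<in>Q. x \<in> \<sigma>}"
proof -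
  obtain W where W: "open W" "x \<in> W" "finite {\<sigma>\<in>Q. \<sigma> \<inter> W \<noteq> {}}" using complex_locfin[OF assms] by blast
  show ?thesis by (rule finite_subset[OF _ W(3)]) (use W in blast)
qed

lemma finite_cells_above: 
  assumes "eucl_complex \<iota> Q" "\<tau> \<noteq> {}" shows "finite {\<sigma>\<in>Q. \<tau> \<subseteq> \<sigma> \<and> P \<sigma>}"
proof -
  obtain x where "x \<in> \<tau>" using assms by blast
  then show ?thesis by (intro finite_subset[OF _ finite_cells_at[OF assms(1), of x]]) blast
qed

text \<open>Remove from a locally finite neighbourhood the finitely many closed cells that miss
  x.\<close>

lemma star_nbhd: 
  assumes "eucl_complex \<iota> Q"
  obtains N where "open N" "x \<in> N" "\<And>\<sigma>. \<sigma> \<in> Q \<Longrightarrow> \<sigma> \<inter> N \<noteq> {} \<Longrightarrow> x \<in> \<sigma>"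
proof -
  obtain W where W: "open W" "x \<in> W" "finite {\<sigma>\<in>Q. \<sigma> \<inter> W \<noteq> {}}" using complex_locfin[OF assms] by blast
  let ?B = "{\<sigma>\<in>Q. \<sigma> \<inter> W \<noteq> {} \<and> x \<notin> \<sigma>}"
  have f: "finite ?B" by (rule finite_subset[OF _ W(3)]) blast
  have "closed (\<Union>?B)" using f cell_closed[OF assms] by (intro closed_Union) auto
  then have "open (W - \<Union>?B)" using W(1) by blast
  moreover have "x \<in> W - \<Union>?B" using W(2) by blast
  moreover have "x \<in> \<sigma>" if "\<sigma> \<in> Q" "\<sigma> \<inter> (W - \<Union>?B) \<noteq> {}" for \<sigma> using that by blast
  ultimately show thesis using that by blast
qed

text \<open>The restrictions to cells are continuous, and the cells form a locally finite closed
  cover.\<close>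

lemma iota_continuous: assumes "eucl_complex \<iota> Q" shows "continuous_on UNIV \<iota>"
proof -
  have "continuous_map euclidean euclidean \<iota>"
  proof (rule pasting_lemma_locally_finite[where I = Q and T = "\<lambda>\<sigma>. \<sigma>" and f = "\<lambda>\<sigma>. \<iota>"])
    show "\<exists>V. openin euclidean V \<and> x \<in> V \<and> finite {i \<in> Q. i \<inter> V \<noteq> {}}" for x
      using complex_locfin[OF assms, of x] by simp
    show "closedin euclidean \<sigma>" if "\<sigma> \<in> Q" for \<sigma> using cell_closed[OF assms that] by simp
    show "continuous_map (top_of_set \<sigma>) euclidean \<iota>" if "\<sigma> \<in> Q" for \<sigma>
      using cell_homeo[OF assms that] homeomorphism_cont1 by (metis continuous_map_iff_continuous)
    show "\<exists>j. j \<in> Q \<and> x \<in> j \<and> \<iota> x = \<iota> x" for x using complex_cover[OF assms, of x] by blast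
  qed auto
  then show ?thesis by simp
qed

text \<open>Injectivity of \<iota> is available on single cells only, so closeness of images is
  tested within one cell, where \<iota> is open onto its image.\<close>

lemma cell_near:
  assumes "eucl_complex \<iota> Q" "\<sigma> \<in> Q" "x \<in> \<sigma>" "open W" "x \<in> W"
  obtains \<delta> where "\<delta> > 0" "\<And>z. z \<in> \<sigma> \<Longrightarrow> dist (\<iota> z) (\<iota> x) \<le> \<delta> \<Longrightarrow> z \<in> W"
proof -
  obtain g where g: "homeomorphism \<sigma> (\<iota> ` \<sigma>) \<iota> g" using cell_homeo[OF assms(1,2)] by blast
  have "openin (top_of_set \<sigma>) (\<sigma> \<inter> W)" using assms(4) by (simp add: openin_open_Int)
  then have "openin (top_of_set (\<iota> ` \<sigma>)) (\<iota> ` (\<sigma> \<inter> W))"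
    using homeomorphism_imp_open_map[OF g] by blast
  then obtain e where e: "e > 0" "\<And>v. v \<in> \<iota> ` \<sigma> \<Longrightarrow> dist v (\<iota> x) < e \<Longrightarrow> v \<in> \<iota> ` (\<sigma> \<inter> W)"
    using assms(3,5) unfolding openin_euclidean_subtopology_iff by (metis IntI imageI)
  have "z \<in> W" if "z \<in> \<sigma>" "dist (\<iota> z) (\<iota> x) \<le> e / 2" for z
  proof -
    have "\<iota> z \<in> \<iota> ` (\<sigma> \<inter> W)" using that e by force
    then show ?thesis using that cell_inj[OF assms(1,2)] by (auto dest: inj_onD)
  qed
  then show thesis using that[of "e/2"] e by simp
qed

lemma cell_segment_near:
  assumes "eucl_complex \<iota> Q" "\<sigma> \<in> Q" "x \<in> \<sigma>" "open W" "x \<in> W" "z \<in> \<sigma>"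
  obtains l y where "l > 0" "l \<le> 1" "y \<in> \<sigma> \<inter> W" "\<iota> y = \<iota> x + l *\<^sub>R (\<iota> z - \<iota> x)"
proof -
  obtain \<delta> where d: "\<delta> > 0" "\<And>z. z \<in> \<sigma> \<Longrightarrow> dist (\<iota> z) (\<iota> x) \<le> \<delta> \<Longrightarrow> z \<in> W"
    using cell_near[OF assms(1-5)] by blast
  \<comment> \<open>The summand 1 keeps the denominator positive when z and x have the same
    image.\<close>
  define l where "l = min 1 (\<delta> / (norm (\<iota> z - \<iota> x) + 1))"
  have n: "norm (\<iota> z - \<iota> x) + 1 > 0" by (simp add: add_nonneg_pos)
  have l: "l > 0" "l \<le> 1" using d n by (auto simp: l_def)
  have "l * norm (\<iota> z - \<iota> x) \<le> \<delta> / (norm (\<iota> z - \<iota> x) + 1) * norm (\<iota> z - \<iota> x)"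
    by (intro mult_right_mono) (auto simp: l_def)
  also have "\<dots> \<le> \<delta>" using d n by (simp add: field_simps)
  finally have ld: "l * norm (\<iota> z - \<iota> x) \<le> \<delta>" .
  have "(1 - l) *\<^sub>R \<iota> x + l *\<^sub>R \<iota> z \<in> \<iota> ` \<sigma>"
    using cell_convex[OF assms(1,2)] assms(3,6) l by (intro convexD) auto
  moreover have "(1 - l) *\<^sub>R \<iota> x + l *\<^sub>R \<iota> z = \<iota> x + l *\<^sub>R (\<iota> z - \<iota> x)" by (simp add: algebra_simps)
  ultimately obtain y where y: "y \<in> \<sigma>" "\<iota> y = \<iota> x + l *\<^sub>R (\<iota> z - \<iota> x)" by auto
  then have "y \<in> W" using d(2)[OF y(1)] ld l by (simp add: dist_norm)
  then show thesis using that l y by blast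
qed

text \<open>\<open>lin_piece\<close> is a choice constrained only by values on \<sigma> \<inter> W.
  Shrinking segments towards a point of W shows that its values on the cell and on the directions of
  the cell do not depend on the choice.\<close>

lemma linear_agree:
  assumes "eucl_complex \<iota> Q" "\<sigma> \<in> Q" "open W" "\<sigma> \<inter> W \<noteq> {}" "linear l" "linear (l'::_ \<Rightarrow> real)"
    and eq: "\<And>x. x \<in> \<sigma> \<inter> W \<Longrightarrow> l (\<iota> x) = l' (\<iota> x)"
  shows "\<And>z. z \<in> \<sigma> \<Longrightarrow> l (\<iota> z) = l' (\<iota> z)" "\<And>v. v \<in> dirs (\<iota> ` \<sigma>) \<Longrightarrow> l v = l' v"
proof -
  interpret l: linear l by fact
  interpret l': linear l' by fact
  obtain x where x: "x \<in> \<sigma>" "x \<in> W" using assms(4) by blast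
  show 1: "l (\<iota> z) = l' (\<iota> z)" if z: "z \<in> \<sigma>" for z
  proof -
    obtain s y where s: "s > 0" "y \<in> \<sigma> \<inter> W" "\<iota> y = \<iota> x + s *\<^sub>R (\<iota> z - \<iota> x)"
      using cell_segment_near[OF assms(1,2) x(1) assms(3) x(2) z] by blast
    have "l (\<iota> y) = l' (\<iota> y)" "l (\<iota> x) = l' (\<iota> x)" using eq s x by blast+
    then show ?thesis unfolding s(3) using s(1)
      by (simp add: l.add l'.add l.scale l'.scale l.diff l'.diff)
  qed
  show "l v = l' v" if "v \<in> dirs (\<iota> ` \<sigma>)" for v
  proof -
    have "subspace {v. l v = l' v}"
      by (auto simp: subspace_def l.add l'.add l.scale l'.scale l.zero l'.zero)
    moreover have "{y - z | y z. y \<in> \<iota> ` \<sigma> \<and> z \<in> \<iota> ` \<sigma>} \<subseteq> {v. l v = l' v}"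
      using 1 by (auto simp: l.diff l'.diff)
    ultimately have "dirs (\<iota> ` \<sigma>) \<subseteq> {v. l v = l' v}" unfolding dirs_def by (rule span_minimal[rotated])
    then show ?thesis using that by blast
  qed
qed

text \<open>If p avoids A and q avoids all other members, no member contains the line through p and
  q, so each meets it in at most one point; finitely many points do not cover a segment.\<close>

lemma finite_affine_cover:
  assumes "finite \<A>" "convex S" "S \<noteq> {}" "\<And>A. A \<in> \<A> \<Longrightarrow> affine A" "S \<subseteq> \<Union>\<A>"
  shows "\<exists>A\<in>\<A>. S \<subseteq> (A::'v::euclidean_space set)"
  using assms
proof (induction \<A> rule: finite_induct)
  case empty then show ?case by auto
next
  case (insert A \<A>)
  show ?case
  proof (rule ccontr)
    assume c: "\<not> ?case"
    then obtain p where p: "p \<in> S" "p \<notin> A" by blast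
    have "\<not> S \<subseteq> \<Union>\<A>" using insert c by blast
    then obtain q where q: "q \<in> S" "q \<notin> \<Union>\<A>" by blast
    define f where "f t = (1 - t) *\<^sub>R p + t *\<^sub>R q" for t :: real
    have "{0<..<1::real} \<subseteq> (\<Union>B\<in>insert A \<A>. {t. f t \<in> B \<and> 0 < t \<and> t < 1})"
    proof
      fix t :: real assume t: "t \<in> {0<..<1}"
      then have "f t \<in> S" unfolding f_def using insert.prems(1) p q by (intro convexD) auto
      then obtain B where "B \<in> insert A \<A>" "f t \<in> B" using insert.prems(4) by blast
      then show "t \<in> (\<Union>B\<in>insert A \<A>. {t. f t \<in> B \<and> 0 < t \<and> t < 1})" using t by simp blast
    qed
    moreover have "finite {t. f t \<in> B \<and> 0 < t \<and> t < 1}" if B: "B \<in> insert A \<A>" for B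
    proof -
      have aff: "affine B" using B insert.prems(3) by blast
      have eq: "t = t'" if t: "f t \<in> B" "f t' \<in> B" for t t'
      proof (rule ccontr)
        assume ne: "t \<noteq> t'"
        have "f s \<in> B" for s
        proof -
          \<comment> \<open>The affine parameter of \<open>f s\<close> on the line through
            \<open>f t\<close> and \<open>f t'\<close>.\<close>
          define c where "c = (s - t) / (t' - t)"
          have "(1 - c) *\<^sub>R f t + c *\<^sub>R f t' \<in> B" using t aff by (auto simp: affine_def)
          moreover have "(1 - c) *\<^sub>R f t + c *\<^sub>R f t' = f ((1 - c) * t + c * t')"
            unfolding f_def by (simp add: algebra_simps)
          moreover have "(1 - c) * t + c * t' = s"
          proof -
            have "(1 - c) * t + c * t' = t + c * (t' - t)" by (simp add: algebra_simps)
            then show ?thesis using ne by (simp add: c_def)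
          qed
          ultimately show ?thesis by simp
        qed
        from this[of 0] this[of 1] have "p \<in> B" "q \<in> B" by (auto simp: f_def)
        then show False using p q B by blast
      qed
      show ?thesis
      proof (cases "\<exists>a. f a \<in> B")
        case True
        then obtain a where "f a \<in> B" by blast
        then have "{t. f t \<in> B \<and> 0 < t \<and> t < 1} \<subseteq> {a}" using eq by blast
        then show ?thesis by (rule finite_subset) simp
      next
        case False
        then show ?thesis by simp
      qed
    qed
    ultimately have "finite {0<..<1::real}" 
      using insert.hyps(1) by (elim finite_subset) (intro finite_UN_I, simp)
    then show False by (simp add: infinite_Ioo)
  qed
qed

text \<open>The cells through \<^term>\<open>y\<close> cover a neighbourhood of it, and a convex set covered by
  finitely many affine subspaces lies in one of them.\<close>

lemma subdiv_full_dim: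
  assumes Q: "eucl_complex \<iota> Q" and Q': "eucl_complex \<iota> Q'" and sd: "subdiv Q' Q" and \<sigma>: "\<sigma> \<in> Q" "y \<in> \<sigma>"
  obtains \<sigma>' where "\<sigma>' \<in> Q'" "y \<in> \<sigma>'" "\<sigma>' \<subseteq> \<sigma>" "pdim \<iota> \<sigma>' = pdim \<iota> \<sigma>"
proof -
  obtain N where N: "open N" "y \<in> N" "\<And>\<sigma>. \<sigma> \<in> Q' \<Longrightarrow> \<sigma> \<inter> N \<noteq> {} \<Longrightarrow> y \<in> \<sigma>"
    using star_nbhd[OF Q'] by blast
  obtain \<delta> where d: "\<delta> > 0" "\<And>z. z \<in> \<sigma> \<Longrightarrow> dist (\<iota> z) (\<iota> y) \<le> \<delta> \<Longrightarrow> z \<in> N"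
    using cell_near[OF Q \<sigma> N(1,2)] by blast
  define S where "S = \<iota> ` \<sigma> \<inter> ball (\<iota> y) \<delta>"
  have c: "convex (\<iota> ` \<sigma>)" using cell_convex[OF Q \<sigma>(1)] .
  have S: "convex S" "S \<noteq> {}" using c d(1) \<sigma>(2) by (auto simp: S_def intro!: convex_Int exI[of _ "\<iota> y"])
  have dimS: "aff_dim S = pdim \<iota> \<sigma>" unfolding S_def pdim_def using c S(2) by (intro aff_dim_convex_Int_open) (auto simp: S_def)
  let ?F = "{\<sigma>' \<in> Q'. y \<in> \<sigma>' \<and> \<sigma>' \<subseteq> \<sigma>}"
  have fin: "finite ?F" by (rule finite_subset[OF _ finite_cells_at[OF Q', of y]]) blast
  have "S \<subseteq> \<Union>((\<lambda>\<sigma>'. affine hull (\<iota> ` \<sigma>')) ` ?F)"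
  proof
    fix v assume v: "v \<in> S"
    then obtain z where z: "z \<in> \<sigma>" "v = \<iota> z" "dist (\<iota> z) (\<iota> y) < \<delta>" by (auto simp: S_def dist_commute)
    have zN: "z \<in> N" using d z by simp
    obtain \<sigma>0 where "\<sigma>0 \<in> Q'" "z \<in> \<sigma>0" using complex_cover[OF Q'] by blast
    then obtain \<rho> where r: "\<rho> \<in> Q'" "z \<in> \<rho>" "\<iota> z \<in> rel_interior (\<iota> ` \<rho>)" using mincell[OF Q'] by metis
    obtain \<sigma>1 where s1: "\<sigma>1 \<in> Q" "\<rho> \<subseteq> \<sigma>1" using sd r unfolding subdiv_def by blast
    have "\<rho> \<subseteq> \<sigma>" using mincell_sub[OF Q s1(2,1) r(2,3) \<sigma>(1) z(1)] .
    moreover have "y \<in> \<rho>" using N(3)[OF r(1)] r(2) zN by blast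
    moreover have "v \<in> affine hull (\<iota> ` \<rho>)" using z r(2) by (simp add: hull_inc)
    ultimately show "v \<in> \<Union>((\<lambda>\<sigma>'. affine hull (\<iota> ` \<sigma>')) ` ?F)" using r(1) by blast
  qed
  then have "\<exists>A\<in>(\<lambda>\<sigma>'. affine hull (\<iota> ` \<sigma>')) ` ?F. S \<subseteq> A"
    using fin S by (intro finite_affine_cover) auto
  then obtain \<sigma>' where s: "\<sigma>' \<in> Q'" "y \<in> \<sigma>'" "\<sigma>' \<subseteq> \<sigma>" "S \<subseteq> affine hull (\<iota> ` \<sigma>')" by blast
  have "pdim \<iota> \<sigma> \<le> pdim \<iota> \<sigma>'"
    using aff_dim_subset[OF s(4)] dimS by (simp add: pdim_def)
  then have "pdim \<iota> \<sigma>' = pdim \<iota> \<sigma>" using pdim_mono[OF s(3), of \<iota>] by simp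
  then show thesis using that s by blast
qed

text \<open>The choice in \<open>pullback\<close> is forced: two cells of the dimension of
  \<open>\<sigma>'\<close> that contain it meet in a face of that same dimension, hence
  coincide.\<close>

lemma pullback_eq:
  assumes Q: "eucl_complex \<iota> Q" and "\<sigma>' \<noteq> {}" "\<sigma> \<in> Q" "\<sigma>' \<subseteq> \<sigma>" "pdim \<iota> \<sigma> = pdim \<iota> \<sigma>'"
  shows "pullback \<iota> Q c \<sigma>' = c \<sigma>"
proof -
  have "\<sigma>1 = \<sigma>" if "\<sigma>1 \<in> Q" "\<sigma>' \<subseteq> \<sigma>1" "pdim \<iota> \<sigma>1 = pdim \<iota> \<sigma>'" for \<sigma>1
  proof -
    have I: "\<sigma> \<inter> \<sigma>1 \<in> Q" using complex_Int(2)[OF Q assms(3) that(1)] .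
    have "pdim \<iota> \<sigma>' \<le> pdim \<iota> (\<sigma> \<inter> \<sigma>1)" using assms(4) that by (intro pdim_mono) blast
    moreover have "pdim \<iota> (\<sigma> \<inter> \<sigma>1) \<le> pdim \<iota> \<sigma>" by (intro pdim_mono) blast
    ultimately have e: "pdim \<iota> (\<sigma> \<inter> \<sigma>1) = pdim \<iota> \<sigma>" "pdim \<iota> (\<sigma> \<inter> \<sigma>1) = pdim \<iota> \<sigma>1"
      using assms(5) that(3) by linarith+
    have "\<sigma> \<inter> \<sigma>1 = \<sigma>" using cell_eq_dim[OF Q assms(3) I _ e(1)] by blast
    moreover have "\<sigma> \<inter> \<sigma>1 = \<sigma>1" using cell_eq_dim[OF Q that(1) I _ e(2)] by blast
    ultimately show ?thesis by simp
  qed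
  then have S: "(SOME s. s \<in> Q \<and> \<sigma>' \<subseteq> s \<and> pdim \<iota> s = pdim \<iota> \<sigma>') = \<sigma>"
    using assms(3-5) by (intro some_equality) blast+
  have "\<exists>\<sigma>\<in>Q. \<sigma>' \<subseteq> \<sigma> \<and> pdim \<iota> \<sigma> = pdim \<iota> \<sigma>'" using assms(3-5) by blast
  then show ?thesis unfolding pullback_def S by simp
qed

lemma pullback_zero: "\<not> (\<exists>\<sigma>\<in>Q. \<sigma>' \<subseteq> \<sigma> \<and> pdim \<iota> \<sigma> = pdim \<iota> \<sigma>') \<Longrightarrow> pullback \<iota> Q c \<sigma>' = 0"
  unfolding pullback_def by (rule if_not_P)

lemma in_class_complex: "in_class \<iota> Q0 Q \<Longrightarrow> eucl_complex \<iota> Q"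
  unfolding in_class_def by blast

lemma subdiv_refl: "subdiv Q Q"
  unfolding subdiv_def by blast

lemma subdiv_trans: "subdiv Q Q' \<Longrightarrow> subdiv Q' Q'' \<Longrightarrow> subdiv Q Q''"
  unfolding subdiv_def by (meson order_trans)

lemma cyc_eq_refl: "in_class \<iota> Q0 Q \<Longrightarrow> cyc_eq \<iota> Q0 W k Q c Q c"
  unfolding cyc_eq_def using subdiv_refl by blast

lemma pos_cycle_refl:
  "in_class \<iota> Q0 Q \<Longrightarrow> minkowski \<iota> Q W k c \<Longrightarrow> (\<And>\<sigma>. \<sigma> \<in> restr \<iota> Q W k \<Longrightarrow> c \<sigma> \<ge> 0) \<Longrightarrow> pos_cycle \<iota> Q0 W k Q c"
  unfolding pos_cycle_def by (intro exI[of _ Q] exI[of _ c] conjI ballI cyc_eq_refl)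

text \<open>Positivity of a cycle shows on each of its weights: every cell contains a cell of full
  dimension of the common subdivision, and there both pullbacks agree.\<close>

lemma pos_cycle_nonneg:
  assumes "pos_cycle \<iota> Q0 W k Q c" "eucl_complex \<iota> Q" "\<sigma> \<in> restr \<iota> Q W k"
  shows "c \<sigma> \<ge> 0"
proof -
  from assms(1) obtain Q1 c1 where 1: "in_class \<iota> Q0 Q1" "\<forall>\<sigma>\<in>restr \<iota> Q1 W k. c1 \<sigma> \<ge> 0"
    "cyc_eq \<iota> Q0 W k Q c Q1 c1"
    unfolding pos_cycle_def by (elim exE conjE) (rule that)
  from 1(3) obtain Q2 where 2: "in_class \<iota> Q0 Q2" "subdiv Q2 Q" "subdiv Q2 Q1"
    "\<forall>\<sigma>\<in>restr \<iota> Q2 W k. pullback \<iota> Q c \<sigma> = pullback \<iota> Q1 c1 \<sigma>"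
    unfolding cyc_eq_def by (elim exE conjE) (rule that)
  note * = 1(1) bspec[OF 1(2)] 2(1-3) bspec[OF 2(4)]
  have s: "\<sigma> \<in> Q" "\<sigma> \<inter> W \<noteq> {}" "pdim \<iota> \<sigma> = k" using assms(3) by (auto simp: restr_def)
  then obtain y where y: "y \<in> \<sigma>" "y \<in> W" by blast
  obtain \<rho> where r: "\<rho> \<in> Q2" "y \<in> \<rho>" "\<rho> \<subseteq> \<sigma>" "pdim \<iota> \<rho> = pdim \<iota> \<sigma>"
    using subdiv_full_dim[OF assms(2) in_class_complex[OF *(3)] *(4) s(1) y(1)] .
  have "pullback \<iota> Q c \<rho> = c \<sigma>" using pullback_eq[OF assms(2) _ s(1) r(3)] r by auto
  moreover have "\<rho> \<in> restr \<iota> Q2 W k" using r y s by (auto simp: restr_def)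
  moreover have "pullback \<iota> Q1 c1 \<rho> \<ge> 0"
  proof (cases "\<exists>\<sigma>\<in>Q1. \<rho> \<subseteq> \<sigma> \<and> pdim \<iota> \<sigma> = pdim \<iota> \<rho>")
    case True
    then obtain \<sigma>1 where s1: "\<sigma>1 \<in> Q1" "\<rho> \<subseteq> \<sigma>1" "pdim \<iota> \<sigma>1 = pdim \<iota> \<rho>" by blast
    then have "pullback \<iota> Q1 c1 \<rho> = c1 \<sigma>1" using pullback_eq[OF in_class_complex[OF *(1)]] r by blast
    moreover have "\<sigma>1 \<in> restr \<iota> Q1 W k" using s1 r s y by (auto simp: restr_def)
    ultimately show ?thesis using *(2) by simp
  next
    case False then show ?thesis by (simp add: pullback_zero[OF False])
  qed
  ultimately show ?thesis using *(6) by simp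
qed

section \<open>Refinement by hyperplanes\<close>

text \<open>The bounding hyperplane is a member so that nonempty faces of members are again
  members.\<close>

definition halves :: "'v::euclidean_space \<times> real \<Rightarrow> 'v set set" where
  "halves h = {{v. fst h \<bullet> v \<le> snd h}, {v. fst h \<bullet> v \<ge> snd h}, {v. fst h \<bullet> v = snd h}}"

definition split_by :: "('x \<Rightarrow> 'v::euclidean_space) \<Rightarrow> 'v \<times> real \<Rightarrow> 'x set set \<Rightarrow> 'x set set" where
  "split_by \<iota> h Q = {\<sigma> \<inter> \<iota> -` H | \<sigma> H. \<sigma> \<in> Q \<and> H \<in> halves h}"

definition refine :: "('x \<Rightarrow> 'v::euclidean_space) \<Rightarrow> ('v \<times> real) list \<Rightarrow> 'x set set \<Rightarrow> 'x set set" where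
  "refine \<iota> hs Q = foldr (split_by \<iota>) hs Q"

lemma split_byI: "\<sigma> \<in> Q \<Longrightarrow> H \<in> halves h \<Longrightarrow> \<sigma> \<inter> \<iota> -` H \<in> split_by \<iota> h Q"
  unfolding split_by_def mem_Collect_eq by (intro exI[of _ \<sigma>] exI[of _ H] conjI refl)

lemma split_byE:
  assumes "\<rho> \<in> split_by \<iota> h Q"
  obtains \<sigma> H where "\<rho> = \<sigma> \<inter> \<iota> -` H" "\<sigma> \<in> Q" "H \<in> halves h"
  using assms unfolding split_by_def mem_Collect_eq by (elim exE conjE) (rule that)

text \<open>Let y be relatively interior to F, and take the faces G of S and H of T with y in their
  relative interiors. Then y is relatively interior to G \<inter> H, so the face F contains G
  \<inter> H; conversely G and H contain F for the same reason.\<close>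

lemma face_of_Int_decomp:
  fixes S T :: "'v::euclidean_space set"
  assumes "polyhedron S" "polyhedron T" "F face_of (S \<inter> T)" "F \<noteq> {}"
  obtains G H where "G face_of S" "H face_of T" "F = G \<inter> H"
proof -
  have FS: "F \<subseteq> S" "F \<subseteq> T" using face_of_imp_subset[OF assms(3)] by auto
  obtain y where y: "y \<in> rel_interior F"
    using rel_interior_eq_empty[OF face_of_imp_convex[OF assms(3)]] assms(4) by blast
  then have yF: "y \<in> F" using rel_interior_subset by blast
  obtain G where G: "G face_of S" "y \<in> rel_interior G"
    using polyhedron_point_face[OF assms(1)] yF FS by blast
  obtain H where H: "H face_of T" "y \<in> rel_interior H"
    using polyhedron_point_face[OF assms(2)] yF FS by blast
  have yGH: "y \<in> G" "y \<in> H" using G H rel_interior_subset by blast+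
  have c: "convex G" "convex H" using G H face_of_imp_convex by blast+
  have "F \<subseteq> G" by (rule subset_of_face_of[OF G(1) FS(1)]) (use y yGH in blast)
  moreover have "F \<subseteq> H" by (rule subset_of_face_of[OF H(1) FS(2)]) (use y yGH in blast)
  moreover have "G \<inter> H \<subseteq> F"
  proof (rule subset_of_face_of[OF assms(3)])
    show "G \<inter> H \<subseteq> S \<inter> T" using face_of_imp_subset[OF G(1)] face_of_imp_subset[OF H(1)] by blast
    have "rel_interior (G \<inter> H) = rel_interior G \<inter> rel_interior H"
      using c G H by (intro convex_rel_interior_inter_two) auto
    then show "F \<inter> rel_interior (G \<inter> H) \<noteq> {}" using yF G H by blast
  qed
  ultimately show thesis using that G(1) H(1) by blast
qed

lemma halves_cases:
  assumes "H \<in> halves h"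
  obtains "H = {v. fst h \<bullet> v \<le> snd h}" | "H = {v. fst h \<bullet> v \<ge> snd h}" | "H = {v. fst h \<bullet> v = snd h}"
  using assms unfolding halves_def by blast

lemma polyhedron_halves: "H \<in> halves h \<Longrightarrow> polyhedron H"
  by (erule halves_cases) (auto simp: polyhedron_halfspace_le polyhedron_halfspace_ge polyhedron_hyperplane)

lemma closed_halves: "H \<in> halves h \<Longrightarrow> closed H"
  using polyhedron_halves polyhedron_imp_closed by blast

lemma hyperplane_face_halves: 
  assumes "H \<in> halves h" shows "{v. fst h \<bullet> v = snd h} face_of H"
  using assms by (cases rule: halves_cases) (auto simp: face_of_halfspace_le face_of_halfspace_ge face_of_refl_eq convex_hyperplane)

lemma face_of_halves:
  assumes "H \<in> halves h" "F face_of H" "F \<noteq> {}" shows "F \<in> halves h"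
  using assms(1)
proof (cases rule: halves_cases)
  case 1 then show ?thesis using assms by (auto simp: face_of_halfspace_le halves_def)
next
  case 2 then show ?thesis using assms by (auto simp: face_of_halfspace_ge halves_def)
next
  case 3
  have "F = {} \<or> F = H" using assms(2) face_of_affine_eq[of H F] affine_hyperplane unfolding 3 by blast
  then show ?thesis using assms by blast
qed

lemma halves_Int_face:
  assumes "H \<in> halves h" "K \<in> halves h" shows "(H \<inter> K) face_of H"
proof -
  have "H \<inter> K = H \<or> H \<inter> K = {v. fst h \<bullet> v = snd h}"
    using assms by (elim halves_cases) auto
  then show ?thesis using hyperplane_face_halves[OF assms(1)] face_of_refl polyhedron_imp_convex[OF polyhedron_halves[OF assms(1)]]
    by metis
qed

text \<open>Faces of a piece are pieces of faces by \<open>face_of_Int_decomp\<close>, and two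
  pieces meet in a common face because both the cells and the members of \<open>halves\<close>
  do.\<close>

lemma eucl_complex_split:
  assumes Q: "eucl_complex \<iota> Q" shows "eucl_complex \<iota> (split_by \<iota> h Q)"
  unfolding eucl_complex_def
proof (intro conjI ballI allI impI)
  let ?S = "split_by \<iota> h Q"
  have img: "\<iota> ` (\<sigma> \<inter> \<iota> -` H) = \<iota> ` \<sigma> \<inter> H" for \<sigma> H by auto
  have cont: "continuous_on UNIV \<iota>" using iota_continuous[OF Q] .
  show "closed \<rho>" if r: "\<rho> \<in> ?S" for \<rho>
  proof -
    obtain \<sigma> H where \<rho>: "\<rho> = \<sigma> \<inter> \<iota> -` H" "\<sigma> \<in> Q" "H \<in> halves h" using r by (rule split_byE)
    show ?thesis unfolding \<rho>(1)
      using cell_closed[OF Q \<rho>(2)] closed_vimage[OF closed_halves[OF \<rho>(3)] cont] by (rule closed_Int)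
  qed
  show "\<Union>?S = UNIV"
  proof -
    have "x \<in> \<Union>?S" for x
    proof -
      obtain \<sigma> where s: "\<sigma> \<in> Q" "x \<in> \<sigma>" using complex_cover[OF Q] by blast
      have "\<exists>H\<in>halves h. \<iota> x \<in> H"
      proof (cases "fst h \<bullet> \<iota> x \<le> snd h")
        case True then show ?thesis by (intro bexI[of _ "{v. fst h \<bullet> v \<le> snd h}"]) (auto simp: halves_def)
      next
        case False then show ?thesis by (intro bexI[of _ "{v. fst h \<bullet> v \<ge> snd h}"]) (auto simp: halves_def)
      qed
      then obtain H where "H \<in> halves h" "\<iota> x \<in> H" by blast
      then have "\<sigma> \<inter> \<iota> -` H \<in> ?S" "x \<in> \<sigma> \<inter> \<iota> -` H" using s split_byI[of \<sigma> Q H h \<iota>] by blast+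
      then show ?thesis by blast
    qed
    then show ?thesis by blast
  qed
  show "\<exists>W. open W \<and> x \<in> W \<and> finite {\<rho>\<in>?S. \<rho> \<inter> W \<noteq> {}}" for x
  proof -
    obtain W where W: "open W" "x \<in> W" "finite {\<sigma>\<in>Q. \<sigma> \<inter> W \<noteq> {}}" using complex_locfin[OF Q] by blast
    have "{\<rho>\<in>?S. \<rho> \<inter> W \<noteq> {}} \<subseteq> (\<lambda>(\<sigma>, H). \<sigma> \<inter> \<iota> -` H) ` ({\<sigma>\<in>Q. \<sigma> \<inter> W \<noteq> {}} \<times> halves h)"
    proof
      fix \<rho> assume "\<rho> \<in> {\<rho>\<in>?S. \<rho> \<inter> W \<noteq> {}}"
      then have "\<rho> \<in> ?S" and rW: "\<rho> \<inter> W \<noteq> {}" by blast+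
      from this(1) obtain \<sigma> H where r: "\<rho> = \<sigma> \<inter> \<iota> -` H" "\<sigma> \<in> Q" "H \<in> halves h"
        by (rule split_byE)
      then show "\<rho> \<in> (\<lambda>(\<sigma>, H). \<sigma> \<inter> \<iota> -` H) ` ({\<sigma>\<in>Q. \<sigma> \<inter> W \<noteq> {}} \<times> halves h)"
        using rW by (intro image_eqI[of _ _ "(\<sigma>, H)"]) auto
    qed
    moreover have "finite (halves h)" by (simp add: halves_def)
    ultimately have "finite {\<rho>\<in>?S. \<rho> \<inter> W \<noteq> {}}" using W(3) by (elim finite_subset) (intro finite_imageI finite_SigmaI)
    then show ?thesis using W by blast
  qed
  fix \<rho> assume "\<rho> \<in> ?S"
  then obtain \<sigma> H where \<rho>: "\<rho> = \<sigma> \<inter> \<iota> -` H" "\<sigma> \<in> Q" "H \<in> halves h" by (rule split_byE)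
  have inj: "inj_on \<iota> \<sigma>" using cell_inj[OF Q \<rho>(2)] .
  show "inj_on \<iota> \<rho>" using inj_on_subset[OF inj] \<rho>(1) by blast
  show "polyhedron (\<iota> ` \<rho>)" unfolding \<rho>(1) img
    using cell_polyhedron[OF Q \<rho>(2)] polyhedron_halves[OF \<rho>(3)] by (rule polyhedron_Int)
  obtain g where "homeomorphism \<sigma> (\<iota> ` \<sigma>) \<iota> g" using cell_homeo[OF Q \<rho>(2)] by blast
  then have "homeomorphism \<rho> (\<iota> ` \<rho>) \<iota> g" by (rule homeomorphism_of_subsets) (use \<rho>(1) in auto)
  then show "\<exists>g. homeomorphism \<rho> (\<iota> ` \<rho>) \<iota> g" by blast
  show "{x \<in> \<rho>. \<iota> x \<in> F} \<in> ?S" if Ff: "F face_of (\<iota> ` \<rho>)" for F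
  proof (cases "F = {}")
    case True
    \<comment> \<open>\<open>face_of_Int_decomp\<close> concerns nonempty faces; the empty one comes
      from the empty face of \<sigma>.\<close>
    have "{x \<in> \<sigma>. \<iota> x \<in> {}} \<in> Q" by (rule complex_face[OF Q \<rho>(2)]) simp
    then have "{} \<in> Q" by simp
    then have "{} \<inter> \<iota> -` H \<in> ?S" using \<rho>(3) by (intro split_byI)
    then show ?thesis using True by simp
  next
    case False
    obtain G K where GK: "G face_of (\<iota> ` \<sigma>)" "K face_of H" "F = G \<inter> K"
      using face_of_Int_decomp[OF cell_polyhedron[OF Q \<rho>(2)] polyhedron_halves[OF \<rho>(3)] _ False]
        Ff unfolding \<rho>(1) img by blast
    have "K \<in> halves h" using face_of_halves[OF \<rho>(3) GK(2)] False GK(3) by blast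
    moreover have "{x \<in> \<sigma>. \<iota> x \<in> G} \<in> Q" using complex_face[OF Q \<rho>(2) GK(1)] .
    moreover have "{x \<in> \<rho>. \<iota> x \<in> F} = {x \<in> \<sigma>. \<iota> x \<in> G} \<inter> \<iota> -` K"
      using GK(3) face_of_imp_subset[OF GK(2)] \<rho>(1) by blast
    ultimately show ?thesis using split_byI[of "{x \<in> \<sigma>. \<iota> x \<in> G}" Q K h \<iota>] by simp
  qed
  have pf: "pface \<iota> (\<rho>1 \<inter> \<rho>2) \<rho>1" if r: "\<rho>1 \<in> ?S" "\<rho>2 \<in> ?S" for \<rho>1 \<rho>2
  proof -
    obtain \<sigma>1 H1 where 1: "\<rho>1 = \<sigma>1 \<inter> \<iota> -` H1" "\<sigma>1 \<in> Q" "H1 \<in> halves h" using r(1) by (rule split_byE)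
    obtain \<sigma>2 H2 where 2: "\<rho>2 = \<sigma>2 \<inter> \<iota> -` H2" "\<sigma>2 \<in> Q" "H2 \<in> halves h" using r(2) by (rule split_byE)
    have f: "(\<iota> ` (\<sigma>1 \<inter> \<sigma>2) \<inter> (H1 \<inter> H2)) face_of (\<iota> ` \<sigma>1 \<inter> H1)"
      by (rule face_of_Int_Int[OF complex_Int(1)[OF Q 1(2) 2(2)] halves_Int_face[OF 1(3) 2(3)]])
    have "\<rho>1 \<inter> \<rho>2 = {x \<in> \<rho>1. \<iota> x \<in> \<iota> ` (\<sigma>1 \<inter> \<sigma>2) \<inter> (H1 \<inter> H2)}"
      using cell_inj[OF Q 1(2)] unfolding 1(1) 2(1) by (auto dest: inj_onD)
    then show ?thesis unfolding pface_def using f 1(1) img by metis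
  qed
  fix \<tau> assume t: "\<tau> \<in> ?S"
  show "pface \<iota> (\<rho> \<inter> \<tau>) \<rho>" using pf[OF \<open>\<rho> \<in> ?S\<close> t] .
  show "pface \<iota> (\<rho> \<inter> \<tau>) \<tau>" using pf[OF t \<open>\<rho> \<in> ?S\<close>] by (simp add: Int_commute)
qed

lemma refine_Nil [simp]: "refine \<iota> [] Q = Q" and refine_Cons [simp]: "refine \<iota> (h # hs) Q = split_by \<iota> h (refine \<iota> hs Q)"
  by (simp_all add: refine_def)

lemma eucl_complex_refine: "eucl_complex \<iota> Q \<Longrightarrow> eucl_complex \<iota> (refine \<iota> hs Q)"
  by (induction hs) (auto intro: eucl_complex_split)

lemma subdiv_split: "subdiv (split_by \<iota> h Q) Q"
  unfolding subdiv_def by (auto elim!: split_byE)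

lemma subdiv_split_mono: assumes "subdiv Q Q'" shows "subdiv (split_by \<iota> h Q) (split_by \<iota> h Q')"
  unfolding subdiv_def
proof
  fix \<rho> assume "\<rho> \<in> split_by \<iota> h Q"
  then obtain \<sigma> H where \<rho>: "\<rho> = \<sigma> \<inter> \<iota> -` H" "\<sigma> \<in> Q" "H \<in> halves h" by (rule split_byE)
  obtain \<sigma>' where "\<sigma>' \<in> Q'" "\<sigma> \<subseteq> \<sigma>'" using assms \<rho>(2) unfolding subdiv_def by blast
  then show "\<exists>\<sigma>\<in>split_by \<iota> h Q'. \<rho> \<subseteq> \<sigma>"
    using \<rho> by (intro bexI[of _ "\<sigma>' \<inter> \<iota> -` H"] split_byI) auto
qed

lemma subdiv_refine: "subdiv (refine \<iota> hs Q) Q"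
  by (induction hs) (auto intro: subdiv_refl subdiv_trans[OF subdiv_split])

text \<open>A common subdivision of Q and \<open>Q0\<close>, split by the same hyperplane, is one of
  the split complex and \<open>Q0\<close>.\<close>

lemma in_class_split: assumes "in_class \<iota> Q0 Q" shows "in_class \<iota> Q0 (split_by \<iota> h Q)"
proof -
  obtain Q'' where q: "eucl_complex \<iota> Q" "eucl_complex \<iota> Q''" "subdiv Q'' Q" "subdiv Q'' Q0"
    using assms unfolding in_class_def by blast
  show ?thesis unfolding in_class_def
    using eucl_complex_split[OF q(1)] eucl_complex_split[OF q(2)] subdiv_split_mono[OF q(3)]
      subdiv_trans[OF subdiv_split q(4)] by blast
qed

lemma in_class_refine: "in_class \<iota> Q0 Q \<Longrightarrow> in_class \<iota> Q0 (refine \<iota> hs Q)"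
  by (induction hs) (auto intro: in_class_split)

text \<open>The selected piece depends on the hyperplane and not on its position, so repeated
  entries of the list do not conflict.\<close>

lemma refine_mem:
  assumes "\<sigma> \<in> Q" "\<And>h. h \<in> set hs \<Longrightarrow> S h \<in> halves h"
  shows "{x \<in> \<sigma>. \<forall>h\<in>set hs. \<iota> x \<in> S h} \<in> refine \<iota> hs Q"
  using assms(2)
proof (induction hs)
  case Nil then show ?case using assms(1) by simp
next
  case (Cons h hs)
  have "{x \<in> \<sigma>. \<forall>h\<in>set (h # hs). \<iota> x \<in> S h} = {x \<in> \<sigma>. \<forall>h\<in>set hs. \<iota> x \<in> S h} \<inter> \<iota> -` S h" by auto
  moreover have "{x \<in> \<sigma>. \<forall>h\<in>set hs. \<iota> x \<in> S h} \<in> refine \<iota> hs Q" using Cons by simp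
  ultimately show ?case using Cons.prems by (simp add: split_byI)
qed

lemma refine_cases:
  assumes "\<rho> \<in> refine \<iota> hs Q"
  obtains \<sigma> where "\<sigma> \<in> Q" "\<rho> \<subseteq> \<sigma>" "\<And>h. h \<in> set hs \<Longrightarrow> \<exists>H\<in>halves h. \<forall>x\<in>\<rho>. \<iota> x \<in> H"
proof -
  have "\<exists>\<sigma>\<in>Q. \<rho> \<subseteq> \<sigma> \<and> (\<forall>h\<in>set hs. \<exists>H\<in>halves h. \<forall>x\<in>\<rho>. \<iota> x \<in> H)" using assms
  proof (induction hs arbitrary: \<rho>)
    case Nil then show ?case by auto
  next
    case (Cons h hs)
    then obtain \<rho>' H where r: "\<rho>' \<in> refine \<iota> hs Q" "H \<in> halves h" "\<rho> = \<rho>' \<inter> \<iota> -` H"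
      unfolding refine_Cons by (auto elim: split_byE)
    then obtain \<sigma> where "\<sigma> \<in> Q" "\<rho>' \<subseteq> \<sigma>" "\<forall>h\<in>set hs. \<exists>H\<in>halves h. \<forall>x\<in>\<rho>'. \<iota> x \<in> H" using Cons.IH by metis
    moreover have "\<exists>H\<in>halves k. \<forall>x\<in>\<rho>. \<iota> x \<in> H" if "k \<in> set (h # hs)" for k
    proof (cases "k = h")
      case True then show ?thesis using r by (intro bexI[of _ H]) auto
    next
      case False
      then have "k \<in> set hs" using that by simp
      then obtain K where "K \<in> halves k" "\<forall>x\<in>\<rho>'. \<iota> x \<in> K"
        using calculation(3) by blast
      then show ?thesis using r(3) by blast
    qed
    ultimately show ?case using r(3) by blast
  qed
  then show thesis using that by blast
qed

section \<open>Pullback of Minkowski weights\<close>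

lemma restrD: "\<sigma> \<in> restr \<iota> Q W k \<Longrightarrow> \<sigma> \<in> Q \<and> \<sigma> \<inter> W \<noteq> {} \<and> pdim \<iota> \<sigma> = k"
  by (simp add: restr_def)

lemma restr_above_eq:
  assumes "\<tau> \<inter> W \<noteq> {}"
  shows "{\<sigma>\<in>restr \<iota> Q W k. \<tau> \<subseteq> \<sigma>} = {\<sigma>\<in>Q. \<tau> \<subseteq> \<sigma> \<and> pdim \<iota> \<sigma> = k}"
  using assms by (auto simp: restr_def)

lemma minkowskiD:
  assumes "minkowski \<iota> Q W k c" "\<tau> \<in> Q" "\<tau> \<inter> W \<noteq> {}" "pdim \<iota> \<tau> = k - 1"
  shows "(\<Sum>\<sigma>\<in>{\<sigma>\<in>Q. \<tau> \<subseteq> \<sigma> \<and> pdim \<iota> \<sigma> = k}. c \<sigma> *\<^sub>R nvec \<iota> \<sigma> \<tau>) = 0"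
proof -
  have "\<tau> \<in> restr \<iota> Q W (k - 1)" using assms by (simp add: restr_def)
  then have "(\<Sum>\<sigma>\<in>{\<sigma>\<in>restr \<iota> Q W k. \<tau> \<subseteq> \<sigma>}. c \<sigma> *\<^sub>R nvec \<iota> \<sigma> \<tau>) = 0"
    using assms(1) unfolding minkowski_def by blast
  then show ?thesis by (simp add: restr_above_eq[OF assms(3)])
qed

lemma minkowskiI:
  assumes "\<And>\<tau>. \<tau> \<in> Q \<Longrightarrow> \<tau> \<inter> W \<noteq> {} \<Longrightarrow> pdim \<iota> \<tau> = k - 1 \<Longrightarrow>
    (\<Sum>\<sigma>\<in>{\<sigma>\<in>Q. \<tau> \<subseteq> \<sigma> \<and> pdim \<iota> \<sigma> = k}. c \<sigma> *\<^sub>R nvec \<iota> \<sigma> \<tau>) = 0"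
  shows "minkowski \<iota> Q W k c"
  unfolding minkowski_def
proof
  fix \<tau> assume "\<tau> \<in> restr \<iota> Q W (k - 1)"
  then have t: "\<tau> \<in> Q" "\<tau> \<inter> W \<noteq> {}" "pdim \<iota> \<tau> = k - 1" using restrD by blast+
  show "(\<Sum>\<sigma>\<in>{\<sigma>\<in>restr \<iota> Q W k. \<tau> \<subseteq> \<sigma>}. c \<sigma> *\<^sub>R nvec \<iota> \<sigma> \<tau>) = 0"
    using assms[OF t] by (simp add: restr_above_eq[OF t(2)])
qed

lemma cell_nvec:
  assumes "eucl_complex \<iota> Q" "\<sigma> \<in> Q" "\<tau> \<in> Q" "\<tau> \<subseteq> \<sigma>" "\<tau> \<noteq> {}" "pdim \<iota> \<sigma> = pdim \<iota> \<tau> + 1"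
  shows "is_nvec (\<iota> ` \<sigma>) (\<iota> ` \<tau>) (nvec \<iota> \<sigma> \<tau>)"
  using nvec_is_nvec[OF cell_convex[OF assms(1,2)] cell_facet[OF assms]] .

lemma cell_nvec_eqI:
  assumes "eucl_complex \<iota> Q" "\<sigma> \<in> Q" "\<tau> \<in> Q" "\<tau> \<subseteq> \<sigma>" "\<tau> \<noteq> {}" "pdim \<iota> \<sigma> = pdim \<iota> \<tau> + 1"
    "is_nvec (\<iota> ` \<sigma>) (\<iota> ` \<tau>) u"
  shows "nvec \<iota> \<sigma> \<tau> = u"
  using nvec_eqI[OF cell_convex[OF assms(1,2)] cell_facet[OF assms(1-6)] assms(7)] .

lemma rel_interior_cell:
  assumes "eucl_complex \<iota> Q" "\<sigma> \<in> Q" "\<sigma> \<noteq> {}"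
  obtains z where "z \<in> \<sigma>" "\<iota> z \<in> rel_interior (\<iota> ` \<sigma>)"
proof -
  have "rel_interior (\<iota> ` \<sigma>) \<noteq> {}" using rel_interior_eq_empty[OF cell_convex[OF assms(1,2)]] assms(3) by simp
  then obtain v where "v \<in> rel_interior (\<iota> ` \<sigma>)" by blast
  moreover then have "v \<in> \<iota> ` \<sigma>" using rel_interior_subset by blast
  ultimately show thesis using that by blast
qed

lemma cell_contains_mincell:
  assumes "eucl_complex \<iota> Q" "\<tau> \<in> Q" "z \<in> \<tau>" "\<iota> z \<in> rel_interior (\<iota> ` \<tau>)" "\<sigma> \<in> Q" "z \<in> \<sigma>"
  shows "\<tau> \<subseteq> \<sigma>"
  by (rule mincell_sub[OF assms(1) order_refl assms(2-6)])

text \<open>Existence: a point y slightly beyond z in direction u has a minimal cell in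
  \<open>Q'\<close>; it contains z, hence \<open>\<tau>'\<close>, and its dimension lies strictly
  above k - 1 and at most at k. Uniqueness: two such cells share a short segment from z, so their
  intersection is larger than \<open>\<tau>'\<close> and has dimension k.\<close>

lemma cell_direction_unique:
  assumes Q: "eucl_complex \<iota> Q" and Q': "eucl_complex \<iota> Q'" and sd: "subdiv Q' Q"
    and \<sigma>: "\<sigma> \<in> Q" "pdim \<iota> \<sigma> = k" and \<tau>': "\<tau>' \<in> Q'" "pdim \<iota> \<tau>' = k - 1" "\<tau>' \<subseteq> \<sigma>"
    and z: "z \<in> \<tau>'" "\<iota> z \<in> rel_interior (\<iota> ` \<tau>')"
    and u: "norm u = 1" "u \<in> dirs (\<iota> ` \<sigma>)" "\<And>t. t \<in> dirs (\<iota> ` \<tau>') \<Longrightarrow> u \<bullet> t = 0"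
    and s: "s > 0" "\<iota> z + s *\<^sub>R u \<in> \<iota> ` \<sigma>"
  shows "\<exists>!\<sigma>'. \<sigma>' \<in> Q' \<and> \<tau>' \<subseteq> \<sigma>' \<and> pdim \<iota> \<sigma>' = k \<and> \<sigma>' \<subseteq> \<sigma> \<and> nvec \<iota> \<sigma>' \<tau>' = u"
proof (rule ex_ex1I)
  have z\<sigma>: "z \<in> \<sigma>" using z \<tau>' by blast
  have uu: "u \<bullet> u = 1" using u(1) by (simp add: norm_eq_1)
  obtain N where N: "open N" "z \<in> N" "\<And>\<sigma>. \<sigma> \<in> Q' \<Longrightarrow> \<sigma> \<inter> N \<noteq> {} \<Longrightarrow> z \<in> \<sigma>"
    using star_nbhd[OF Q'] by blast
  obtain w where w: "w \<in> \<sigma>" "\<iota> w = \<iota> z + s *\<^sub>R u" using s(2) by auto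
  obtain l y where ly: "l > 0" "l \<le> 1" "y \<in> \<sigma> \<inter> N" "\<iota> y = \<iota> z + l *\<^sub>R (\<iota> w - \<iota> z)"
    using cell_segment_near[OF Q \<sigma>(1) z\<sigma> N(1,2) w(1)] .
  have y: "y \<in> \<sigma>" "y \<in> N" "\<iota> y - \<iota> z = (l * s) *\<^sub>R u" using ly w by auto
  have ls: "l * s > 0" using ly s by simp
  obtain \<sigma>0 where "\<sigma>0 \<in> Q'" "y \<in> \<sigma>0" using complex_cover[OF Q'] by blast
  then obtain \<rho> where r: "\<rho> \<in> Q'" "y \<in> \<rho>" "\<iota> y \<in> rel_interior (\<iota> ` \<rho>)" using mincell[OF Q'] by metis
  obtain \<sigma>1 where s1: "\<sigma>1 \<in> Q" "\<rho> \<subseteq> \<sigma>1" using sd r unfolding subdiv_def by blast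
  have rs: "\<rho> \<subseteq> \<sigma>" using mincell_sub[OF Q s1(2,1) r(2,3) \<sigma>(1) y(1)] .
  have "z \<in> \<rho>" using N(3)[OF r(1)] r(2) y(2) by blast
  then have tr: "\<tau>' \<subseteq> \<rho>" using cell_contains_mincell[OF Q' \<tau>'(1) z r(1)] by blast
  have d1: "pdim \<iota> \<rho> \<le> k" using pdim_mono[OF rs, of \<iota>] \<sigma> by simp
  have ne: "\<tau>' \<noteq> \<rho>"
  proof
    assume "\<tau>' = \<rho>"
    then have "\<iota> y - \<iota> z \<in> dirs (\<iota> ` \<tau>')" using r(2) z(1) by (intro diff_in_dirs) auto
    then have "u \<bullet> (\<iota> y - \<iota> z) = 0" using u(3) by blast
    then show False using y(3) uu ls by auto
  qed
  have "pdim \<iota> \<tau>' \<noteq> pdim \<iota> \<rho>" using cell_eq_dim[OF Q' r(1) \<tau>'(1) tr] ne by blast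
  then have dk: "pdim \<iota> \<rho> = k" using pdim_mono[OF tr, of \<iota>] \<tau>'(2) d1 by simp
  have "dirs (\<iota> ` \<rho>) = dirs (\<iota> ` \<sigma>)"
    using rs dk \<sigma>(2) r(2) by (intro dirs_subset_eq) (auto simp: pdim_def)
  then have isn: "is_nvec (\<iota> ` \<rho>) (\<iota> ` \<tau>') u"
    unfolding is_nvec_def
  proof (intro conjI ballI)
    show "u \<bullet> (a - b) = 0" if "a \<in> \<iota> ` \<tau>'" "b \<in> \<iota> ` \<tau>'" for a b using u(3) diff_in_dirs[OF that] by blast
    have "u \<bullet> (\<iota> y - \<iota> z) > 0" using y(3) uu ls by simp
    then show "\<exists>y\<in>\<iota> ` \<rho>. \<exists>z\<in>\<iota> ` \<tau>'. 0 < u \<bullet> (y - z)" using r(2) z(1) by blast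
  qed (use u in auto)
  have "nvec \<iota> \<rho> \<tau>' = u"
    using cell_nvec_eqI[OF Q' r(1) \<tau>'(1) tr _ _ isn] z(1) dk \<tau>'(2) by auto
  then show "\<exists>\<sigma>'. \<sigma>' \<in> Q' \<and> \<tau>' \<subseteq> \<sigma>' \<and> pdim \<iota> \<sigma>' = k \<and> \<sigma>' \<subseteq> \<sigma> \<and> nvec \<iota> \<sigma>' \<tau>' = u"
    using r tr dk rs by blast
next
  fix \<sigma>1 \<sigma>2
  assume 1: "\<sigma>1 \<in> Q' \<and> \<tau>' \<subseteq> \<sigma>1 \<and> pdim \<iota> \<sigma>1 = k \<and> \<sigma>1 \<subseteq> \<sigma> \<and> nvec \<iota> \<sigma>1 \<tau>' = u"
    and 2: "\<sigma>2 \<in> Q' \<and> \<tau>' \<subseteq> \<sigma>2 \<and> pdim \<iota> \<sigma>2 = k \<and> \<sigma>2 \<subseteq> \<sigma> \<and> nvec \<iota> \<sigma>2 \<tau>' = u"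
  have ne: "\<tau>' \<noteq> {}" using z by blast
  have uu: "u \<bullet> u = 1" using u(1) by (simp add: norm_eq_1)
  have in1: "\<exists>l>0. \<forall>s. 0 \<le> s \<and> s \<le> l \<longrightarrow> \<iota> z + s *\<^sub>R u \<in> \<iota> ` \<rho>"
    if r: "\<rho> \<in> Q' \<and> \<tau>' \<subseteq> \<rho> \<and> pdim \<iota> \<rho> = k \<and> \<rho> \<subseteq> \<sigma> \<and> nvec \<iota> \<rho> \<tau>' = u" for \<rho>
  proof -
    have r': "\<rho> \<in> Q'" "\<tau>' \<subseteq> \<rho>" "pdim \<iota> \<rho> = pdim \<iota> \<tau>' + 1" "nvec \<iota> \<rho> \<tau>' = u" using r \<tau>' by auto
    show ?thesis
      using facet_inward[OF cell_convex[OF Q' r'(1)] cell_facet[OF Q' r'(1) \<tau>'(1) r'(2) ne r'(3)]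
          cell_nvec[OF Q' r'(1) \<tau>'(1) r'(2) ne r'(3)] z(2)] r'(4) by metis
  qed
  obtain l1 where l1: "l1 > 0" "\<And>s. 0 \<le> s \<Longrightarrow> s \<le> l1 \<Longrightarrow> \<iota> z + s *\<^sub>R u \<in> \<iota> ` \<sigma>1" using in1[OF 1] by blast
  obtain l2 where l2: "l2 > 0" "\<And>s. 0 \<le> s \<Longrightarrow> s \<le> l2 \<Longrightarrow> \<iota> z + s *\<^sub>R u \<in> \<iota> ` \<sigma>2" using in1[OF 2] by blast
  define l where "l = min l1 l2"
  have l: "l > 0" "\<iota> z + l *\<^sub>R u \<in> \<iota> ` \<sigma>1" "\<iota> z + l *\<^sub>R u \<in> \<iota> ` \<sigma>2"
    using l1 l2 by (auto simp: l_def)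
  obtain y1 where y1: "y1 \<in> \<sigma>1" "\<iota> y1 = \<iota> z + l *\<^sub>R u" using l(2) by auto
  obtain y2 where y2: "y2 \<in> \<sigma>2" "\<iota> y2 = \<iota> z + l *\<^sub>R u" using l(3) by auto
  have "y1 = y2" using cell_inj[OF Q \<sigma>(1)] y1 y2 1 2 by (metis inj_onD subsetD)
  then have y12: "y1 \<in> \<sigma>1 \<inter> \<sigma>2" using y1 y2 by simp
  have I: "\<sigma>1 \<inter> \<sigma>2 \<in> Q'" using complex_Int(2)[OF Q'] 1 2 by blast
  have tI: "\<tau>' \<subseteq> \<sigma>1 \<inter> \<sigma>2" using 1 2 by blast
  have "\<tau>' \<noteq> \<sigma>1 \<inter> \<sigma>2"
  proof
    assume "\<tau>' = \<sigma>1 \<inter> \<sigma>2"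
    then have "\<iota> y1 - \<iota> z \<in> dirs (\<iota> ` \<tau>')" using y12 z(1) by (intro diff_in_dirs) auto
    then have "u \<bullet> (\<iota> y1 - \<iota> z) = 0" using u(3) by blast
    then show False using y1(2) uu l(1) by simp
  qed
  then have "pdim \<iota> \<tau>' \<noteq> pdim \<iota> (\<sigma>1 \<inter> \<sigma>2)" using cell_eq_dim[OF Q' I \<tau>'(1) tI] by blast
  moreover have "pdim \<iota> (\<sigma>1 \<inter> \<sigma>2) \<le> k" using pdim_mono[of "\<sigma>1 \<inter> \<sigma>2" \<sigma>1 \<iota>] 1 by simp
  ultimately have d: "pdim \<iota> (\<sigma>1 \<inter> \<sigma>2) = k" using pdim_mono[OF tI, of \<iota>] \<tau>'(2) by simp
  have "\<sigma>1 \<inter> \<sigma>2 = \<sigma>1" using cell_eq_dim[OF Q' _ I] 1 d by blast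
  moreover have "\<sigma>1 \<inter> \<sigma>2 = \<sigma>2" using cell_eq_dim[OF Q' _ I] 2 d by blast
  ultimately show "\<sigma>1 = \<sigma>2" by simp
qed

text \<open>A point z relatively interior to \<open>\<tau>'\<close> singles out the cell \<tau> of Q
  with z in its relative interior, which every cell of Q through z contains. Its dimension is at
  least k - 1 and decides how the new sum relates to an old one.\<close>

lemma minkowski_pullback:
  assumes Q: "eucl_complex \<iota> Q" and Q': "eucl_complex \<iota> Q'" and sd: "subdiv Q' Q"
    and m: "minkowski \<iota> Q W k c"
  shows "minkowski \<iota> Q' W k (pullback \<iota> Q c)"
proof (rule minkowskiI)
  fix \<tau>' assume \<tau>': "\<tau>' \<in> Q'" "\<tau>' \<inter> W \<noteq> {}" "pdim \<iota> \<tau>' = k - 1"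
  have ne: "\<tau>' \<noteq> {}" using \<tau>'(2) by blast
  obtain z where z: "z \<in> \<tau>'" "\<iota> z \<in> rel_interior (\<iota> ` \<tau>')" using rel_interior_cell[OF Q' \<tau>'(1) ne] .
  obtain \<sigma>1 where s1: "\<sigma>1 \<in> Q" "\<tau>' \<subseteq> \<sigma>1" using sd \<tau>'(1) unfolding subdiv_def by blast
  then have "z \<in> \<sigma>1" using z by blast
  then obtain \<tau> where t: "\<tau> \<in> Q" "z \<in> \<tau>" "\<iota> z \<in> rel_interior (\<iota> ` \<tau>)" using mincell[OF Q _ s1(1)] by metis
  have tt: "\<tau>' \<subseteq> \<tau>" using mincell_sub[OF Q s1(2,1) z t(1,2)] .
  have abv: "\<tau> \<subseteq> \<sigma>" if "\<sigma> \<in> Q" "z \<in> \<sigma>" for \<sigma> using cell_contains_mincell[OF Q t that] .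
  define S' where "S' = {\<sigma>'\<in>Q'. \<tau>' \<subseteq> \<sigma>' \<and> pdim \<iota> \<sigma>' = k}"
  have fS': "finite S'" unfolding S'_def by (rule finite_cells_above[OF Q' ne])
  define p where "p = pullback \<iota> Q c"
  define A where "A \<sigma> = {\<sigma>'\<in>S'. \<sigma>' \<subseteq> \<sigma>}" for \<sigma>
  have pA: "p \<sigma>' = c \<sigma>" if "\<sigma>' \<in> A \<sigma>" "\<sigma> \<in> Q" "pdim \<iota> \<sigma> = k" for \<sigma>' \<sigma>
    unfolding p_def using that ne by (intro pullback_eq[OF Q]) (auto simp: A_def S'_def)
  have p0: "p \<sigma>' = 0" if "\<sigma>' \<in> S'" "\<not> (\<exists>\<sigma>\<in>Q. pdim \<iota> \<sigma> = k \<and> \<sigma>' \<in> A \<sigma>)" for \<sigma>'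
    unfolding p_def using that by (intro pullback_zero) (auto simp: A_def S'_def)
  have nv: "is_nvec (\<iota> ` \<sigma>') (\<iota> ` \<tau>') (nvec \<iota> \<sigma>' \<tau>')" if "\<sigma>' \<in> S'" for \<sigma>'
    using that \<tau>' ne by (intro cell_nvec[OF Q']) (auto simp: S'_def)
  have dA: "dirs (\<iota> ` \<sigma>') = dirs (\<iota> ` \<sigma>)" if "\<sigma>' \<in> A \<sigma>" "pdim \<iota> \<sigma> = k" for \<sigma>' \<sigma>
    using that ne by (intro dirs_subset_eq) (auto simp: A_def S'_def pdim_def)
  have "pdim \<iota> \<tau> \<ge> k - 1" using pdim_mono[OF tt, of \<iota>] \<tau>'(3) by simp
  \<comment> \<open>The cells around \<open>\<tau>'\<close> correspond to those around \<open>\<tau>\<close>; or there are two of them, opposite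
    and of equal weight; or all of them have weight zero.\<close>
  then consider "pdim \<iota> \<tau> = k - 1" | "pdim \<iota> \<tau> = k" | "pdim \<iota> \<tau> > k" by linarith
  then have "(\<Sum>\<sigma>'\<in>S'. p \<sigma>' *\<^sub>R nvec \<iota> \<sigma>' \<tau>') = 0"
  proof cases
    case 3
    have "p \<sigma>' = 0" if "\<sigma>' \<in> S'" for \<sigma>'
    proof (rule p0[OF that], rule notI)
      assume "\<exists>\<sigma>\<in>Q. pdim \<iota> \<sigma> = k \<and> \<sigma>' \<in> A \<sigma>"
      then obtain \<sigma> where s: "\<sigma> \<in> Q" "pdim \<iota> \<sigma> = k" "\<sigma>' \<in> A \<sigma>" by blast
      then have "z \<in> \<sigma>" using z(1) that by (auto simp: A_def S'_def)
      then have "pdim \<iota> \<tau> \<le> k" using pdim_mono[OF abv[OF s(1)], of \<iota>] s(2) by simp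
      then show False using 3 by simp
    qed
    then show ?thesis by simp
  next
    case 1
    define S where "S = {\<sigma>\<in>Q. \<tau> \<subseteq> \<sigma> \<and> pdim \<iota> \<sigma> = k}"
    have tne: "\<tau> \<noteq> {}" using t by blast
    have fS: "finite S" unfolding S_def by (rule finite_cells_above[OF Q tne])
    have dt: "dirs (\<iota> ` \<tau>') = dirs (\<iota> ` \<tau>)"
      using tt ne 1 \<tau>'(3) by (intro dirs_subset_eq) (auto simp: pdim_def)
    have ns: "is_nvec (\<iota> ` \<sigma>) (\<iota> ` \<tau>) (nvec \<iota> \<sigma> \<tau>)" if "\<sigma> \<in> S" for \<sigma>
      using that t tne 1 by (intro cell_nvec[OF Q]) (auto simp: S_def)
    have same: "nvec \<iota> \<sigma>' \<tau>' = nvec \<iota> \<sigma> \<tau>" if a: "\<sigma>' \<in> A \<sigma>" "\<sigma> \<in> S" for \<sigma>' \<sigma>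
    proof -
      have s': "\<sigma>' \<in> S'" "\<sigma>' \<subseteq> \<sigma>" using a by (auto simp: A_def)
      note n = nv[OF s'(1)]
      have sd: "dirs (\<iota> ` \<sigma>') = dirs (\<iota> ` \<sigma>)" using dA[OF a(1)] a(2) by (simp add: S_def)
      have "is_nvec (\<iota> ` \<sigma>) (\<iota> ` \<tau>) (nvec \<iota> \<sigma>' \<tau>')"
        unfolding is_nvec_def
      proof (intro conjI ballI)
        show "norm (nvec \<iota> \<sigma>' \<tau>') = 1" "nvec \<iota> \<sigma>' \<tau>' \<in> dirs (\<iota> ` \<sigma>)" using n sd by (auto simp: is_nvec_def)
        show "nvec \<iota> \<sigma>' \<tau>' \<bullet> (y - z) = 0" if "y \<in> \<iota> ` \<tau>" "z \<in> \<iota> ` \<tau>" for y z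
          using is_nvec_orth[OF n] diff_in_dirs[OF that] dt by simp
        show "\<exists>y\<in>\<iota> ` \<sigma>. \<exists>z\<in>\<iota> ` \<tau>. 0 < nvec \<iota> \<sigma>' \<tau>' \<bullet> (y - z)"
          using n s'(2) tt unfolding is_nvec_def by (meson image_mono subsetD)
      qed
      moreover have "\<sigma> \<in> Q" "\<tau> \<subseteq> \<sigma>" "pdim \<iota> \<sigma> = pdim \<iota> \<tau> + 1" using a(2) 1 by (auto simp: S_def)
      ultimately show ?thesis using cell_nvec_eqI[OF Q _ t(1) _ tne] by metis
    qed
    have one: "\<exists>\<sigma>'. A \<sigma> = {\<sigma>'}" if s: "\<sigma> \<in> S" for \<sigma>
    proof -
      have s': "\<sigma> \<in> Q" "pdim \<iota> \<sigma> = k" "\<tau> \<subseteq> \<sigma>" using s by (auto simp: S_def)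
      note n = ns[OF s]
      have fac: "(\<iota> ` \<tau>) facet_of (\<iota> ` \<sigma>)" using cell_facet[OF Q s'(1) t(1) s'(3) tne] s'(2) 1 by simp
      obtain l where l: "l > 0" "\<And>s. 0 \<le> s \<Longrightarrow> s \<le> l \<Longrightarrow> \<iota> z + s *\<^sub>R nvec \<iota> \<sigma> \<tau> \<in> \<iota> ` \<sigma>"
        using facet_inward[OF cell_convex[OF Q s'(1)] fac n t(3)] by blast
      have "\<exists>!\<sigma>'. \<sigma>' \<in> Q' \<and> \<tau>' \<subseteq> \<sigma>' \<and> pdim \<iota> \<sigma>' = k \<and> \<sigma>' \<subseteq> \<sigma> \<and> nvec \<iota> \<sigma>' \<tau>' = nvec \<iota> \<sigma> \<tau>"
      proof (rule cell_direction_unique[OF Q Q' sd s'(1,2) \<tau>'(1,3) _ z])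
        show "\<tau>' \<subseteq> \<sigma>" using tt s'(3) by blast
        show "norm (nvec \<iota> \<sigma> \<tau>) = 1" "nvec \<iota> \<sigma> \<tau> \<in> dirs (\<iota> ` \<sigma>)" using n by (auto simp: is_nvec_def)
        show "nvec \<iota> \<sigma> \<tau> \<bullet> t = 0" if "t \<in> dirs (\<iota> ` \<tau>')" for t using is_nvec_orth[OF n] that dt by simp
        show "l > 0" by fact
        show "\<iota> z + l *\<^sub>R nvec \<iota> \<sigma> \<tau> \<in> \<iota> ` \<sigma>" using l by simp
      qed
      then obtain \<sigma>' where u: "\<sigma>' \<in> Q' \<and> \<tau>' \<subseteq> \<sigma>' \<and> pdim \<iota> \<sigma>' = k \<and> \<sigma>' \<subseteq> \<sigma> \<and> nvec \<iota> \<sigma>' \<tau>' = nvec \<iota> \<sigma> \<tau>"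
        "\<And>\<rho>. \<rho> \<in> Q' \<and> \<tau>' \<subseteq> \<rho> \<and> pdim \<iota> \<rho> = k \<and> \<rho> \<subseteq> \<sigma> \<and> nvec \<iota> \<rho> \<tau>' = nvec \<iota> \<sigma> \<tau> \<Longrightarrow> \<rho> = \<sigma>'"
        by (elim ex1E) (rule that, assumption, blast)
      have "\<sigma>' \<in> A \<sigma>" using u(1) by (simp add: A_def S'_def)
      moreover have "\<rho> = \<sigma>'" if "\<rho> \<in> A \<sigma>" for \<rho>
        using u(2)[of \<rho>] same[OF that s] that by (simp add: A_def S'_def)
      ultimately have "A \<sigma> = {\<sigma>'}" by blast
      then show ?thesis by blast
    qed
    have disj: "A \<sigma> \<inter> A \<rho> = {}" if a: "\<sigma> \<in> S" "\<rho> \<in> S" "\<sigma> \<noteq> \<rho>" for \<sigma> \<rho>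
    proof (rule ccontr)
      assume "A \<sigma> \<inter> A \<rho> \<noteq> {}"
      then obtain \<sigma>' where s: "\<sigma>' \<in> S'" "\<sigma>' \<subseteq> \<sigma> \<inter> \<rho>" by (auto simp: A_def)
      have I: "\<sigma> \<inter> \<rho> \<in> Q" "\<sigma> \<in> Q" "\<rho> \<in> Q" using complex_Int(2)[OF Q] a by (auto simp: S_def)
      have "k \<le> pdim \<iota> (\<sigma> \<inter> \<rho>)" using pdim_mono[OF s(2), of \<iota>] s(1) by (simp add: S'_def)
      moreover have "pdim \<iota> (\<sigma> \<inter> \<rho>) \<le> k" using pdim_mono[of "\<sigma> \<inter> \<rho>" \<sigma> \<iota>] a(1) by (simp add: S_def)
      ultimately have "pdim \<iota> (\<sigma> \<inter> \<rho>) = k" by simp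
      then have "\<sigma> \<inter> \<rho> = \<sigma>" "\<sigma> \<inter> \<rho> = \<rho>"
        using cell_eq_dim[OF Q I(2) I(1)] cell_eq_dim[OF Q I(3) I(1)] a by (auto simp: S_def)
      then show False using a(3) by blast
    qed
    have sub: "(\<Union>\<sigma>\<in>S. A \<sigma>) \<subseteq> S'" by (auto simp: A_def)
    \<comment> \<open>The omitted cells lie in no k-cell of Q, only in larger ones, and have weight
      0 by the default of \<open>pullback\<close>.\<close>
    have "(\<Sum>\<sigma>'\<in>S'. p \<sigma>' *\<^sub>R nvec \<iota> \<sigma>' \<tau>') = (\<Sum>\<sigma>'\<in>(\<Union>\<sigma>\<in>S. A \<sigma>). p \<sigma>' *\<^sub>R nvec \<iota> \<sigma>' \<tau>')"
    proof (rule sum.mono_neutral_right[OF fS' sub], rule ballI)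
      fix \<sigma>' assume s': "\<sigma>' \<in> S' - (\<Union>\<sigma>\<in>S. A \<sigma>)"
      have "p \<sigma>' = 0"
      proof (rule p0, use s' in blast, rule notI)
        assume "\<exists>\<sigma>\<in>Q. pdim \<iota> \<sigma> = k \<and> \<sigma>' \<in> A \<sigma>"
        then obtain \<sigma> where s: "\<sigma> \<in> Q" "pdim \<iota> \<sigma> = k" "\<sigma>' \<in> A \<sigma>" by blast
        then have "z \<in> \<sigma>" using z(1) by (auto simp: A_def S'_def)
        then have "\<sigma> \<in> S" using abv s by (simp add: S_def)
        then show False using s' s by blast
      qed
      then show "p \<sigma>' *\<^sub>R nvec \<iota> \<sigma>' \<tau>' = 0" by simp
    qed
    also have "\<dots> = (\<Sum>\<sigma>\<in>S. \<Sum>\<sigma>'\<in>A \<sigma>. p \<sigma>' *\<^sub>R nvec \<iota> \<sigma>' \<tau>')"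
      using fS disj one by (intro sum.UNION_disjoint) (auto, metis finite.emptyI finite_insert)
    also have "\<dots> = (\<Sum>\<sigma>\<in>S. c \<sigma> *\<^sub>R nvec \<iota> \<sigma> \<tau>)"
    proof (rule sum.cong[OF refl])
      fix \<sigma> assume s: "\<sigma> \<in> S"
      obtain \<sigma>' where A: "A \<sigma> = {\<sigma>'}" using one[OF s] by blast
      then have "\<sigma>' \<in> A \<sigma>" by simp
      then have "p \<sigma>' = c \<sigma>" "nvec \<iota> \<sigma>' \<tau>' = nvec \<iota> \<sigma> \<tau>"
        using pA same s by (auto simp: S_def)
      then show "(\<Sum>\<sigma>'\<in>A \<sigma>. p \<sigma>' *\<^sub>R nvec \<iota> \<sigma>' \<tau>') = c \<sigma> *\<^sub>R nvec \<iota> \<sigma> \<tau>" by (simp add: A)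
    qed
    also have "\<dots> = 0" unfolding S_def using t(1) \<tau>'(2) tt 1 by (intro minkowskiD[OF m]) auto
    finally show ?thesis .
  next
    case 2
    have dsub: "dirs (\<iota> ` \<tau>') \<subseteq> dirs (\<iota> ` \<tau>)" using tt by (intro dirs_mono image_mono)
    have dd: "dim (dirs (\<iota> ` \<tau>)) = Suc (dim (dirs (\<iota> ` \<tau>')))"
    proof -
      have "\<tau> \<noteq> {}" using t(2) by blast
      then show ?thesis
        using aff_dim_dirs[of "\<iota> ` \<tau>"] aff_dim_dirs[of "\<iota> ` \<tau>'"] ne 2 \<tau>'(3) by (simp add: pdim_def)
    qed
    have "dirs (\<iota> ` \<tau>') \<subset> dirs (\<iota> ` \<tau>)" using dsub dd by force
    then obtain x where x: "x \<in> dirs (\<iota> ` \<tau>)" "x \<noteq> 0" "\<And>y. y \<in> dirs (\<iota> ` \<tau>') \<Longrightarrow> orthogonal x y"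
      using orthogonal_to_subspace_exists_gen[of "dirs (\<iota> ` \<tau>')" "dirs (\<iota> ` \<tau>)"] 
      by (metis span_eq_iff subspace_dirs)
    define u where "u = x /\<^sub>R norm x"
    have u: "u \<in> dirs (\<iota> ` \<tau>)" "norm u = 1" "\<And>t. t \<in> dirs (\<iota> ` \<tau>') \<Longrightarrow> u \<bullet> t = 0"
      using x by (auto simp: u_def orthogonal_def subspace_scale)
    obtain e where e: "e > 0" "\<And>t. t \<in> dirs (\<iota> ` \<tau>) \<Longrightarrow> norm t \<le> e \<Longrightarrow> \<iota> z + t \<in> \<iota> ` \<tau>"
      using rel_interior_dirs[OF t(3)] by blast
    \<comment> \<open>As z is relatively interior to \<tau>, both unit normals u and -u of
      \<open>\<tau>'\<close> lead into \<tau>.\<close>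
    have ex1: "\<exists>!\<sigma>'. \<sigma>' \<in> Q' \<and> \<tau>' \<subseteq> \<sigma>' \<and> pdim \<iota> \<sigma>' = k \<and> \<sigma>' \<subseteq> \<tau> \<and> nvec \<iota> \<sigma>' \<tau>' = w"
      if w: "w = u \<or> w = - u" for w
    proof (rule cell_direction_unique[OF Q Q' sd t(1) 2 \<tau>'(1,3) tt z])
      show nw: "norm w = 1" using w u(2) by auto
      show wd: "w \<in> dirs (\<iota> ` \<tau>)" using w u(1) subspace_neg[OF subspace_dirs u(1)] by blast
      show "w \<bullet> t = 0" if "t \<in> dirs (\<iota> ` \<tau>')" for t using w u(3)[OF that] by auto
      show "e > 0" by fact
      show "\<iota> z + e *\<^sub>R w \<in> \<iota> ` \<tau>"
        using e(1) nw wd by (intro e(2)) (simp_all add: subspace_scale)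
    qed
    obtain \<rho>1 where r1: "\<rho>1 \<in> Q' \<and> \<tau>' \<subseteq> \<rho>1 \<and> pdim \<iota> \<rho>1 = k \<and> \<rho>1 \<subseteq> \<tau> \<and> nvec \<iota> \<rho>1 \<tau>' = u"
        "\<And>\<rho>. \<rho> \<in> Q' \<and> \<tau>' \<subseteq> \<rho> \<and> pdim \<iota> \<rho> = k \<and> \<rho> \<subseteq> \<tau> \<and> nvec \<iota> \<rho> \<tau>' = u \<Longrightarrow> \<rho> = \<rho>1"
      using ex1[of u] by (auto elim!: ex1E)
    obtain \<rho>2 where r2: "\<rho>2 \<in> Q' \<and> \<tau>' \<subseteq> \<rho>2 \<and> pdim \<iota> \<rho>2 = k \<and> \<rho>2 \<subseteq> \<tau> \<and> nvec \<iota> \<rho>2 \<tau>' = - u"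
        "\<And>\<rho>. \<rho> \<in> Q' \<and> \<tau>' \<subseteq> \<rho> \<and> pdim \<iota> \<rho> = k \<and> \<rho> \<subseteq> \<tau> \<and> nvec \<iota> \<rho> \<tau>' = - u \<Longrightarrow> \<rho> = \<rho>2"
      using ex1[of "- u"] by (auto elim!: ex1E)
    have "u \<noteq> - u"
    proof
      assume "u = - u"
      then have "u \<bullet> u = - (u \<bullet> u)" by (metis inner_minus_left)
      then show False using u(2) by simp
    qed
    then have r12: "\<rho>1 \<noteq> \<rho>2" using r1(1) r2(1) by metis
    have A\<tau>: "A \<tau> = {\<rho>1, \<rho>2}"
    proof
      show "{\<rho>1, \<rho>2} \<subseteq> A \<tau>" using r1(1) r2(1) by (simp add: A_def S'_def)
      show "A \<tau> \<subseteq> {\<rho>1, \<rho>2}"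
      proof
        fix \<rho> assume r: "\<rho> \<in> A \<tau>"
        then have r': "\<rho> \<in> S'" by (simp add: A_def)
        note n = nv[OF r']
        have "nvec \<iota> \<rho> \<tau>' = u \<or> nvec \<iota> \<rho> \<tau>' = - u"
        proof (rule unit_orth_unique[OF subspace_dirs subspace_dirs dsub dd u])
          show "nvec \<iota> \<rho> \<tau>' \<in> dirs (\<iota> ` \<tau>)" "norm (nvec \<iota> \<rho> \<tau>') = 1"
            using n dA[OF r 2] by (auto simp: is_nvec_def)
          show "nvec \<iota> \<rho> \<tau>' \<bullet> t = 0" if "t \<in> dirs (\<iota> ` \<tau>')" for t
            using is_nvec_orth[OF n that] .
        qed
        then show "\<rho> \<in> {\<rho>1, \<rho>2}" using r r1(2)[of \<rho>] r2(2)[of \<rho>] by (auto simp: A_def S'_def)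
      qed
    qed
    have "(\<Sum>\<sigma>'\<in>S'. p \<sigma>' *\<^sub>R nvec \<iota> \<sigma>' \<tau>') = (\<Sum>\<sigma>'\<in>A \<tau>. p \<sigma>' *\<^sub>R nvec \<iota> \<sigma>' \<tau>')"
    proof (rule sum.mono_neutral_right[OF fS'], use A_def in blast, rule ballI)
      fix \<sigma>' assume s': "\<sigma>' \<in> S' - A \<tau>"
      have "p \<sigma>' = 0"
      proof (rule p0, use s' in blast, rule notI)
        assume "\<exists>\<sigma>\<in>Q. pdim \<iota> \<sigma> = k \<and> \<sigma>' \<in> A \<sigma>"
        then obtain \<sigma> where s: "\<sigma> \<in> Q" "pdim \<iota> \<sigma> = k" "\<sigma>' \<in> A \<sigma>" by blast
        then have "z \<in> \<sigma>" using z(1) by (auto simp: A_def S'_def)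
        then have "\<tau> = \<sigma>" using cell_eq_dim[OF Q s(1) t(1) abv[OF s(1)]] 2 s(2) by simp
        then show False using s' s by blast
      qed
      then show "p \<sigma>' *\<^sub>R nvec \<iota> \<sigma>' \<tau>' = 0" by simp
    qed
    also have "\<dots> = 0" using pA[OF _ t(1) 2] A\<tau> r12 r1(1) r2(1) by simp
    finally show ?thesis .
  qed
  then show "(\<Sum>\<sigma>\<in>{\<sigma>\<in>Q'. \<tau>' \<subseteq> \<sigma> \<and> pdim \<iota> \<sigma> = k}. pullback \<iota> Q c \<sigma> *\<^sub>R nvec \<iota> \<sigma> \<tau>') = 0"
    by (simp add: S'_def p_def)
qed

section \<open>Products with piecewise affine functions\<close>

lemma lin_piece:
  assumes "PA_on \<iota> Q W g" "\<sigma> \<in> Q"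
  shows "linear (lin_piece \<iota> \<sigma> W g)" "\<And>x. x \<in> \<sigma> \<Longrightarrow> x \<in> W \<Longrightarrow> lin_piece \<iota> \<sigma> W g (\<iota> x) = g x"
proof -
  have "\<exists>l. linear l \<and> (\<forall>x\<in>\<sigma> \<inter> W. g x = l (\<iota> x))" using assms unfolding PA_on_def by blast
  from someI_ex[OF this] have *: "linear (lin_piece \<iota> \<sigma> W g) \<and> (\<forall>x\<in>\<sigma> \<inter> W. g x = lin_piece \<iota> \<sigma> W g (\<iota> x))"
    unfolding lin_piece_def .
  then show "linear (lin_piece \<iota> \<sigma> W g)" by (rule conjunct1)
  show "lin_piece \<iota> \<sigma> W g (\<iota> x) = g x" if "x \<in> \<sigma>" "x \<in> W" for x using * that by simp
qed

lemma lin_piece_face: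
  assumes Q: "eucl_complex \<iota> Q" and W: "open W" and g: "PA_on \<iota> Q W g"
    and \<sigma>: "\<sigma> \<in> Q" "\<rho> \<in> Q" "\<rho> \<subseteq> \<sigma>" "\<rho> \<inter> W \<noteq> {}" and v: "v \<in> dirs (\<iota> ` \<rho>)"
  shows "lin_piece \<iota> \<sigma> W g v = lin_piece \<iota> \<rho> W g v"
proof (rule linear_agree(2)[OF Q \<sigma>(2) W \<sigma>(4) lin_piece(1)[OF g \<sigma>(1)] lin_piece(1)[OF g \<sigma>(2)] _ v])
  show "lin_piece \<iota> \<sigma> W g (\<iota> x) = lin_piece \<iota> \<rho> W g (\<iota> x)" if "x \<in> \<rho> \<inter> W" for x
    using lin_piece(2)[OF g \<sigma>(1), of x] lin_piece(2)[OF g \<sigma>(2), of x] that \<sigma>(3) by auto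
qed

lemma mult_eq:
  assumes "\<rho> \<inter> W \<noteq> {}"
  shows "mult \<iota> Q W k g c \<rho> = - (\<Sum>\<sigma>\<in>{\<sigma>\<in>Q. \<rho> \<subseteq> \<sigma> \<and> pdim \<iota> \<sigma> = k}. c \<sigma> * lin_piece \<iota> \<sigma> W g (nvec \<iota> \<sigma> \<rho>))"
  unfolding mult_def restr_above_eq[OF assms] ..

lemma ridge_two_cells:
  assumes Q: "eucl_complex \<iota> Q" and \<sigma>: "\<sigma> \<in> Q" "\<tau> \<in> Q" "\<tau> \<subseteq> \<sigma>" "\<tau> \<noteq> {}" "pdim \<iota> \<tau> = pdim \<iota> \<sigma> - 2"
  obtains \<rho>1 \<rho>2 where "\<rho>1 \<noteq> \<rho>2" "{\<rho>\<in>Q. \<tau> \<subseteq> \<rho> \<and> pdim \<iota> \<rho> = pdim \<iota> \<sigma> - 1 \<and> \<rho> \<subseteq> \<sigma>} = {\<rho>1, \<rho>2}"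
proof -
  have inj: "inj_on \<iota> \<sigma>" using cell_inj[OF Q \<sigma>(1)] .
  have ne: "\<iota> ` \<tau> \<noteq> {}" using \<sigma>(4) by simp
  have ad: "aff_dim (\<iota> ` \<tau>) = aff_dim (\<iota> ` \<sigma>) - 2" using \<sigma>(5) by (simp add: pdim_def)
  obtain F G where FG: "F facet_of (\<iota> ` \<sigma>)" "G facet_of (\<iota> ` \<sigma>)" "F \<noteq> G"
    "{H. H facet_of (\<iota> ` \<sigma>) \<and> \<iota> ` \<tau> \<subseteq> H} = {F, G}"
    using ridge_two_facets[OF cell_polyhedron[OF Q \<sigma>(1)] cell_face[OF Q \<sigma>(1-3)] ne ad] .
  have f: "F face_of (\<iota> ` \<sigma>)" "G face_of (\<iota> ` \<sigma>)" using FG by (auto simp: facet_of_def)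
  obtain \<rho>1 where r1: "\<rho>1 \<in> Q" "\<rho>1 \<subseteq> \<sigma>" "\<iota> ` \<rho>1 = F" using complex_face_cell[OF Q \<sigma>(1) f(1)] .
  obtain \<rho>2 where r2: "\<rho>2 \<in> Q" "\<rho>2 \<subseteq> \<sigma>" "\<iota> ` \<rho>2 = G" using complex_face_cell[OF Q \<sigma>(1) f(2)] .
  have T: "\<iota> ` \<tau> \<subseteq> F" "\<iota> ` \<tau> \<subseteq> G" using FG(4) by blast+
  have t1: "\<tau> \<subseteq> \<rho>1" using inj_on_image_subset_iff[OF inj \<sigma>(3) r1(2)] T r1(3) by simp
  have t2: "\<tau> \<subseteq> \<rho>2" using inj_on_image_subset_iff[OF inj \<sigma>(3) r2(2)] T r2(3) by simp
  have d: "pdim \<iota> \<rho>1 = pdim \<iota> \<sigma> - 1" "pdim \<iota> \<rho>2 = pdim \<iota> \<sigma> - 1" using FG(1,2) r1 r2 by (auto simp: pdim_def facet_of_def)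
  have "\<rho> = \<rho>1 \<or> \<rho> = \<rho>2" if r: "\<rho> \<in> Q" "\<tau> \<subseteq> \<rho>" "pdim \<iota> \<rho> = pdim \<iota> \<sigma> - 1" "\<rho> \<subseteq> \<sigma>" for \<rho>
  proof -
    have "\<rho> \<noteq> {}" using r(2) \<sigma>(4) by blast
    then have "(\<iota> ` \<rho>) facet_of (\<iota> ` \<sigma>)" using cell_facet[OF Q \<sigma>(1) r(1,4)] r(3) by simp
    then have "\<iota> ` \<rho> \<in> {H. H facet_of (\<iota> ` \<sigma>) \<and> \<iota> ` \<tau> \<subseteq> H}" using r(2) by blast
    then have "\<iota> ` \<rho> = \<iota> ` \<rho>1 \<or> \<iota> ` \<rho> = \<iota> ` \<rho>2" unfolding FG(4) r1 r2 by simp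
    then show ?thesis using inj_on_image_eq_iff[OF inj r(4) r1(2)] inj_on_image_eq_iff[OF inj r(4) r2(2)] by blast
  qed
  then have "\<rho> \<in> Q \<and> \<tau> \<subseteq> \<rho> \<and> pdim \<iota> \<rho> = pdim \<iota> \<sigma> - 1 \<and> \<rho> \<subseteq> \<sigma> \<longleftrightarrow> \<rho> = \<rho>1 \<or> \<rho> = \<rho>2" for \<rho>
    using r1(1,2) r2(1,2) t1 t2 d by metis
  then have eq: "{\<rho>\<in>Q. \<tau> \<subseteq> \<rho> \<and> pdim \<iota> \<rho> = pdim \<iota> \<sigma> - 1 \<and> \<rho> \<subseteq> \<sigma>} = {\<rho>1, \<rho>2}"
    by (simp add: set_eq_iff)
  have "\<rho>1 \<noteq> \<rho>2" using FG(3) r1(3) r2(3) by auto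
  from that[OF this eq] show thesis .
qed

text \<open>At a codimension two cell the double sum is rearranged with \<open>ridge_linear_exchange\<close>; after
  that the inner sums are the balancing conditions of \<^term>\<open>c\<close> at the intermediate cells.\<close>

lemma minkowski_mult:
  assumes Q: "eucl_complex \<iota> Q" and W: "open W" and m: "minkowski \<iota> Q W k c" and g: "PA_on \<iota> Q W g"
  shows "minkowski \<iota> Q W (k - 1) (mult \<iota> Q W k g c)"
proof (rule minkowskiI)
  fix \<tau> assume t: "\<tau> \<in> Q" "\<tau> \<inter> W \<noteq> {}" "pdim \<iota> \<tau> = k - 1 - 1"
  define R where "R = {\<rho>\<in>Q. \<tau> \<subseteq> \<rho> \<and> pdim \<iota> \<rho> = k - 1}"
  define S where "S = {\<sigma>\<in>Q. \<tau> \<subseteq> \<sigma> \<and> pdim \<iota> \<sigma> = k}"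
  define l where "l \<sigma> = lin_piece \<iota> \<sigma> W g" for \<sigma>
  have ne: "\<tau> \<noteq> {}" using t(2) by blast
  have fin: "finite R" "finite S" unfolding R_def S_def by (rule finite_cells_above[OF Q ne])+
  have RD: "\<rho> \<in> Q" "\<tau> \<subseteq> \<rho>" "pdim \<iota> \<rho> = k - 1" "\<rho> \<noteq> {}" "\<rho> \<inter> W \<noteq> {}" if "\<rho> \<in> R" for \<rho>
    using that ne t(2) by (auto simp: R_def)
  have SD: "\<sigma> \<in> Q" "\<tau> \<subseteq> \<sigma>" "pdim \<iota> \<sigma> = k" "\<sigma> \<noteq> {}" "\<sigma> \<inter> W \<noteq> {}" if "\<sigma> \<in> S" for \<sigma>
    using that ne t(2) by (auto simp: S_def)
  have above: "{\<sigma>\<in>Q. \<rho> \<subseteq> \<sigma> \<and> pdim \<iota> \<sigma> = k} = {\<sigma>\<in>S. \<rho> \<subseteq> \<sigma>}" if "\<rho> \<in> R" for \<rho>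
    using that by (auto simp: S_def R_def)
  have nR: "is_nvec (\<iota> ` \<rho>) (\<iota> ` \<tau>) (nvec \<iota> \<rho> \<tau>)" and fR: "(\<iota> ` \<tau>) facet_of (\<iota> ` \<rho>)" if "\<rho> \<in> R" for \<rho>
    using cell_nvec[OF Q RD(1)[OF that] t(1) RD(2)[OF that] ne] cell_facet[OF Q RD(1)[OF that] t(1) RD(2)[OF that] ne]
      RD(3)[OF that] t(3) by simp_all
  have nS: "is_nvec (\<iota> ` \<sigma>) (\<iota> ` \<rho>) (nvec \<iota> \<sigma> \<rho>)" and fS: "(\<iota> ` \<rho>) facet_of (\<iota> ` \<sigma>)" if "\<rho> \<in> R" "\<sigma> \<in> S" "\<rho> \<subseteq> \<sigma>" for \<rho> \<sigma>
    using cell_nvec[OF Q SD(1)[OF that(2)] RD(1)[OF that(1)] that(3) RD(4)[OF that(1)]]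
      cell_facet[OF Q SD(1)[OF that(2)] RD(1)[OF that(1)] that(3) RD(4)[OF that(1)]]
      SD(3)[OF that(2)] RD(3)[OF that(1)] by simp_all
  have exch: "(\<Sum>\<rho>\<in>{\<rho>\<in>R. \<rho> \<subseteq> \<sigma>}. l \<sigma> (nvec \<iota> \<sigma> \<rho>) *\<^sub>R nvec \<iota> \<rho> \<tau>)
      = (\<Sum>\<rho>\<in>{\<rho>\<in>R. \<rho> \<subseteq> \<sigma>}. l \<sigma> (nvec \<iota> \<rho> \<tau>) *\<^sub>R nvec \<iota> \<sigma> \<rho>)" if s: "\<sigma> \<in> S" for \<sigma>
  proof -
    note sd = SD[OF s]
    have pd: "pdim \<iota> \<tau> = pdim \<iota> \<sigma> - 2" using sd t by simp
    obtain \<rho>1 \<rho>2 where r: "\<rho>1 \<noteq> \<rho>2" "{\<rho>\<in>Q. \<tau> \<subseteq> \<rho> \<and> pdim \<iota> \<rho> = pdim \<iota> \<sigma> - 1 \<and> \<rho> \<subseteq> \<sigma>} = {\<rho>1, \<rho>2}"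
      using ridge_two_cells[OF Q sd(1) t(1) sd(2) ne pd] .
    have e: "{\<rho>\<in>R. \<rho> \<subseteq> \<sigma>} = {\<rho>1, \<rho>2}" using r(2) sd(3) by (auto simp: R_def)
    then have r12: "\<rho>1 \<in> R" "\<rho>1 \<subseteq> \<sigma>" "\<rho>2 \<in> R" "\<rho>2 \<subseteq> \<sigma>" by blast+
    have "\<iota> ` \<rho>1 \<noteq> \<iota> ` \<rho>2" using inj_on_image_eq_iff[OF cell_inj[OF Q sd(1)] r12(2,4)] r(1) by simp
    from ridge_linear_exchange[OF cell_convex[OF Q sd(1)] fS[OF r12(1) s r12(2)] fS[OF r12(3) s r12(4)] this
        fR[OF r12(1)] fR[OF r12(3)] nS[OF r12(1) s r12(2)] nS[OF r12(3) s r12(4)] nR[OF r12(1)] nR[OF r12(3)]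
        lin_piece(1)[OF g sd(1)]]
    show ?thesis unfolding e l_def using r(1) by simp
  qed
  \<comment> \<open>The slope of g along \<rho> is the same in every \<sigma> above \<rho>, so it
    can be pulled out of the sum over \<sigma>.\<close>
  have lface: "l \<sigma> (nvec \<iota> \<rho> \<tau>) = l \<rho> (nvec \<iota> \<rho> \<tau>)" if "\<rho> \<in> R" "\<sigma> \<in> S" "\<rho> \<subseteq> \<sigma>" for \<sigma> \<rho>
    unfolding l_def
    using lin_piece_face[OF Q W g SD(1)[OF that(2)] RD(1)[OF that(1)] that(3) RD(5)[OF that(1)]] nR[OF that(1)]
    by (simp add: is_nvec_def)
  have "(\<Sum>\<rho>\<in>R. mult \<iota> Q W k g c \<rho> *\<^sub>R nvec \<iota> \<rho> \<tau>)
      = (\<Sum>\<rho>\<in>R. \<Sum>\<sigma>\<in>{\<sigma>\<in>S. \<rho> \<subseteq> \<sigma>}. - (c \<sigma> *\<^sub>R (l \<sigma> (nvec \<iota> \<sigma> \<rho>) *\<^sub>R nvec \<iota> \<rho> \<tau>)))"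
  proof (rule sum.cong[OF refl])
    fix \<rho> assume r: "\<rho> \<in> R"
    show "mult \<iota> Q W k g c \<rho> *\<^sub>R nvec \<iota> \<rho> \<tau> = (\<Sum>\<sigma>\<in>{\<sigma>\<in>S. \<rho> \<subseteq> \<sigma>}. - (c \<sigma> *\<^sub>R (l \<sigma> (nvec \<iota> \<sigma> \<rho>) *\<^sub>R nvec \<iota> \<rho> \<tau>)))"
      unfolding mult_eq[OF RD(5)[OF r]] above[OF r] l_def
      by (simp add: scaleR_sum_left sum_negf)
  qed
  also have "\<dots> = (\<Sum>\<sigma>\<in>S. \<Sum>\<rho>\<in>{\<rho>\<in>R. \<rho> \<subseteq> \<sigma>}. - (c \<sigma> *\<^sub>R (l \<sigma> (nvec \<iota> \<sigma> \<rho>) *\<^sub>R nvec \<iota> \<rho> \<tau>)))"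
    by (rule sum.swap_restrict[OF fin])
  also have "\<dots> = (\<Sum>\<sigma>\<in>S. - (c \<sigma> *\<^sub>R (\<Sum>\<rho>\<in>{\<rho>\<in>R. \<rho> \<subseteq> \<sigma>}. l \<sigma> (nvec \<iota> \<sigma> \<rho>) *\<^sub>R nvec \<iota> \<rho> \<tau>)))"
    by (simp only: scaleR_sum_right sum_negf)
  also have "\<dots> = (\<Sum>\<sigma>\<in>S. - (c \<sigma> *\<^sub>R (\<Sum>\<rho>\<in>{\<rho>\<in>R. \<rho> \<subseteq> \<sigma>}. l \<sigma> (nvec \<iota> \<rho> \<tau>) *\<^sub>R nvec \<iota> \<sigma> \<rho>)))"
    by (rule sum.cong[OF refl]) (simp add: exch)
  also have "\<dots> = (\<Sum>\<sigma>\<in>S. \<Sum>\<rho>\<in>{\<rho>\<in>R. \<rho> \<subseteq> \<sigma>}. - (l \<rho> (nvec \<iota> \<rho> \<tau>) *\<^sub>R (c \<sigma> *\<^sub>R nvec \<iota> \<sigma> \<rho>)))"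
    by (rule sum.cong[OF refl]) (simp add: scaleR_sum_right sum_negf lface mult.commute)
  also have "\<dots> = (\<Sum>\<rho>\<in>R. \<Sum>\<sigma>\<in>{\<sigma>\<in>S. \<rho> \<subseteq> \<sigma>}. - (l \<rho> (nvec \<iota> \<rho> \<tau>) *\<^sub>R (c \<sigma> *\<^sub>R nvec \<iota> \<sigma> \<rho>)))"
    by (rule sum.swap_restrict[OF fin, symmetric])
  also have "\<dots> = (\<Sum>\<rho>\<in>R. - (l \<rho> (nvec \<iota> \<rho> \<tau>) *\<^sub>R (\<Sum>\<sigma>\<in>{\<sigma>\<in>S. \<rho> \<subseteq> \<sigma>}. c \<sigma> *\<^sub>R nvec \<iota> \<sigma> \<rho>)))"
    by (simp only: scaleR_sum_right sum_negf)
  also have "\<dots> = 0"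
  proof (rule sum.neutral, rule ballI)
    fix \<rho> assume r: "\<rho> \<in> R"
    show "- (l \<rho> (nvec \<iota> \<rho> \<tau>) *\<^sub>R (\<Sum>\<sigma>\<in>{\<sigma>\<in>S. \<rho> \<subseteq> \<sigma>}. c \<sigma> *\<^sub>R nvec \<iota> \<sigma> \<rho>)) = 0"
      using minkowskiD[OF m RD(1)[OF r] RD(5)[OF r] RD(3)[OF r]] unfolding above[OF r] by simp
  qed
  finally show "(\<Sum>\<sigma>\<in>{\<sigma>\<in>Q. \<tau> \<subseteq> \<sigma> \<and> pdim \<iota> \<sigma> = k - 1}. mult \<iota> Q W k g c \<sigma> *\<^sub>R nvec \<iota> \<sigma> \<tau>) = 0"
    unfolding R_def .
qed

text \<open>As \<^term>\<open>c\<close> is balanced, a linear function may be added to \<^term>\<open>g\<close> for free.  It is chosen below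
  to support \<^term>\<open>g\<close> along \<^term>\<open>\<rho>\<close>, which makes every summand nonnegative.\<close>

lemma mult_shift:
  assumes m: "minkowski \<iota> Q W k c" and \<rho>: "\<rho> \<in> Q" "\<rho> \<inter> W \<noteq> {}" "pdim \<iota> \<rho> = k - 1" and h: "linear h"
  shows "mult \<iota> Q W k g c \<rho> =
    (\<Sum>\<sigma>\<in>{\<sigma>\<in>Q. \<rho> \<subseteq> \<sigma> \<and> pdim \<iota> \<sigma> = k}. c \<sigma> * (h (nvec \<iota> \<sigma> \<rho>) - lin_piece \<iota> \<sigma> W g (nvec \<iota> \<sigma> \<rho>)))"
proof -
  interpret h: linear h by fact
  have "(\<Sum>\<sigma>\<in>{\<sigma>\<in>Q. \<rho> \<subseteq> \<sigma> \<and> pdim \<iota> \<sigma> = k}. c \<sigma> * h (nvec \<iota> \<sigma> \<rho>)) = 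
      h (\<Sum>\<sigma>\<in>{\<sigma>\<in>Q. \<rho> \<subseteq> \<sigma> \<and> pdim \<iota> \<sigma> = k}. c \<sigma> *\<^sub>R nvec \<iota> \<sigma> \<rho>)"
    by (simp add: h.sum h.scale)
  also have "\<dots> = 0" using minkowskiD[OF m \<rho>] by (simp add: h.zero)
  finally show ?thesis unfolding mult_eq[OF \<rho>(2)]
    by (simp add: right_diff_distrib sum_subtractf)
qed

text \<open>h lies above g on W and agrees with it along \<rho>, so on leaving \<rho> into \<sigma>
  the slope of g is at most that of h. The tangential parts are equal, which leaves the comparison
  on the normal.\<close>

lemma support_piece_le:
  assumes Q: "eucl_complex \<iota> Q" and g: "PA_on \<iota> Q W g"
    and \<rho>: "\<rho> \<in> Q" "\<sigma> \<in> Q" "\<rho> \<subseteq> \<sigma>" "pdim \<iota> \<sigma> = pdim \<iota> \<rho> + 1"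
    and h: "linear h" "\<And>x. x \<in> W \<Longrightarrow> g x \<le> h (\<iota> x)"
    and W': "open W'" "W' \<subseteq> W" "\<rho> \<inter> W' \<noteq> {}" "\<And>x. x \<in> \<rho> \<inter> W' \<Longrightarrow> h (\<iota> x) = g x"
  shows "lin_piece \<iota> \<sigma> W g (nvec \<iota> \<sigma> \<rho>) \<le> h (nvec \<iota> \<sigma> \<rho>)"
proof -
  let ?l = "lin_piece \<iota> \<sigma> W g" and ?v = "nvec \<iota> \<sigma> \<rho>"
  have lin: "linear ?l" by (rule lin_piece(1)[OF g \<rho>(2)])
  interpret h: linear h by fact
  interpret l: linear ?l by fact
  have ne: "\<rho> \<noteq> {}" using W'(3) by blast
  note nv = cell_nvec[OF Q \<rho>(2,1,3) ne \<rho>(4)] and fc = cell_facet[OF Q \<rho>(2,1,3) ne \<rho>(4)]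
  obtain y where y: "y \<in> \<rho>" "y \<in> W'" using W'(3) by blast
  have y\<sigma>: "y \<in> \<sigma>" using y \<rho>(3) by blast
  have "\<rho> \<noteq> \<sigma>" using \<rho>(4) by auto
  then obtain z where z: "z \<in> \<sigma>" "z \<notin> \<rho>" using \<rho>(3) by blast
  have z': "\<iota> z \<notin> \<iota> ` \<rho>" using z cell_inj[OF Q \<rho>(2)] \<rho>(3) by (auto dest: inj_onD)
  obtain s y' where s: "s > 0" "s \<le> 1" "y' \<in> \<sigma> \<inter> W'" "\<iota> y' = \<iota> y + s *\<^sub>R (\<iota> z - \<iota> y)"
    using cell_segment_near[OF Q \<rho>(2) y\<sigma> W'(1) y(2) z(1)] .
  have "?l (\<iota> y') \<le> h (\<iota> y')" using lin_piece(2)[OF g \<rho>(2), of y'] h(2)[of y'] s(3) W'(2) by auto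
  moreover have "?l (\<iota> y) = h (\<iota> y)" using lin_piece(2)[OF g \<rho>(2) y\<sigma>] W'(4)[of y] y W'(2) by auto
  ultimately have "s * ?l (\<iota> z - \<iota> y) \<le> s * h (\<iota> z - \<iota> y)"
    unfolding s(4) by (simp add: l.add h.add l.scale h.scale)
  then have le: "?l (\<iota> z - \<iota> y) \<le> h (\<iota> z - \<iota> y)" using s(1) by simp
  have p: "?v \<bullet> (\<iota> z - \<iota> y) > 0" using is_nvec_pos[OF cell_convex[OF Q \<rho>(2)] fc nv _ z'] z y by blast
  obtain t where t: "t \<in> dirs (\<iota> ` \<rho>)" "\<iota> z - \<iota> y = (?v \<bullet> (\<iota> z - \<iota> y)) *\<^sub>R ?v + t"
    using is_nvec_decomp[OF fc nv, of "\<iota> z - \<iota> y"] diff_in_dirs[of "\<iota> z" "\<iota> ` \<sigma>" "\<iota> y"] z(1) y\<sigma> by blast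
  have "?l t = h t"
  proof (rule linear_agree(2)[OF Q \<rho>(1) W'(1,3) lin h(1) _ t(1)])
    show "?l (\<iota> x) = h (\<iota> x)" if "x \<in> \<rho> \<inter> W'" for x
      using lin_piece(2)[OF g \<rho>(2), of x] W'(2,4) \<rho>(3) that by auto
  qed
  moreover have "?l (\<iota> z - \<iota> y) = (?v \<bullet> (\<iota> z - \<iota> y)) * ?l ?v + ?l t"
    by (subst t(2)) (simp only: l.add l.scale real_scaleR_def)
  moreover have "h (\<iota> z - \<iota> y) = (?v \<bullet> (\<iota> z - \<iota> y)) * h ?v + h t"
    by (subst t(2)) (simp only: h.add h.scale real_scaleR_def)
  ultimately have "(?v \<bullet> (\<iota> z - \<iota> y)) * ?l ?v \<le> (?v \<bullet> (\<iota> z - \<iota> y)) * h ?v" using le by linarith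
  then show ?thesis using p by simp
qed

text \<open>If l is nonzero at some point of \<rho> \<inter> W, then near it the function is linear,
  being l or 0, and the weight at \<rho> is 0 by \<open>mult_shift\<close>. Otherwise l vanishes on
  \<rho>, the zero functional supports min(0, l) from above along \<rho>, and all summands are
  nonnegative; a cell with positive weight on which l falls off from \<rho> makes the sum
  positive.\<close>

lemma mult_min_linear:
  assumes Q: "eucl_complex \<iota> Q" and W: "open W" and m: "minkowski \<iota> Q W k c"
    and pos: "\<And>\<sigma>. \<sigma> \<in> restr \<iota> Q W k \<Longrightarrow> c \<sigma> \<ge> 0"
    and l: "linear l" and g: "PA_on \<iota> Q W (\<lambda>x. min 0 (l (\<iota> x)))"
    and \<rho>: "\<rho> \<in> restr \<iota> Q W (k - 1)"
  shows mult_min_nonneg: "mult \<iota> Q W k (\<lambda>x. min 0 (l (\<iota> x))) c \<rho> \<ge> 0"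
    and mult_min_support: "mult \<iota> Q W k (\<lambda>x. min 0 (l (\<iota> x))) c \<rho> \<noteq> 0 \<Longrightarrow> z \<in> \<rho> \<Longrightarrow> l (\<iota> z) = 0"
    and mult_min_pos: "\<sigma> \<in> Q \<Longrightarrow> \<rho> \<subseteq> \<sigma> \<Longrightarrow> pdim \<iota> \<sigma> = k \<Longrightarrow> c \<sigma> > 0 \<Longrightarrow> (\<And>z. z \<in> \<rho> \<Longrightarrow> l (\<iota> z) = 0) \<Longrightarrow>
      (\<And>z. z \<in> \<sigma> \<Longrightarrow> l (\<iota> z) \<le> 0) \<Longrightarrow> l (nvec \<iota> \<sigma> \<rho>) < 0 \<Longrightarrow> mult \<iota> Q W k (\<lambda>x. min 0 (l (\<iota> x))) c \<rho> > 0"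
proof -
  let ?g = "\<lambda>x. min 0 (l (\<iota> x))"
  let ?S = "{\<sigma>\<in>Q. \<rho> \<subseteq> \<sigma> \<and> pdim \<iota> \<sigma> = k}"
  have r: "\<rho> \<in> Q" "\<rho> \<inter> W \<noteq> {}" "pdim \<iota> \<rho> = k - 1" using restrD[OF \<rho>] by auto
  then have fin: "finite ?S" by (intro finite_cells_above[OF Q]) blast
  have cS: "c \<sigma> \<ge> 0" if "\<sigma> \<in> ?S" for \<sigma> using that r(2) by (intro pos) (auto simp: restr_def)
  have lin0: "linear (\<lambda>v. 0::real)" by (simp add: linear_zero)
  have cl: "continuous_on UNIV (\<lambda>x. l (\<iota> x))"
    by (rule continuous_on_compose2[OF linear_continuous_on[OF linear_conv_bounded_linear[THEN iffD1, OF l], of UNIV] iota_continuous[OF Q]]) simp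
  have op: "open {x. l (\<iota> x) < 0}" "open {x. l (\<iota> x) > 0}"
    using cl by (auto intro!: open_Collect_less continuous_on_const)
  have nonneg: "mult \<iota> Q W k ?g c \<rho> \<ge> 0"
    if h: "linear h" "\<And>x. min 0 (l (\<iota> x)) \<le> h (\<iota> x)" and
      W': "open W'" "W' \<subseteq> W" "\<rho> \<inter> W' \<noteq> {}" "\<And>x. x \<in> \<rho> \<inter> W' \<Longrightarrow> h (\<iota> x) = ?g x" for h W'
    unfolding mult_shift[OF m r h(1)]
  proof (intro sum_nonneg mult_nonneg_nonneg cS)
    fix \<sigma> assume s: "\<sigma> \<in> ?S"
    have "lin_piece \<iota> \<sigma> W ?g (nvec \<iota> \<sigma> \<rho>) \<le> h (nvec \<iota> \<sigma> \<rho>)"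
      by (rule support_piece_le[OF Q g r(1) _ _ _ h(1) h(2) W']) (use s r in auto)
    then show "h (nvec \<iota> \<sigma> \<rho>) - lin_piece \<iota> \<sigma> W ?g (nvec \<iota> \<sigma> \<rho>) \<ge> 0" by simp
  qed
  have zero: "mult \<iota> Q W k ?g c \<rho> = 0"
    if h: "linear h" and W': "open W'" "W' \<subseteq> W" "\<rho> \<inter> W' \<noteq> {}" "\<And>x. x \<in> W' \<Longrightarrow> h (\<iota> x) = ?g x" for h W'
    unfolding mult_shift[OF m r h]
  proof (rule sum.neutral, rule ballI)
    fix \<sigma> assume s: "\<sigma> \<in> ?S"
    have nv: "is_nvec (\<iota> ` \<sigma>) (\<iota> ` \<rho>) (nvec \<iota> \<sigma> \<rho>)" using s r by (intro cell_nvec[OF Q]) auto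
    have "lin_piece \<iota> \<sigma> W ?g (nvec \<iota> \<sigma> \<rho>) = h (nvec \<iota> \<sigma> \<rho>)"
    proof (rule linear_agree(2)[OF Q _ W'(1) _ lin_piece(1)[OF g] h])
      show "\<sigma> \<in> Q" "\<sigma> \<in> Q" "\<sigma> \<inter> W' \<noteq> {}" using s W'(3) by auto
      show "lin_piece \<iota> \<sigma> W ?g (\<iota> x) = h (\<iota> x)" if "x \<in> \<sigma> \<inter> W'" for x
        using lin_piece(2)[OF g, of \<sigma> x] that s W' by auto
    qed (use nv in \<open>simp add: is_nvec_def\<close>)
    then show "c \<sigma> * (h (nvec \<iota> \<sigma> \<rho>) - lin_piece \<iota> \<sigma> W ?g (nvec \<iota> \<sigma> \<rho>)) = 0" by simp
  qed
  have zneg: "mult \<iota> Q W k ?g c \<rho> = 0" if "y \<in> \<rho>" "y \<in> W" "l (\<iota> y) < 0" for y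
    using that W op by (intro zero[OF l, of "W \<inter> {x. l (\<iota> x) < 0}"]) auto
  have zpos: "mult \<iota> Q W k ?g c \<rho> = 0" if "y \<in> \<rho>" "y \<in> W" "l (\<iota> y) > 0" for y
    using that W op by (intro zero[OF lin0, of "W \<inter> {x. l (\<iota> x) > 0}"]) auto
  have cases: "mult \<iota> Q W k ?g c \<rho> = 0 \<or> (\<forall>y\<in>\<rho> \<inter> W. l (\<iota> y) = 0)"
    using zneg zpos by (metis IntD1 IntD2 linorder_neqE_linordered_idom)
  then show "mult \<iota> Q W k ?g c \<rho> \<ge> 0"
  proof
    assume a: "\<forall>y\<in>\<rho> \<inter> W. l (\<iota> y) = 0"
    show ?thesis by (rule nonneg[OF lin0 _ W order_refl r(2)]) (use a in auto)
  qed simp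
  \<comment> \<open>\<open>cases\<close> only speaks of points of W; linearity carries the vanishing
    to the whole cell.\<close>
  show "l (\<iota> z) = 0" if "mult \<iota> Q W k ?g c \<rho> \<noteq> 0" "z \<in> \<rho>"
    using linear_agree(1)[OF Q r(1) W r(2) l lin0 _ that(2)] cases that(1) by blast
  show "mult \<iota> Q W k ?g c \<rho> > 0" if \<sigma>: "\<sigma> \<in> Q" "\<rho> \<subseteq> \<sigma>" "pdim \<iota> \<sigma> = k" "c \<sigma> > 0"
    and l0: "\<And>z. z \<in> \<rho> \<Longrightarrow> l (\<iota> z) = 0" and le: "\<And>z. z \<in> \<sigma> \<Longrightarrow> l (\<iota> z) \<le> 0" and ln: "l (nvec \<iota> \<sigma> \<rho>) < 0"
  proof -
    have sS: "\<sigma> \<in> ?S" using \<sigma> by simp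
    have nv: "is_nvec (\<iota> ` \<sigma>) (\<iota> ` \<rho>) (nvec \<iota> \<sigma> \<rho>)" using \<sigma> r by (intro cell_nvec[OF Q]) auto
    have "lin_piece \<iota> \<sigma> W ?g (nvec \<iota> \<sigma> \<rho>) = l (nvec \<iota> \<sigma> \<rho>)"
    proof (rule linear_agree(2)[OF Q \<sigma>(1) W _ lin_piece(1)[OF g \<sigma>(1)] l])
      show "\<sigma> \<inter> W \<noteq> {}" using \<sigma>(2) r(2) by auto
      show "lin_piece \<iota> \<sigma> W ?g (\<iota> x) = l (\<iota> x)" if "x \<in> \<sigma> \<inter> W" for x
        using lin_piece(2)[OF g \<sigma>(1), of x] that le[of x] by auto
    qed (use nv in \<open>simp add: is_nvec_def\<close>)
    then have p: "c \<sigma> * (0 - lin_piece \<iota> \<sigma> W ?g (nvec \<iota> \<sigma> \<rho>)) > 0" using ln \<sigma>(4) by (simp add: mult_pos_neg)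
    show ?thesis unfolding mult_shift[OF m r lin0]
    proof (rule sum_pos2[where i = \<sigma>])
      show "finite ?S" by (rule fin)
      show "\<sigma> \<in> ?S" by (rule sS)
      show "0 < c \<sigma> * (0 - lin_piece \<iota> \<sigma> W ?g (nvec \<iota> \<sigma> \<rho>))" by (rule p)
      fix \<sigma>' assume s: "\<sigma>' \<in> ?S"
      have "lin_piece \<iota> \<sigma>' W ?g (nvec \<iota> \<sigma>' \<rho>) \<le> 0"
        by (rule support_piece_le[OF Q g r(1) _ _ _ lin0 _ W order_refl r(2)]) (use s r l0 in auto)
      then show "0 \<le> c \<sigma>' * (0 - lin_piece \<iota> \<sigma>' W ?g (nvec \<iota> \<sigma>' \<rho>))" using cS[OF s] by (simp add: mult_nonneg_nonpos)
    qed
  qed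
qed

lemma linear_inner_left: "linear (\<lambda>v. a \<bullet> v)"
  by (simp add: bounded_linear.linear bounded_linear_inner_right)

text \<open>Cells cut along the zero set see a constant sign. The hyperplane of h may be
  inhomogeneous; the second hypothesis expresses its equation by a linear functional on the image of
  \<iota>.\<close>

lemma PA_on_refine_min:
  assumes "h \<in> set hs" "\<And>x. a \<bullet> \<iota> x = fst h \<bullet> \<iota> x - snd h"
  shows "PA_on \<iota> (refine \<iota> hs Q) W (\<lambda>x. min 0 (a \<bullet> \<iota> x))"
  unfolding PA_on_def
proof
  fix \<rho> assume r: "\<rho> \<in> refine \<iota> hs Q"
  then obtain H where H: "H \<in> halves h" "\<forall>x\<in>\<rho>. \<iota> x \<in> H" using refine_cases assms(1) by metis
  from H(1) show "\<exists>l. linear l \<and> (\<forall>x\<in>\<rho> \<inter> W. min 0 (a \<bullet> \<iota> x) = l (\<iota> x))"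
  proof (cases rule: halves_cases)
    case 1
    then have "a \<bullet> \<iota> x \<le> 0" if "x \<in> \<rho>" for x using H(2) that assms(2)[of x] by auto
    then show ?thesis by (intro exI[of _ "\<lambda>v. a \<bullet> v"]) (auto simp: linear_inner_left)
  next
    case 2
    then have "a \<bullet> \<iota> x \<ge> 0" if "x \<in> \<rho>" for x using H(2) that assms(2)[of x] by auto
    then show ?thesis by (intro exI[of _ "\<lambda>v. 0"]) (auto simp: linear_zero)
  next
    case 3
    then have "a \<bullet> \<iota> x = 0" if "x \<in> \<rho>" for x using H(2) that assms(2)[of x] by auto
    then show ?thesis by (intro exI[of _ "\<lambda>v. 0"]) (auto simp: linear_zero)
  qed
qed

text \<open>The product is computed on the given complex, where \<open>pos_cycle_nonneg\<close>
  makes the weight nonnegative; \<open>mult_min_nonneg\<close> then yields a nonnegative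
  representative on the same complex.\<close>

lemma concave_PA_min:
  assumes "in_class \<iota> Q0 Q1" "open U"
  shows "concave_PA \<iota> Q0 U (\<lambda>x. min 0 (a \<bullet> \<iota> x))"
  unfolding concave_PA_def
proof (intro conjI allI impI)
  have "PA_on \<iota> (refine \<iota> [(a, 0)] Q1) U (\<lambda>x. min 0 (a \<bullet> \<iota> x))"
    by (rule PA_on_refine_min[of "(a, 0)"]) auto
  then show "\<exists>Q. in_class \<iota> Q0 Q \<and> PA_on \<iota> Q U (\<lambda>x. min 0 (a \<bullet> \<iota> x))"
    using in_class_refine[OF assms(1)] by blast
next
  fix W Q k c
  assume "open W \<and> W \<subseteq> U \<and> in_class \<iota> Q0 Q \<and> PA_on \<iota> Q W (\<lambda>x. min 0 (a \<bullet> \<iota> x)) \<and>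
     minkowski \<iota> Q W k c \<and> pos_cycle \<iota> Q0 W k Q c"
  then have *: "open W" "in_class \<iota> Q0 Q" "PA_on \<iota> Q W (\<lambda>x. min 0 (a \<bullet> \<iota> x))"
    "minkowski \<iota> Q W k c" "pos_cycle \<iota> Q0 W k Q c" by blast+
  note Q = in_class_complex[OF *(2)]
  show "pos_cycle \<iota> Q0 W (k - 1) Q (mult \<iota> Q W k (\<lambda>x. min 0 (a \<bullet> \<iota> x)) c)"
    by (rule pos_cycle_refl[OF *(2) minkowski_mult[OF Q *(1,4,3)]
          mult_min_nonneg[OF Q *(1,4) pos_cycle_nonneg[OF *(5) Q] linear_inner_left *(3)]])
qed

section \<open>Convex combinations along the edges at a vertex\<close>

lemma orthonormal_extend:
  fixes D :: "'v::euclidean_space set"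
  assumes D: "subspace D" and B0: "B0 \<subseteq> D" "finite B0" "pairwise orthogonal B0" "\<And>b. b \<in> B0 \<Longrightarrow> norm b = 1"
  obtains B where "B0 \<subseteq> B" "B \<subseteq> D" "finite B" "pairwise orthogonal B" "\<And>b. b \<in> B \<Longrightarrow> norm b = 1"
    "span B = D"
proof -
  let ?S = "span B0"
  let ?E = "{y\<in>D. \<forall>x\<in>?S. orthogonal x y}"
  have subE: "subspace ?E"
    using D by (auto simp: subspace_def orthogonal_def inner_add_right)
  obtain B' where B': "B' \<subseteq> ?E" "pairwise orthogonal B'" "\<And>x. x \<in> B' \<Longrightarrow> norm x = 1"
    "independent B'" "card B' = dim ?E" "span B' = ?E"
    by (rule orthonormal_basis_subspace[OF subE], rule that; assumption)
  have SD: "?S \<subseteq> D" using B0(1) D by (rule span_minimal)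
  have fB': "finite B'" using B'(4) independent_bound_general by blast
  have orth: "orthogonal x y" if "x \<in> B0" "y \<in> B'" for x y
    using that B'(1) span_base by blast
  have po: "pairwise orthogonal (B0 \<union> B')"
    using B0(3) B'(2) orth orth[THEN orthogonal_commute[THEN iffD1]] by (auto simp: pairwise_def)
  have n1: "norm b = 1" if "b \<in> B0 \<union> B'" for b using that B0(4) B'(3) by blast
  have nz: "0 \<notin> B0 \<union> B'" using n1 by force
  have ind: "independent (B0 \<union> B')" using pairwise_orthogonal_independent[OF po nz] .
  have disj: "B0 \<inter> B' = {}"
  proof (rule ccontr)
    assume "B0 \<inter> B' \<noteq> {}"
    then obtain x where "x \<in> B0" "x \<in> B'" by blast
    then have "orthogonal x x" "x \<noteq> 0" using orth nz by auto
    then show False by (simp add: orthogonal_self)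
  qed
  have "dim ?E + dim ?S = dim D"
    by (rule dim_subspace_orthogonal_to_vectors[OF subspace_span D SD])
  moreover have "dim ?S = card B0"
    using independent_mono[OF ind, of B0] by (simp add: dim_eq_card_independent)
  ultimately have "card (B0 \<union> B') = dim D" using B'(5) card_Un_disjoint[OF B0(2) fB' disj] by simp
  moreover have sub: "B0 \<union> B' \<subseteq> D" using B0(1) B'(1) by blast
  ultimately have "D \<subseteq> span (B0 \<union> B')" using card_ge_dim_independent[OF sub ind] by simp
  moreover have "span (B0 \<union> B') \<subseteq> D" using sub D by (rule span_minimal)
  ultimately have "span (B0 \<union> B') = D" by blast
  from that[OF _ sub _ po n1 this] show thesis using B0(2) fB' by blast
qed

text \<open>A vertex has no tangential directions, so the edge lies on one ray from it and the
  coefficient of the unit normal is the distance.\<close>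

lemma dist_nvec_point:
  assumes "eucl_complex \<iota> Q" "\<rho> \<in> Q" "{x} \<in> Q" "x \<in> \<rho>" "pdim \<iota> \<rho> = 1" "z \<in> \<rho>" "z \<noteq> x"
  shows "\<iota> z - \<iota> x = dist (\<iota> z) (\<iota> x) *\<^sub>R nvec \<iota> \<rho> {x}"
proof -
  have p: "pdim \<iota> \<rho> = pdim \<iota> {x} + 1" using assms(5) by (simp add: pdim_def)
  have s: "{x} \<subseteq> \<rho>" using assms(4) by simp
  note nv = cell_nvec[OF assms(1-3) s _ p, simplified] and fc = cell_facet[OF assms(1-3) s _ p, simplified]
  obtain t where t: "t \<in> dirs {\<iota> x}" "\<iota> z - \<iota> x = (nvec \<iota> \<rho> {x} \<bullet> (\<iota> z - \<iota> x)) *\<^sub>R nvec \<iota> \<rho> {x} + t"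
    using is_nvec_decomp[OF fc nv, of "\<iota> z - \<iota> x"] diff_in_dirs[of "\<iota> z" "\<iota> ` \<rho>" "\<iota> x"] assms(4,6) by blast
  have e: "\<iota> z - \<iota> x = (nvec \<iota> \<rho> {x} \<bullet> (\<iota> z - \<iota> x)) *\<^sub>R nvec \<iota> \<rho> {x}" using t by simp
  have "\<iota> z \<noteq> \<iota> x" using cell_inj[OF assms(1,2)] assms(4,6,7) by (auto dest: inj_onD)
  then have "nvec \<iota> \<rho> {x} \<bullet> (\<iota> z - \<iota> x) > 0"
    using is_nvec_pos[OF cell_convex[OF assms(1,2)] fc nv, of "\<iota> z" "\<iota> x"] assms(6) by blast
  moreover have "norm (nvec \<iota> \<rho> {x}) = 1" using nv by (simp add: is_nvec_def)
  ultimately have "norm (\<iota> z - \<iota> x) = nvec \<iota> \<rho> {x} \<bullet> (\<iota> z - \<iota> x)" using e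
    by (metis abs_of_pos mult.right_neutral norm_scaleR)
  then show ?thesis using e by (simp add: dist_norm)
qed

text \<open>Weak concavity for \<tau> = {x} and k = 1. Testing at \<open>y \<rho>\<close> gives
  coefficients proportional to the weight over the distance; balancing of c at x is exactly the
  statement that their centre of mass is x.\<close>

lemma weakly_concave_star:
  assumes Q0: "in_class \<iota> Q0 Q" "subdiv Q Qb" and U: "x \<in> U" and xQ: "{x} \<in> Q"
    and R: "R = {\<rho>\<in>Q. x \<in> \<rho> \<and> pdim \<iota> \<rho> = 1}" "\<And>\<rho>. \<rho> \<in> R \<Longrightarrow> \<rho> \<subseteq> U"
    and gs: "int (length gs) = n - 1" "\<And>g. g \<in> set gs \<Longrightarrow> concave_PA \<iota> Q0 U g" "\<And>g. g \<in> set gs \<Longrightarrow> PA_on \<iota> Q U g"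
    and c: "c = mults \<iota> Q U n gs (pullback \<iota> Qb b)" "minkowski \<iota> Q U 1 c" "\<And>\<rho>. \<rho> \<in> R \<Longrightarrow> c \<rho> \<ge> 0" "\<exists>\<rho>\<in>R. c \<rho> > 0"
    and y: "\<And>\<rho>. \<rho> \<in> R \<Longrightarrow> y \<rho> \<in> \<rho>" "\<And>\<rho>. \<rho> \<in> R \<Longrightarrow> y \<rho> \<noteq> x"
    and f: "weakly_concave \<iota> Q0 n U Qb b f"
  shows "(\<Sum>\<rho>\<in>R. c \<rho> / dist (\<iota> (y \<rho>)) (\<iota> x)) * f x \<ge> (\<Sum>\<rho>\<in>R. c \<rho> / dist (\<iota> (y \<rho>)) (\<iota> x) * f (y \<rho>))"
proof -
  note Q = in_class_complex[OF Q0(1)]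
  have fin: "finite R" unfolding R(1) by (rule finite_subset[OF _ finite_cells_at[OF Q, of x]]) blast
  define t where "t \<rho> = dist (\<iota> (y \<rho>)) (\<iota> x)" for \<rho>
  \<comment> \<open>L normalises the coefficients to sum 1. Multiplied by the distance
    \<open>t\<close>, they give the weight c / L, which is the one declared in the balanced
    combination.\<close>
  define L where "L = (\<Sum>\<rho>\<in>R. c \<rho> / t \<rho>)"
  have RQ: "\<rho> \<in> Q" "x \<in> \<rho>" "pdim \<iota> \<rho> = 1" if "\<rho> \<in> R" for \<rho> using that by (auto simp: R(1))
  have tpos: "t \<rho> > 0" if "\<rho> \<in> R" for \<rho>
  proof -
    have "\<iota> (y \<rho>) \<noteq> \<iota> x" using cell_inj[OF Q RQ(1)[OF that]] RQ(2)[OF that] y[OF that] by (auto dest: inj_onD)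
    then show ?thesis by (simp add: t_def)
  qed
  obtain \<rho>0 where r0: "\<rho>0 \<in> R" "c \<rho>0 > 0" using c(4) by blast
  have Lpos: "L > 0" unfolding L_def
  proof (rule sum_pos2[where i = \<rho>0])
    show "0 < c \<rho>0 / t \<rho>0" using r0 tpos by simp
    show "0 \<le> c \<rho> / t \<rho>" if "\<rho> \<in> R" for \<rho> using c(3)[OF that] tpos[OF that] by simp
  qed (use fin r0 in auto)
  \<comment> \<open>Convex combinations are indexed by naturals, so the edges are
    enumerated.\<close>
  obtain \<sigma>s where bij: "bij_betw \<sigma>s {..<card R} R"
    using ex_bij_betw_nat_finite[OF fin] by (auto simp: atLeast0LessThan)
  let ?I = "{..<card R}"
  define xs where "xs i = y (\<sigma>s i)" for i
  define \<nu> where "\<nu> i = c (\<sigma>s i) / t (\<sigma>s i) / L" for i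
  have sR: "\<sigma>s i \<in> R" if "i \<in> ?I" for i using bij that by (auto simp: bij_betw_def)
  have reidx: "(\<Sum>i\<in>?I. h (\<sigma>s i)) = (\<Sum>\<rho>\<in>R. h \<rho>)" for h :: "'a set \<Rightarrow> 'c::comm_monoid_add"
    by (rule sum.reindex_bij_betw[OF bij])
  have "balanced_cc \<iota> Q0 n U Qb b x ?I xs \<nu>"
    unfolding balanced_cc_def
  proof (intro conjI ballI exI[of _ Q] exI[of _ "{x}"] exI[of _ \<sigma>s] exI[of _ "\<lambda>\<sigma>. c \<sigma> / L"])
    show "finite ?I" "x \<in> U" by (simp_all add: U)
    show "xs i \<in> U" if "i \<in> ?I" for i using R(2)[OF sR[OF that]] y(1)[OF sR[OF that]] by (auto simp: xs_def)
    show "\<nu> i \<ge> 0" if "i \<in> ?I" for i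
      using c(3)[OF sR[OF that]] tpos[OF sR[OF that]] Lpos by (simp add: \<nu>_def)
    have "sum \<nu> ?I = (\<Sum>\<rho>\<in>R. c \<rho> / t \<rho> / L)" unfolding \<nu>_def by (rule reidx)
    also have "\<dots> = L / L" unfolding L_def by (rule sum_divide_distrib[symmetric])
    also have "\<dots> = 1" using Lpos by simp
    finally show s1: "sum \<nu> ?I = 1" .
    have "(\<Sum>i\<in>?I. \<nu> i *\<^sub>R (\<iota> (xs i) - \<iota> x)) = (\<Sum>\<rho>\<in>R. (c \<rho> / t \<rho> / L) *\<^sub>R (\<iota> (y \<rho>) - \<iota> x))"
      unfolding \<nu>_def xs_def by (rule reidx)
    also have "\<dots> = (\<Sum>\<rho>\<in>R. (1 / L) *\<^sub>R (c \<rho> *\<^sub>R nvec \<iota> \<rho> {x}))"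
    proof (rule sum.cong[OF refl])
      fix \<rho> assume r: "\<rho> \<in> R"
      have "\<iota> (y \<rho>) - \<iota> x = t \<rho> *\<^sub>R nvec \<iota> \<rho> {x}" unfolding t_def
        by (rule dist_nvec_point[OF Q RQ(1)[OF r] xQ RQ(2,3)[OF r] y[OF r]])
      then show "(c \<rho> / t \<rho> / L) *\<^sub>R (\<iota> (y \<rho>) - \<iota> x) = (1 / L) *\<^sub>R (c \<rho> *\<^sub>R nvec \<iota> \<rho> {x})"
        using tpos[OF r] by simp
    qed
    also have "\<dots> = (1 / L) *\<^sub>R (\<Sum>\<rho>\<in>R. c \<rho> *\<^sub>R nvec \<iota> \<rho> {x})" by (rule scaleR_sum_right[symmetric])
    also have "(\<Sum>\<rho>\<in>R. c \<rho> *\<^sub>R nvec \<iota> \<rho> {x}) = 0"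
      using minkowskiD[OF c(2) xQ] U unfolding R(1) by (simp add: pdim_def)
    finally have "(\<Sum>i\<in>?I. \<nu> i *\<^sub>R \<iota> (xs i)) - sum \<nu> ?I *\<^sub>R \<iota> x = 0"
      by (simp add: scaleR_diff_right sum_subtractf scaleR_sum_left)
    then show "(\<Sum>i\<in>?I. \<nu> i *\<^sub>R \<iota> (xs i)) = \<iota> x" by (simp add: s1)
    show "in_class \<iota> Q0 Q" "{x} \<in> Q" "x \<in> {x}" using Q0 xQ by simp_all
    show "\<sigma>s i \<in> Q" "\<sigma>s i \<subseteq> U" "xs i \<in> \<sigma>s i" if "i \<in> ?I" for i
      using RQ(1)[OF sR[OF that]] R(2)[OF sR[OF that]] y(1)[OF sR[OF that]] by (simp_all add: xs_def)
    have pf: "pface \<iota> {x} \<rho>" if "\<rho> \<in> R" for \<rho>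
      using pface_iff[OF cell_inj[OF Q RQ(1)[OF that]]] cell_face[OF Q RQ(1)[OF that] xQ] RQ(2)[OF that] by simp
    then show "pface \<iota> {x} (\<sigma>s i)" if "i \<in> ?I" for i using sR[OF that] .
    have p0: "pdim \<iota> {x} = 0" by (simp add: pdim_def)
    have "{\<sigma> \<in> Q. pdim \<iota> \<sigma> = pdim \<iota> {x} + 1 \<and> pface \<iota> {x} \<sigma>} = R"
    proof
      show "{\<sigma> \<in> Q. pdim \<iota> \<sigma> = pdim \<iota> {x} + 1 \<and> pface \<iota> {x} \<sigma>} \<subseteq> R"
        unfolding p0 R(1) pface_def by auto
      show "R \<subseteq> {\<sigma> \<in> Q. pdim \<iota> \<sigma> = pdim \<iota> {x} + 1 \<and> pface \<iota> {x} \<sigma>}"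
        using pf RQ p0 by auto
    qed
    then show "bij_betw \<sigma>s ?I {\<sigma> \<in> Q. pdim \<iota> \<sigma> = pdim \<iota> {x} + 1 \<and> pface \<iota> {x} \<sigma>}" using bij by simp
    show "\<nu> i * infdist (\<iota> (xs i)) (affine hull \<iota> ` {x}) = c (\<sigma>s i) / L" if "i \<in> ?I" for i
      using tpos[OF sR[OF that]] by (simp add: \<nu>_def xs_def t_def)
    have "minkowski \<iota> Q U 1 (\<lambda>\<sigma>. c \<sigma> / L)"
    proof (rule minkowskiI)
      fix \<tau> assume "\<tau> \<in> Q" "\<tau> \<inter> U \<noteq> {}" "pdim \<iota> \<tau> = 1 - 1"
      from minkowskiD[OF c(2) this] have "(\<Sum>\<sigma>\<in>{\<sigma> \<in> Q. \<tau> \<subseteq> \<sigma> \<and> pdim \<iota> \<sigma> = 1}. c \<sigma> *\<^sub>R nvec \<iota> \<sigma> \<tau>) = 0" .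
      then have "(1 / L) *\<^sub>R (\<Sum>\<sigma>\<in>{\<sigma> \<in> Q. \<tau> \<subseteq> \<sigma> \<and> pdim \<iota> \<sigma> = 1}. c \<sigma> *\<^sub>R nvec \<iota> \<sigma> \<tau>) = 0" by simp
      then show "(\<Sum>\<sigma>\<in>{\<sigma> \<in> Q. \<tau> \<subseteq> \<sigma> \<and> pdim \<iota> \<sigma> = 1}. (c \<sigma> / L) *\<^sub>R nvec \<iota> \<sigma> \<tau>) = 0"
        unfolding scaleR_sum_right by simp
    qed
    \<comment> \<open>The rescaled weight is a single product with coefficient 1 / L > 0, hence the
      index set {0}.\<close>
    moreover have "(\<lambda>\<sigma>. \<Sum>j\<in>{0::nat}. 1 / L * mults \<iota> Q U n gs (pullback \<iota> Qb b) \<sigma>) = (\<lambda>\<sigma>. c \<sigma> / L)"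
      by (simp add: c(1))
    then have "cyc_eq \<iota> Q0 U 1 Q (\<lambda>\<sigma>. c \<sigma> / L) Q (\<lambda>\<sigma>. \<Sum>j\<in>{0::nat}. 1 / L * mults \<iota> Q U n gs (pullback \<iota> Qb b) \<sigma>)"
      using cyc_eq_refl[OF Q0(1)] by metis
    moreover have "1 \<le> n" using gs(1) by linarith
    ultimately have "beta_pos \<iota> Q0 n U Qb b 1 Q (\<lambda>\<sigma>. c \<sigma> / L)"
      unfolding beta_pos_def
      by (intro conjI exI[of _ "{0::nat}"] exI[of _ "\<lambda>j::nat. 1 / L"] exI[of _ "\<lambda>j::nat. gs"] exI[of _ Q])
        (use gs Q0 Lpos in simp_all)
    then show "beta_pos \<iota> Q0 n U Qb b (pdim \<iota> {x} + 1) Q (\<lambda>\<sigma>. c \<sigma> / L)" by (simp add: p0)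
  qed
  then have "f x \<ge> (\<Sum>i\<in>?I. \<nu> i * f (xs i))" using f unfolding weakly_concave_def by blast
  also have "(\<Sum>i\<in>?I. \<nu> i * f (xs i)) = (\<Sum>\<rho>\<in>R. c \<rho> / t \<rho> / L * f (y \<rho>))"
    unfolding \<nu>_def xs_def by (rule reidx)
  also have "\<dots> = (\<Sum>\<rho>\<in>R. c \<rho> / t \<rho> * f (y \<rho>)) / L" by (simp add: sum_divide_distrib)
  finally have "(\<Sum>\<rho>\<in>R. c \<rho> / t \<rho> * f (y \<rho>)) \<le> L * f x" using Lpos by (simp add: field_simps)
  then show ?thesis by (simp add: L_def t_def)
qed

section \<open>A one-dimensional cycle through a given ray\<close>

locale star_refinement =
  fixes \<iota> :: "'x::topological_space \<Rightarrow> 'v::euclidean_space" and Qb :: "'x set set" and x :: 'x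
    and \<epsilon> :: real and bl :: "'v list"
  assumes Qb: "eucl_complex \<iota> Qb" and eps: "\<epsilon> > 0"
    and orth: "pairwise orthogonal (set bl)" and unit: "\<And>b. b \<in> set bl \<Longrightarrow> norm b = 1"
    and spn: "span (set bl) = UNIV"
begin

text \<open>For each basis vector, the hyperplane through x and its translates by \<epsilon> on both
  sides. The middle ones make x a vertex, the outer ones bound all cells at x.\<close>

definition hyps :: "('v \<times> real) list" where
  "hyps = concat (map (\<lambda>b. [(b, b \<bullet> \<iota> x - \<epsilon>), (b, b \<bullet> \<iota> x), (b, b \<bullet> \<iota> x + \<epsilon>)]) bl)"

definition star_complex :: "'x set set" where "star_complex = refine \<iota> hyps Qb"

definition in_range :: "int \<Rightarrow> real \<Rightarrow> bool" where
  "in_range k s \<longleftrightarrow> (if k > 0 then 0 \<le> s \<and> s \<le> \<epsilon> else if k < 0 then - \<epsilon> \<le> s \<and> s \<le> 0 else s = 0)"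

definition sector :: "'x set \<Rightarrow> ('v \<Rightarrow> int) \<Rightarrow> 'x set" where
  "sector \<sigma> \<kappa> = {z \<in> \<sigma>. \<forall>b\<in>set bl. in_range (\<kappa> b) (b \<bullet> (\<iota> z - \<iota> x))}"

lemma in_range_zero: "in_range 0 s \<Longrightarrow> in_range k s"
  using eps by (simp add: in_range_def)

lemma hyps_mem: "h \<in> set hyps \<longleftrightarrow> (\<exists>b\<in>set bl. h = (b, b \<bullet> \<iota> x - \<epsilon>) \<or> h = (b, b \<bullet> \<iota> x) \<or> h = (b, b \<bullet> \<iota> x + \<epsilon>))"
  by (auto simp: hyps_def)

lemma star_eucl: "eucl_complex \<iota> star_complex"
  unfolding star_complex_def by (rule eucl_complex_refine[OF Qb])

text \<open>Each cell lies on one side of every outer hyperplane, and x lies strictly on the inner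
  side.\<close>

lemma star_cell_bounds:
  assumes "\<rho> \<in> star_complex" "x \<in> \<rho>"
  obtains \<sigma> where "\<sigma> \<in> Qb" "\<rho> \<subseteq> \<sigma>" "\<And>b z. b \<in> set bl \<Longrightarrow> z \<in> \<rho> \<Longrightarrow> \<bar>b \<bullet> (\<iota> z - \<iota> x)\<bar> \<le> \<epsilon>"
proof -
  obtain \<sigma> where s: "\<sigma> \<in> Qb" "\<rho> \<subseteq> \<sigma>" "\<And>h. h \<in> set hyps \<Longrightarrow> \<exists>H\<in>halves h. \<forall>x\<in>\<rho>. \<iota> x \<in> H"
    by (rule refine_cases[OF assms(1)[unfolded star_complex_def]], rule that; assumption)
  have "\<bar>b \<bullet> (\<iota> z - \<iota> x)\<bar> \<le> \<epsilon>" if b: "b \<in> set bl" and z: "z \<in> \<rho>" for b z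
  proof -
    have "(b, b \<bullet> \<iota> x - \<epsilon>) \<in> set hyps" using b by (auto simp: hyps_mem)
    then obtain H where H: "H \<in> halves (b, b \<bullet> \<iota> x - \<epsilon>)" "\<forall>x\<in>\<rho>. \<iota> x \<in> H" using s(3) by blast
    have 1: "b \<bullet> \<iota> z \<ge> b \<bullet> \<iota> x - \<epsilon>"
      using H(1)
    proof (cases rule: halves_cases)
      case 1
      then have "b \<bullet> \<iota> x \<le> b \<bullet> \<iota> x - \<epsilon>" using H(2) assms(2) by fastforce
      then show ?thesis using eps by simp
    qed (use H(2) z in auto)
    have "(b, b \<bullet> \<iota> x + \<epsilon>) \<in> set hyps" using b by (auto simp: hyps_mem)
    then obtain K where K: "K \<in> halves (b, b \<bullet> \<iota> x + \<epsilon>)" "\<forall>x\<in>\<rho>. \<iota> x \<in> K" using s(3) by blast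
    have 2: "b \<bullet> \<iota> z \<le> b \<bullet> \<iota> x + \<epsilon>"
      using K(1)
    proof (cases rule: halves_cases)
      case 2
      then have "b \<bullet> \<iota> x \<ge> b \<bullet> \<iota> x + \<epsilon>" using K(2) assms(2) by fastforce
      then show ?thesis using eps by simp
    qed (use K(2) z in auto)
    show ?thesis using 1 2 by (simp add: inner_diff_right abs_le_iff)
  qed
  then show thesis using that s by blast
qed

lemma sector_mem: assumes "\<sigma> \<in> Qb" shows "sector \<sigma> \<kappa> \<in> star_complex"
proof -
  \<comment> \<open>The three offsets of b are distinct because \<epsilon> > 0, so the piece can be
    read off from the pair: the inner side at the outer hyperplanes, the side given by the sign of
    \<kappa> at the middle one.\<close>
  define S where "S = (\<lambda>(b, c). if c = b \<bullet> \<iota> x - \<epsilon> then {v. b \<bullet> v \<ge> c} else if c = b \<bullet> \<iota> x + \<epsilon> then {v. b \<bullet> v \<le> c}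
     else if \<kappa> b > 0 then {v. b \<bullet> v \<ge> c} else if \<kappa> b < 0 then {v. b \<bullet> v \<le> c} else {v. b \<bullet> v = c})"
  have "S h \<in> halves h" for h by (cases h) (simp add: S_def halves_def)
  then have "{z \<in> \<sigma>. \<forall>h\<in>set hyps. \<iota> z \<in> S h} \<in> star_complex"
    unfolding star_complex_def by (intro refine_mem[OF assms])
  moreover have "(\<forall>h\<in>set hyps. \<iota> z \<in> S h) \<longleftrightarrow> (\<forall>b\<in>set bl. in_range (\<kappa> b) (b \<bullet> (\<iota> z - \<iota> x)))" for z
  proof -
    have "(\<forall>h\<in>set hyps. P h) \<longleftrightarrow> (\<forall>b\<in>set bl. P (b, b \<bullet> \<iota> x - \<epsilon>) \<and> P (b, b \<bullet> \<iota> x) \<and> P (b, b \<bullet> \<iota> x + \<epsilon>))" for P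
      by (auto simp: hyps_def)
    then have "(\<forall>h\<in>set hyps. \<iota> z \<in> S h) \<longleftrightarrow> (\<forall>b\<in>set bl. \<iota> z \<in> S (b, b \<bullet> \<iota> x - \<epsilon>) \<and> \<iota> z \<in> S (b, b \<bullet> \<iota> x) \<and> \<iota> z \<in> S (b, b \<bullet> \<iota> x + \<epsilon>))"
      by this
    also have "\<dots> \<longleftrightarrow> (\<forall>b\<in>set bl. in_range (\<kappa> b) (b \<bullet> (\<iota> z - \<iota> x)))"
    proof (rule ball_cong[OF refl])
      fix b
      show "\<iota> z \<in> S (b, b \<bullet> \<iota> x - \<epsilon>) \<and> \<iota> z \<in> S (b, b \<bullet> \<iota> x) \<and> \<iota> z \<in> S (b, b \<bullet> \<iota> x + \<epsilon>) \<longleftrightarrow>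
         in_range (\<kappa> b) (b \<bullet> (\<iota> z - \<iota> x))"
        using eps unfolding S_def in_range_def inner_diff_right by auto
    qed
    finally show ?thesis .
  qed
  ultimately show ?thesis unfolding sector_def by simp
qed

lemma expand: "(\<Sum>b\<in>set bl. (v \<bullet> b) *\<^sub>R b) = v"
  by (rule orthonormal_basis_expand[OF orth unit]) (simp_all add: spn)

lemma inner_bl_zero: assumes "\<And>b. b \<in> set bl \<Longrightarrow> b \<bullet> v = 0" shows "v = 0"
  using expand[of v] assms by (simp add: inner_commute)

lemma indep_bl: "independent (set bl)"
  using orth unit by (intro pairwise_orthogonal_independent) force+

text \<open>Origin of the radius \<open>DIM('v) * \<epsilon>\<close> in the neighbourhood
  hypotheses: a vector with all coordinates at most \<epsilon> is at most that long.\<close>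

lemma norm_le_bl: assumes "\<And>b. b \<in> set bl \<Longrightarrow> \<bar>b \<bullet> v\<bar> \<le> \<epsilon>" shows "norm v \<le> DIM('v) * \<epsilon>"
proof -
  have "norm v = norm (\<Sum>b\<in>set bl. (v \<bullet> b) *\<^sub>R b)" by (simp add: expand)
  also have "\<dots> \<le> (\<Sum>b\<in>set bl. \<epsilon>)"
    by (rule order_trans[OF norm_sum sum_mono]) (use assms unit in \<open>simp add: inner_commute\<close>)
  also have "\<dots> = card (set bl) * \<epsilon>" by simp
  also have "\<dots> \<le> DIM('v) * \<epsilon>" using independent_bound[OF indep_bl] eps by (intro mult_right_mono) auto
  finally show ?thesis .
qed

text \<open>Freezing all coordinates of a basis leaves x alone, by injectivity on \<sigma>.\<close>

lemma sing_mem: assumes "\<sigma> \<in> Qb" "x \<in> \<sigma>" shows "{x} \<in> star_complex"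
proof -
  have "sector \<sigma> (\<lambda>b. 0) = {x}"
  proof
    show "sector \<sigma> (\<lambda>b. 0) \<subseteq> {x}"
    proof
      fix z assume "z \<in> sector \<sigma> (\<lambda>b. 0)"
      then have z: "z \<in> \<sigma>" "\<And>b. b \<in> set bl \<Longrightarrow> b \<bullet> (\<iota> z - \<iota> x) = 0" by (auto simp: sector_def in_range_def)
      then have "\<iota> z - \<iota> x = 0" using inner_bl_zero by blast
      then show "z \<in> {x}" using z(1) assms(2) cell_inj[OF Qb assms(1)] by (auto dest: inj_onD)
    qed
    show "{x} \<subseteq> sector \<sigma> (\<lambda>b. 0)" using assms by (auto simp: sector_def in_range_def)
  qed
  then show ?thesis using sector_mem[OF assms(1), of "\<lambda>b. 0"] by simp
qed

end

text \<open>\<open>B1\<close> is an orthonormal basis of the directions of \<sigma> containing d,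
  and \<open>bl\<close> extends it to the whole space. The last hypothesis keeps the cells of the
  star inside U, as balanced combinations require.\<close>

locale balanced_star = star_refinement \<iota> Qb x \<epsilon> bl
  for \<iota> :: "'x::topological_space \<Rightarrow> 'v::euclidean_space" and Qb x \<epsilon> bl +
  fixes Q0 :: "'x set set" and n :: int and U :: "'x set" and w :: "'x set \<Rightarrow> real"
    and a :: 'v and \<beta> :: real and \<sigma> :: "'x set" and d :: 'v and B1 :: "'v set"
  assumes cls: "in_class \<iota> Q0 Qb" and aff: "\<And>z. a \<bullet> \<iota> z = \<beta>" "\<beta> \<noteq> 0"
    and U: "open U" "x \<in> U" and mink: "minkowski \<iota> Qb U n w" and wpos: "\<And>\<sigma>. \<sigma> \<in> restr \<iota> Qb U n \<Longrightarrow> w \<sigma> > 0"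
    and sig: "\<sigma> \<in> Qb" "x \<in> \<sigma>" "pdim \<iota> \<sigma> = n"
    and B1: "d \<in> B1" "B1 \<subseteq> set bl" "span B1 = dirs (\<iota> ` \<sigma>)"
    and inward: "\<exists>s>0. \<iota> x + s *\<^sub>R d \<in> rel_interior (\<iota> ` \<sigma>)"
    and nbhd: "\<And>\<rho> z. \<rho> \<in> Qb \<Longrightarrow> x \<in> \<rho> \<Longrightarrow> z \<in> \<rho> \<Longrightarrow> dist (\<iota> z) (\<iota> x) \<le> DIM('v) * \<epsilon> \<Longrightarrow> z \<in> U"
begin

lemma finB1: "finite B1" using B1(2) finite_subset by blast

lemma ortho_rule: "b \<in> set bl \<Longrightarrow> c \<in> set bl \<Longrightarrow> b \<bullet> c = (if b = c then 1 else 0)"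
  using orth unit by (auto simp: pairwise_def orthogonal_def norm_eq_1)

lemma dirs_expand: assumes "v \<in> dirs (\<iota> ` \<sigma>)" shows "(\<Sum>b\<in>B1. (v \<bullet> b) *\<^sub>R b) = v"
  using orth unit B1 assms finB1
  by (intro orthonormal_basis_expand) (auto intro: pairwise_subset)

lemma B1_dirs: "b \<in> B1 \<Longrightarrow> b \<in> dirs (\<iota> ` \<sigma>)"
  using B1(3) span_base by blast

text \<open>The functional a is constant on the image of \<iota>, so the correction by a in
  \<open>lin\<close> changes no slope along \<sigma>.\<close>

lemma a_B1: assumes "v \<in> dirs (\<iota> ` \<sigma>)" shows "a \<bullet> v = 0"
  by (rule orth_dirs[OF _ assms]) (auto simp: inner_diff_right aff)

lemma card_B1: "int (card B1) = n"
proof -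
  have "dim (dirs (\<iota> ` \<sigma>)) = card B1"
    using dim_eq_card_independent[OF independent_mono[OF indep_bl B1(2)]] B1(3) by (metis dim_span)
  moreover have "\<iota> ` \<sigma> \<noteq> {}" using sig(2) by blast
  ultimately show ?thesis using aff_dim_dirs[of "\<iota> ` \<sigma>"] sig(3) by (simp add: pdim_def)
qed

text \<open>A flag of cells from \<^term>\<open>\<sigma>\<close> down to the edge in direction \<^term>\<open>d\<close>: the coordinates in \<^term>\<open>A\<close>
  vanish and those in \<open>B1 - A - {d}\<close> are nonpositive, so that the tent functions still to be
  multiplied are not constant.\<close>

definition flag :: "'v set \<Rightarrow> 'x set" where
  "flag A = sector \<sigma> (\<lambda>b. if b = d then 1 else if b \<in> B1 - A then - 1 else 0)"

text \<open>Piecewise affine functions are encoded by linear functionals.  Since the image of \<^term>\<open>\<iota>\<close> lies in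
  the hyperplane where \<^term>\<open>a\<close> takes the value \<^term>\<open>\<beta>\<close>, the functional \<open>lin b\<close> computes the
  affine function \<open>b \<bullet> (\<iota> z - \<iota> x)\<close> there.\<close>

definition lin :: "'v \<Rightarrow> 'v" where "lin b = b - (b \<bullet> \<iota> x / \<beta>) *\<^sub>R a"

definition tent :: "'v \<Rightarrow> 'x \<Rightarrow> real" where "tent b = (\<lambda>z. min 0 (lin b \<bullet> \<iota> z))"

text \<open>\<open>mults\<close> multiplies by the head of the list last: \<open>wt (b # bs)\<close>
  is \<open>wt bs\<close> times one more tent, which suits induction on the list.\<close>

definition wt :: "'v list \<Rightarrow> 'x set \<Rightarrow> real" where
  "wt bs = mults \<iota> star_complex U n (map tent bs) (pullback \<iota> Qb w)"

lemma lin_iota: "lin b \<bullet> \<iota> z = b \<bullet> (\<iota> z - \<iota> x)"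
  using aff by (simp add: lin_def inner_diff_left inner_diff_right)

lemma PA_tent: assumes "b \<in> set bl" shows "PA_on \<iota> star_complex W (tent b)"
  unfolding star_complex_def tent_def
  by (rule PA_on_refine_min[of "(b, b \<bullet> \<iota> x)"]) (use assms in \<open>auto simp: hyps_mem lin_iota inner_diff_right\<close>)

lemma concave_tent: "concave_PA \<iota> Q0 U (tent b)"
  unfolding tent_def by (rule concave_PA_min[OF cls U(1)])

lemma d_bl: "d \<in> set bl" using B1 by blast

lemma flag_sub: "flag A \<subseteq> \<sigma>" "x \<in> flag A" "flag A \<in> star_complex"
  using sig sector_mem[OF sig(1)] eps by (auto simp: flag_def sector_def in_range_def)

text \<open>One point q of the edge, over the relative interior of \<sigma>, belongs to all flag
  cells and leaves room for a step of length \<eta> along -b for every b in \<open>B1\<close> other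
  than d that A does not freeze.\<close>

lemma flag_points:
  obtains q s \<eta> where "s > 0" "\<eta> > 0" "\<And>A. d \<notin> A \<Longrightarrow> q \<in> flag A" "\<iota> q = \<iota> x + s *\<^sub>R d"
    "\<And>A b. d \<notin> A \<Longrightarrow> b \<in> B1 \<Longrightarrow> b \<noteq> d \<Longrightarrow> b \<notin> A \<Longrightarrow> \<exists>z\<in>flag A. \<iota> z = \<iota> q - \<eta> *\<^sub>R b"
proof -
  obtain s0 where s0: "s0 > 0" "\<iota> x + s0 *\<^sub>R d \<in> rel_interior (\<iota> ` \<sigma>)" using inward by blast
  \<comment> \<open>Contracting towards x stays in the relative interior and brings the length down
    to \<epsilon>, as the sector demands.\<close>
  define e where "e = min 1 (\<epsilon> / s0)"
  have e: "0 < e" "e \<le> 1" using s0(1) eps by (auto simp: e_def)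
  define s where "s = e * s0"
  have "e \<le> \<epsilon> / s0" by (simp add: e_def)
  then have s: "s > 0" "s \<le> \<epsilon>" using e s0 by (auto simp: s_def pos_le_divide_eq)
  have "\<iota> x - e *\<^sub>R (\<iota> x - (\<iota> x + s0 *\<^sub>R d)) \<in> rel_interior (\<iota> ` \<sigma>)"
    by (rule rel_interior_convex_shrink[OF cell_convex[OF Qb sig(1)] s0(2) _ e]) (use sig in blast)
  then have ri: "\<iota> x + s *\<^sub>R d \<in> rel_interior (\<iota> ` \<sigma>)" by (simp add: s_def)
  then obtain q where q: "q \<in> \<sigma>" "\<iota> q = \<iota> x + s *\<^sub>R d" using rel_interior_subset by (metis imageE subsetD)
  obtain e' where e': "e' > 0" "\<And>t. t \<in> dirs (\<iota> ` \<sigma>) \<Longrightarrow> norm t \<le> e' \<Longrightarrow> \<iota> x + s *\<^sub>R d + t \<in> \<iota> ` \<sigma>"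
    using rel_interior_dirs[OF ri] by blast
  define \<eta> where "\<eta> = min e' \<epsilon>"
  have \<eta>: "\<eta> > 0" "\<eta> \<le> e'" "\<eta> \<le> \<epsilon>" using e' eps by (auto simp: \<eta>_def)
  have 1: "q \<in> flag A" if "d \<notin> A" for A
    using q s that d_bl B1(2) by (auto simp: flag_def sector_def in_range_def ortho_rule)
  have 2: "\<exists>z\<in>flag A. \<iota> z = \<iota> q - \<eta> *\<^sub>R b" if "d \<notin> A" "b \<in> B1" "b \<noteq> d" "b \<notin> A" for A b
  proof -
    have "- \<eta> *\<^sub>R b \<in> dirs (\<iota> ` \<sigma>)" using B1_dirs[OF that(2)] subspace_scale[OF subspace_dirs] by blast
    moreover have "norm (- \<eta> *\<^sub>R b) \<le> e'" using \<eta> unit that B1(2) by auto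
    ultimately have "\<iota> x + s *\<^sub>R d + - \<eta> *\<^sub>R b \<in> \<iota> ` \<sigma>" using e'(2) by blast
    then obtain z where z: "z \<in> \<sigma>" "\<iota> z = \<iota> x + s *\<^sub>R d - \<eta> *\<^sub>R b" by auto
    have "b \<in> set bl" using that B1 by blast
    then have "in_range (if c = d then 1 else if c \<in> B1 - A then - 1 else 0) (c \<bullet> (\<iota> z - \<iota> x))" if c: "c \<in> set bl" for c
      using c s \<eta> \<open>b \<noteq> d\<close> \<open>b \<in> B1\<close> \<open>b \<notin> A\<close> eps d_bl
      by (auto simp: z(2) in_range_def inner_diff_right ortho_rule)
    then have "z \<in> flag A" using z(1) by (simp add: flag_def sector_def)
    then show ?thesis using z(2) q(2) by auto
  qed
  show thesis using that[OF s(1) \<eta>(1) 1 q(2) 2] .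
qed

text \<open>The coordinates in A vanish on the flag cell. The remaining directions are realised by
  \<open>flag_points\<close>: d by q - x, the others by the steps from q.\<close>

lemma flag_dirs: assumes "A \<subseteq> B1 - {d}" shows "dirs (\<iota> ` flag A) = span (B1 - A)"
proof
  have dA: "d \<notin> A" using assms by blast
  have AB: "A \<subseteq> set bl" using assms B1 by blast
  have "v \<bullet> b = 0" if "b \<in> A" "v \<in> dirs (\<iota> ` flag A)" for b v
  proof -
    have 0: "b \<bullet> (\<iota> z - \<iota> x) = 0" if "z \<in> flag A" for z
      using that \<open>b \<in> A\<close> AB dA by (auto simp: flag_def sector_def in_range_def split: if_splits)
    have "b \<bullet> v = 0" by (rule orth_dirs[OF _ that(2)]) (use 0 in \<open>auto simp: inner_diff_right\<close>)
    then show ?thesis by (simp add: inner_commute)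
  qed
  note o = this
  show "dirs (\<iota> ` flag A) \<subseteq> span (B1 - A)"
  proof
    fix v assume v: "v \<in> dirs (\<iota> ` flag A)"
    then have "v \<in> dirs (\<iota> ` \<sigma>)" using dirs_mono[OF image_mono[OF flag_sub(1)]] by blast
    then have "v = (\<Sum>b\<in>B1. (v \<bullet> b) *\<^sub>R b)" by (simp add: dirs_expand)
    also have "\<dots> = (\<Sum>b\<in>B1 - A. (v \<bullet> b) *\<^sub>R b)"
      by (rule sum.mono_neutral_right) (use finB1 o[OF _ v] in auto)
    also have "\<dots> \<in> span (B1 - A)" by (intro span_sum span_scale span_base)
    finally show "v \<in> span (B1 - A)" .
  qed
  obtain q s \<eta> where q: "s > 0" "\<eta> > 0" "\<And>A. d \<notin> A \<Longrightarrow> q \<in> flag A" "\<iota> q = \<iota> x + s *\<^sub>R d"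
    "\<And>A b. d \<notin> A \<Longrightarrow> b \<in> B1 \<Longrightarrow> b \<noteq> d \<Longrightarrow> b \<notin> A \<Longrightarrow> \<exists>z\<in>flag A. \<iota> z = \<iota> q - \<eta> *\<^sub>R b"
    by (rule flag_points, rule that; assumption)
  have "B1 - A \<subseteq> dirs (\<iota> ` flag A)"
  proof
    fix b assume b: "b \<in> B1 - A"
    show "b \<in> dirs (\<iota> ` flag A)"
    proof (cases "b = d")
      case True
      have "\<iota> q - \<iota> x \<in> dirs (\<iota> ` flag A)" using q(3)[OF dA] flag_sub(2) by (intro diff_in_dirs imageI)
      then have "(1 / s) *\<^sub>R (\<iota> q - \<iota> x) \<in> dirs (\<iota> ` flag A)" by (intro subspace_scale[OF subspace_dirs])
      moreover have "(1 / s) *\<^sub>R (\<iota> q - \<iota> x) = b" using True q(1,4) by simp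
      ultimately show ?thesis by simp
    next
      case False
      then obtain z where z: "z \<in> flag A" "\<iota> z = \<iota> q - \<eta> *\<^sub>R b" using q(5)[OF dA] b by blast
      have "\<iota> q - \<iota> z \<in> dirs (\<iota> ` flag A)" using q(3)[OF dA] z(1) by (intro diff_in_dirs imageI)
      then have "(1 / \<eta>) *\<^sub>R (\<iota> q - \<iota> z) \<in> dirs (\<iota> ` flag A)" by (intro subspace_scale[OF subspace_dirs])
      moreover have "(1 / \<eta>) *\<^sub>R (\<iota> q - \<iota> z) = b" using z(2) q(2) by simp
      ultimately show ?thesis by simp
    qed
  qed
  then show "span (B1 - A) \<subseteq> dirs (\<iota> ` flag A)" by (intro span_minimal) auto
qed

lemma flag_pdim: assumes "A \<subseteq> B1 - {d}" shows "pdim \<iota> (flag A) = n - int (card A)"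
proof -
  have ind: "independent (B1 - A)" using independent_mono[OF indep_bl] B1(2) by blast
  have "\<iota> ` flag A \<noteq> {}" using flag_sub(2) by blast
  then have "pdim \<iota> (flag A) = int (dim (span (B1 - A)))"
    unfolding pdim_def flag_dirs[OF assms, symmetric] by (rule aff_dim_dirs)
  also have "\<dots> = int (card (B1 - A))" using dim_eq_card_independent[OF ind] by simp
  also have "\<dots> = n - int (card A)"
  proof -
    have A: "A \<subseteq> B1" using assms by blast
    show ?thesis
      using finB1 card_B1 card_Diff_subset[OF finite_subset[OF A finB1] A] card_mono[OF finB1 A] by simp
  qed
  finally show ?thesis .
qed

text \<open>The coordinate b is nonpositive on the larger cell and 0 on the smaller one, so the
  inward direction is -b.\<close>

lemma flag_nvec:
  assumes "insert b A \<subseteq> B1 - {d}" "b \<notin> A" shows "flag (insert b A) \<subseteq> flag A" "nvec \<iota> (flag A) (flag (insert b A)) = - b"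
proof -
  have A: "A \<subseteq> B1 - {d}" using assms(1) by blast
  have finA: "finite A" using finite_subset[OF A] finB1 by simp
  have b: "b \<in> set bl" "b \<in> B1" "b \<noteq> d" using assms(1) B1 by auto
  show sub: "flag (insert b A) \<subseteq> flag A"
  proof
    fix z assume z: "z \<in> flag (insert b A)"
    have "in_range (if c = d then 1 else if c \<in> B1 - A then - 1 else 0) (c \<bullet> (\<iota> z - \<iota> x))" if "c \<in> set bl" for c
    proof -
      have "in_range (if c = d then 1 else if c \<in> B1 - insert b A then - 1 else 0) (c \<bullet> (\<iota> z - \<iota> x))"
        using z that by (simp add: flag_def sector_def)
      then show ?thesis using in_range_zero by (cases "c = b") (auto simp: b(3))
    qed
    then show "z \<in> flag A" using z by (simp add: flag_def sector_def)
  qed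
  obtain q s \<eta> where q: "s > 0" "\<eta> > 0" "\<And>A. d \<notin> A \<Longrightarrow> q \<in> flag A" "\<iota> q = \<iota> x + s *\<^sub>R d"
    "\<And>A b. d \<notin> A \<Longrightarrow> b \<in> B1 \<Longrightarrow> b \<noteq> d \<Longrightarrow> b \<notin> A \<Longrightarrow> \<exists>z\<in>flag A. \<iota> z = \<iota> q - \<eta> *\<^sub>R b"
    by (rule flag_points, rule that; assumption)
  obtain z where z: "z \<in> flag A" "\<iota> z = \<iota> q - \<eta> *\<^sub>R b" using q(5)[of A b] b(2,3) assms(2) A by blast
  have qA: "q \<in> flag (insert b A)" using q(3) assms(1) by blast
  have "is_nvec (\<iota> ` flag A) (\<iota> ` flag (insert b A)) (- b)"
    unfolding is_nvec_def
  proof (intro conjI ballI)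
    show "norm (- b) = 1" using unit b by simp
    have "b \<in> span (B1 - A)" using b assms(2) by (intro span_base) blast
    then show "- b \<in> dirs (\<iota> ` flag A)" unfolding flag_dirs[OF A] by (rule span_neg)
    have 0: "b \<bullet> (\<iota> z - \<iota> x) = 0" if "z \<in> flag (insert b A)" for z
      using that b by (auto simp: flag_def sector_def in_range_def split: if_splits)
    show "- b \<bullet> (y - z) = 0" if "y \<in> \<iota> ` flag (insert b A)" "z \<in> \<iota> ` flag (insert b A)" for y z
      using that 0 by (auto simp: inner_diff_right)
    have "- b \<bullet> (\<iota> z - \<iota> q) = \<eta>" using z(2) ortho_rule[OF b(1,1)] by simp
    then show "\<exists>y\<in>\<iota> ` flag A. \<exists>z\<in>\<iota> ` flag (insert b A). 0 < - b \<bullet> (y - z)" using z(1) qA q(2) by (intro bexI) auto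
  qed
  then show "nvec \<iota> (flag A) (flag (insert b A)) = - b"
    using flag_pdim[OF A] flag_pdim[OF assms(1)] assms(2) finA flag_sub(2)[of "insert b A"]
    by (intro cell_nvec_eqI[OF star_eucl flag_sub(3) flag_sub(3) sub]) auto
qed

text \<open>Induction on the list. The product with a tent stays nonnegative and is supported on the
  hyperplane of the tent; on the flag it stays positive because the tent decreases from each flag
  cell into the preceding one.\<close>

lemma wt_props:
  assumes "distinct bs" "set bs \<subseteq> B1 - {d}"
  defines "k \<equiv> n - int (length bs)"
  shows "minkowski \<iota> star_complex U k (wt bs)"
    and "\<forall>\<rho>\<in>restr \<iota> star_complex U k. wt bs \<rho> \<ge> 0 \<and> (wt bs \<rho> \<noteq> 0 \<longrightarrow> (\<forall>b\<in>set bs. \<forall>z\<in>\<rho>. b \<bullet> (\<iota> z - \<iota> x) = 0))"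
    and "wt bs (flag (set bs)) > 0"
proof -
  have "minkowski \<iota> star_complex U (n - int (length bs)) (wt bs) \<and>
    (\<forall>\<rho>\<in>restr \<iota> star_complex U (n - int (length bs)). wt bs \<rho> \<ge> 0 \<and> (wt bs \<rho> \<noteq> 0 \<longrightarrow> (\<forall>b\<in>set bs. \<forall>z\<in>\<rho>. b \<bullet> (\<iota> z - \<iota> x) = 0))) \<and>
    wt bs (flag (set bs)) > 0"
    using assms(1,2)
  proof (induction bs)
    case Nil
    have sd: "subdiv star_complex Qb" unfolding star_complex_def by (rule subdiv_refine)
    have 1: "minkowski \<iota> star_complex U n (pullback \<iota> Qb w)" by (rule minkowski_pullback[OF Qb star_eucl sd mink])
    have 2: "pullback \<iota> Qb w \<rho> \<ge> 0" if r: "\<rho> \<in> restr \<iota> star_complex U n" for \<rho>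
    proof (cases "\<exists>\<sigma>\<in>Qb. \<rho> \<subseteq> \<sigma> \<and> pdim \<iota> \<sigma> = pdim \<iota> \<rho>")
      case True
      then obtain \<sigma>1 where s1: "\<sigma>1 \<in> Qb" "\<rho> \<subseteq> \<sigma>1" "pdim \<iota> \<sigma>1 = pdim \<iota> \<rho>" by blast
      have "\<rho> \<noteq> {}" using restrD[OF r] by blast
      then have "pullback \<iota> Qb w \<rho> = w \<sigma>1" using pullback_eq[OF Qb _ s1] by simp
      moreover have "\<sigma>1 \<in> restr \<iota> Qb U n" using s1 restrD[OF r] by (auto simp: restr_def)
      ultimately show ?thesis using wpos[of \<sigma>1] by simp
    next
      case False then show ?thesis by (simp add: pullback_zero[OF False])
    qed
    have "pullback \<iota> Qb w (flag {}) = w \<sigma>"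
    proof (rule pullback_eq[OF Qb _ sig(1) flag_sub(1)])
      show "flag {} \<noteq> {}" using flag_sub(2) by blast
      show "pdim \<iota> \<sigma> = pdim \<iota> (flag {})" using flag_pdim[of "{}"] sig(3) by simp
    qed
    moreover have "\<sigma> \<in> restr \<iota> Qb U n" using sig U by (auto simp: restr_def)
    ultimately have 3: "pullback \<iota> Qb w (flag {}) > 0" using wpos by simp
    show ?case using 1 2 3 by (simp add: wt_def)
  next
    case (Cons b bs)
    let ?k = "n - int (length bs)"
    have b: "b \<in> set bl" "b \<in> B1" "b \<noteq> d" "b \<notin> set bs" using Cons.prems B1 by auto
    have bs: "set bs \<subseteq> B1 - {d}" "distinct bs" using Cons.prems by auto
    have IH: "minkowski \<iota> star_complex U ?k (wt bs)"
      "\<And>\<rho>. \<rho> \<in> restr \<iota> star_complex U ?k \<Longrightarrow> wt bs \<rho> \<ge> 0"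
      "\<And>\<rho> b z. \<rho> \<in> restr \<iota> star_complex U ?k \<Longrightarrow> wt bs \<rho> \<noteq> 0 \<Longrightarrow> b \<in> set bs \<Longrightarrow> z \<in> \<rho> \<Longrightarrow> b \<bullet> (\<iota> z - \<iota> x) = 0"
      "wt bs (flag (set bs)) > 0"
      using Cons.IH[OF bs(2,1)] by blast+
    have wtC: "wt (b # bs) = mult \<iota> star_complex U ?k (\<lambda>z. min 0 (lin b \<bullet> \<iota> z)) (wt bs)"
      by (simp add: wt_def tent_def)
    note PA = PA_tent[OF b(1), of U, unfolded tent_def]
    note lin = linear_inner_left[of "lin b"]
    have k1: "n - int (length (b # bs)) = ?k - 1" by simp
    have m: "minkowski \<iota> star_complex U (?k - 1) (wt (b # bs))"
      unfolding wtC by (rule minkowski_mult[OF star_eucl U(1) IH(1) PA])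
    have nn: "wt (b # bs) \<rho> \<ge> 0" if "\<rho> \<in> restr \<iota> star_complex U (?k - 1)" for \<rho>
      unfolding wtC by (rule mult_min_nonneg[OF star_eucl U(1) IH(1,2) lin PA that])
    have sp: "c \<bullet> (\<iota> z - \<iota> x) = 0" if r: "\<rho> \<in> restr \<iota> star_complex U (?k - 1)" and
      nz: "wt (b # bs) \<rho> \<noteq> 0" and c: "c \<in> set (b # bs)" and z: "z \<in> \<rho>" for \<rho> c z
    proof (cases "c = b")
      case True
      have "lin b \<bullet> \<iota> z = 0"
        by (rule mult_min_support[OF star_eucl U(1) IH(1,2) lin PA r _ z]) (use nz wtC in simp_all)
      then show ?thesis using True by (simp add: lin_iota)
    next
      case False
      then have cb: "c \<in> set bs" using c by simp
      have ne: "\<rho> \<inter> U \<noteq> {}" using restrD[OF r] by blast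
      \<comment> \<open>A nonzero new weight needs a nonzero old one on some cell above \<rho>, and
        that cell already lies in the earlier hyperplanes.\<close>
      have "\<exists>\<rho>'\<in>{\<rho>'\<in>star_complex. \<rho> \<subseteq> \<rho>' \<and> pdim \<iota> \<rho>' = ?k}. wt bs \<rho>' \<noteq> 0"
      proof (rule ccontr)
        assume "\<not> ?thesis"
        then have "wt (b # bs) \<rho> = 0" unfolding wtC mult_eq[OF ne] by simp
        then show False using nz by simp
      qed
      then obtain \<rho>' where r': "\<rho>' \<in> star_complex" "\<rho> \<subseteq> \<rho>'" "pdim \<iota> \<rho>' = ?k" "wt bs \<rho>' \<noteq> 0" by blast
      then have "\<rho>' \<in> restr \<iota> star_complex U ?k" using ne by (auto simp: restr_def)
      then show ?thesis using IH(3)[OF _ r'(4) cb] r'(2) z by blast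
    qed
    have ins: "set (b # bs) = insert b (set bs)" by simp
    have bA: "insert b (set bs) \<subseteq> B1 - {d}" using b bs by blast
    note fl = flag_nvec[OF bA b(4)]
    have "wt (b # bs) (flag (insert b (set bs))) > 0"
      unfolding wtC
    proof (rule mult_min_pos[OF star_eucl U(1) IH(1,2) lin PA _ flag_sub(3) fl(1) _ IH(4)])
      show "flag (insert b (set bs)) \<in> restr \<iota> star_complex U (?k - 1)"
        using flag_pdim[OF bA] b(4) flag_sub[of "insert b (set bs)"] U distinct_card[OF bs(2)] by (auto simp: restr_def)
      show "pdim \<iota> (flag (set bs)) = ?k" using flag_pdim[OF bs(1)] distinct_card[OF bs(2)] by simp
      show "lin b \<bullet> \<iota> z = 0" if "z \<in> flag (insert b (set bs))" for z
        using that b unfolding lin_iota by (auto simp: flag_def sector_def in_range_def split: if_splits)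
      show "lin b \<bullet> \<iota> z \<le> 0" if "z \<in> flag (set bs)" for z
        using that b unfolding lin_iota by (auto simp: flag_def sector_def in_range_def split: if_splits)
      \<comment> \<open>The value is -(b \<bullet> b) = -1, since a is orthogonal to b.\<close>
      show "lin b \<bullet> nvec \<iota> (flag (set bs)) (flag (insert b (set bs))) < 0"
        unfolding fl(2) using a_B1[OF B1_dirs[OF b(2)]] ortho_rule[OF b(1,1)] by (simp add: lin_def inner_diff_left)
    qed simp
    then show ?case using m nn sp unfolding k1 ins by blast
  qed
  then show "minkowski \<iota> star_complex U k (wt bs)"
    "\<forall>\<rho>\<in>restr \<iota> star_complex U k. wt bs \<rho> \<ge> 0 \<and> (wt bs \<rho> \<noteq> 0 \<longrightarrow> (\<forall>b\<in>set bs. \<forall>z\<in>\<rho>. b \<bullet> (\<iota> z - \<iota> x) = 0))"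
    "wt bs (flag (set bs)) > 0" unfolding k_def by blast+
qed

end

section \<open>The edges of the star and the inequality they give\<close>

definition ray :: "('x \<Rightarrow> 'v::euclidean_space) \<Rightarrow> 'x set \<Rightarrow> 'x \<Rightarrow> real \<Rightarrow> 'v \<Rightarrow> 'x set" where
  "ray \<iota> \<sigma> x \<epsilon> e = {z \<in> \<sigma>. \<exists>s\<in>{0..\<epsilon>}. \<iota> z = \<iota> x + s *\<^sub>R e}"

lemma ray_pdim:
  assumes "inj_on \<iota> \<sigma>" "convex (\<iota> ` \<sigma>)" "x \<in> \<sigma>" "norm e = 1" "\<epsilon> > 0" "s > 0" "\<iota> x + s *\<^sub>R e \<in> \<iota> ` \<sigma>"
  shows "pdim \<iota> (ray \<iota> \<sigma> x \<epsilon> e) = 1"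
proof -
  let ?r = "ray \<iota> \<sigma> x \<epsilon> e"
  have xr: "x \<in> ?r" using assms by (auto simp: ray_def intro!: bexI[of _ 0])
  define l where "l = min 1 (\<epsilon> / s)"
  have l: "0 < l" "l \<le> 1" "l * s \<le> \<epsilon>" using assms by (auto simp: l_def min_def field_simps)
  have "(1 - l) *\<^sub>R \<iota> x + l *\<^sub>R (\<iota> x + s *\<^sub>R e) \<in> \<iota> ` \<sigma>"
    using l assms by (intro convexD) auto
  then obtain z where z: "z \<in> \<sigma>" "\<iota> z = \<iota> x + (l * s) *\<^sub>R e" by (auto simp: algebra_simps)
  then have zr: "z \<in> ?r" using l assms(6) by (auto simp: ray_def intro!: bexI[of _ "l * s"])
  have "dirs (\<iota> ` ?r) = span {e}"
  proof
    show "dirs (\<iota> ` ?r) \<subseteq> span {e}"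
      unfolding dirs_def
    proof (rule span_minimal)
      show "{y - z |y z. y \<in> \<iota> ` ?r \<and> z \<in> \<iota> ` ?r} \<subseteq> span {e}"
        by (auto simp: ray_def span_singleton simp flip: scaleR_diff_left)
    qed simp
    have "\<iota> z - \<iota> x \<in> dirs (\<iota> ` ?r)" using xr zr by (intro diff_in_dirs imageI)
    then have "(1 / (l * s)) *\<^sub>R (\<iota> z - \<iota> x) \<in> dirs (\<iota> ` ?r)" by (intro subspace_scale[OF subspace_dirs])
    moreover have "(1 / (l * s)) *\<^sub>R (\<iota> z - \<iota> x) = e" using z(2) l assms(6) by simp
    ultimately show "span {e} \<subseteq> dirs (\<iota> ` ?r)" by (intro span_minimal) auto
  qed
  moreover have "e \<noteq> 0" using assms(4) by auto
  moreover have "\<iota> ` ?r \<noteq> {}" using xr by blast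
  ultimately show ?thesis using aff_dim_dirs[of "\<iota> ` ?r"] by (simp add: pdim_def)
qed

context balanced_star
begin

lemma sector_ray:
  assumes "k = 1 \<or> k = - 1"
  shows "sector \<sigma> (\<lambda>b. if b = d then k else 0) = ray \<iota> \<sigma> x \<epsilon> (of_int k *\<^sub>R d)" (is "?S = ?r")
proof
  have dd: "d \<bullet> d = 1" using ortho_rule[OF d_bl d_bl] by simp
  show "?S \<subseteq> ?r"
  proof
    fix z assume z: "z \<in> ?S"
    define v where "v = \<iota> z - \<iota> x"
    have r: "in_range (if b = d then k else 0) (b \<bullet> v)" if "b \<in> set bl" for b
      using z that by (simp add: sector_def v_def)
    have 0: "b \<bullet> v = 0" if "b \<in> set bl" "b \<noteq> d" for b using r[OF that(1)] that(2) by (simp add: in_range_def)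
    have "v = (\<Sum>b\<in>set bl. (v \<bullet> b) *\<^sub>R b)" by (simp add: expand)
    also have "\<dots> = (\<Sum>b\<in>{d}. (v \<bullet> b) *\<^sub>R b)"
      by (rule sum.mono_neutral_right) (use d_bl 0 in \<open>auto simp: inner_commute\<close>)
    finally have v: "v = (d \<bullet> v) *\<^sub>R d" by (simp add: inner_commute)
    have "in_range k (d \<bullet> v)" using r[OF d_bl] by simp
    then have k: "of_int k * (d \<bullet> v) \<in> {0..\<epsilon>}" using assms by (auto simp: in_range_def)
    have "\<iota> z = \<iota> x + v" by (simp add: v_def)
    also have "v = (of_int k * (d \<bullet> v)) *\<^sub>R (of_int k *\<^sub>R d)" using assms v by auto
    finally have "\<iota> z = \<iota> x + (of_int k * (d \<bullet> v)) *\<^sub>R (of_int k *\<^sub>R d)" .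
    moreover have "z \<in> \<sigma>" using z by (simp add: sector_def)
    ultimately show "z \<in> ?r" using k unfolding ray_def by blast
  qed
  show "?r \<subseteq> ?S"
  proof
    fix z assume "z \<in> ?r"
    then obtain s where s: "z \<in> \<sigma>" "0 \<le> s" "s \<le> \<epsilon>" "\<iota> z = \<iota> x + s *\<^sub>R (of_int k *\<^sub>R d)" by (auto simp: ray_def)
    have "in_range (if b = d then k else 0) (b \<bullet> (\<iota> z - \<iota> x))" if "b \<in> set bl" for b
      using s assms ortho_rule[OF that d_bl] by (auto simp: in_range_def)
    then show "z \<in> ?S" using s(1) by (simp add: sector_def)
  qed
qed

text \<open>R consists of all edges at x of the star complex and c is the product of the tents with
  the balancing cycle. The support statement says that a weighted edge, in whichever cell at x,
  projects to a multiple of d in the directions of \<sigma>. The test points are left free so that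
  one of them can run along the ray.\<close>

lemma star_edges:
  obtains R c where "finite R"
    "\<And>\<rho>. \<rho> \<in> R \<Longrightarrow> x \<in> \<rho> \<and> \<rho> \<subseteq> U \<and> c \<rho> \<ge> 0 \<and> convex (\<iota> ` \<rho>) \<and> (\<exists>z\<in>\<rho>. z \<noteq> x) \<and>
       (\<forall>z\<in>\<rho>. \<bar>d \<bullet> (\<iota> z - \<iota> x)\<bar> \<le> \<epsilon>) \<and> (\<exists>\<sigma>'\<in>Qb. \<rho> \<subseteq> \<sigma>')"
    "\<And>\<rho> z v. \<rho> \<in> R \<Longrightarrow> c \<rho> \<noteq> 0 \<Longrightarrow> z \<in> \<rho> \<Longrightarrow> v \<in> dirs (\<iota> ` \<sigma>) \<Longrightarrow> v \<bullet> d = 0 \<Longrightarrow> v \<bullet> (\<iota> z - \<iota> x) = 0"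
    "ray \<iota> \<sigma> x \<epsilon> d \<in> R" "c (ray \<iota> \<sigma> x \<epsilon> d) > 0"
    "\<And>s. s > 0 \<Longrightarrow> \<iota> x - s *\<^sub>R d \<in> \<iota> ` \<sigma> \<Longrightarrow> ray \<iota> \<sigma> x \<epsilon> (- d) \<in> R"
    "\<And>\<rho> \<rho>'. \<rho> \<in> R \<Longrightarrow> \<rho>' \<in> R \<Longrightarrow> \<rho> \<noteq> \<rho>' \<Longrightarrow> \<rho> \<inter> \<rho>' = {x}"
    "\<And>y f. weakly_concave \<iota> Q0 n U Qb w f \<Longrightarrow> \<forall>\<rho>\<in>R. y \<rho> \<in> \<rho> \<and> y \<rho> \<noteq> x \<Longrightarrow>
      (\<Sum>\<rho>\<in>R. c \<rho> / dist (\<iota> (y \<rho>)) (\<iota> x) * f (y \<rho>)) \<le> (\<Sum>\<rho>\<in>R. c \<rho> / dist (\<iota> (y \<rho>)) (\<iota> x)) * f x"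
    "\<And>y. \<forall>\<rho>\<in>R. y \<rho> \<in> \<rho> \<and> y \<rho> \<noteq> x \<Longrightarrow>
      (\<Sum>\<rho>\<in>R. (c \<rho> / dist (\<iota> (y \<rho>)) (\<iota> x)) *\<^sub>R (\<iota> (y \<rho>) - \<iota> x)) = 0"
proof -
  define R where "R = {\<rho>\<in>star_complex. x \<in> \<rho> \<and> pdim \<iota> \<rho> = 1}"
  \<comment> \<open>One tent for each basis direction of \<sigma> other than d; these n - 1 factors
    bring the dimension down to 1.\<close>
  obtain bs where bs: "set bs = B1 - {d}" "distinct bs" using finite_distinct_list[of "B1 - {d}"] finB1 by blast
  define c where "c = wt bs"
  have len: "int (length bs) = n - 1"
    using distinct_card[OF bs(2)] bs(1) B1(1) finB1 card_B1 card_Diff_singleton[OF B1(1)] card_gt_0_iff[of B1] by force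
  have k: "n - int (length bs) = 1" using len by simp
  have sub: "set bs \<subseteq> B1 - {d}" using bs(1) by simp
  note W = wt_props[OF bs(2) sub, unfolded k, folded c_def]
  have xQ: "{x} \<in> star_complex" using sing_mem sig by blast
  note Q = star_eucl
  have RD: "\<rho> \<in> star_complex" "x \<in> \<rho>" "pdim \<iota> \<rho> = 1" if "\<rho> \<in> R" for \<rho> using that by (auto simp: R_def)
  have Rr: "\<rho> \<in> restr \<iota> star_complex U 1" if "\<rho> \<in> R" for \<rho> using RD[OF that] U by (auto simp: restr_def)
  have fin: "finite R" unfolding R_def by (rule finite_subset[OF _ finite_cells_at[OF Q, of x]]) blast
  have bnd: "\<exists>\<sigma>'\<in>Qb. \<rho> \<subseteq> \<sigma>' \<and> (\<forall>b\<in>set bl. \<forall>z\<in>\<rho>. \<bar>b \<bullet> (\<iota> z - \<iota> x)\<bar> \<le> \<epsilon>)" if "\<rho> \<in> R" for \<rho>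
    using star_cell_bounds[OF RD(1,2)[OF that]] by metis
  have RU: "\<rho> \<subseteq> U" if r: "\<rho> \<in> R" for \<rho>
  proof
    fix z assume z: "z \<in> \<rho>"
    obtain \<sigma>' where s: "\<sigma>' \<in> Qb" "\<rho> \<subseteq> \<sigma>'" "\<forall>b\<in>set bl. \<forall>z\<in>\<rho>. \<bar>b \<bullet> (\<iota> z - \<iota> x)\<bar> \<le> \<epsilon>" using bnd[OF r] by blast
    have "norm (\<iota> z - \<iota> x) \<le> DIM('v) * \<epsilon>" using s(3) z by (intro norm_le_bl) blast
    then show "z \<in> U" using nbhd[OF s(1)] s(2) RD(2)[OF r] z by (auto simp: dist_norm)
  qed
  have ray1: "ray \<iota> \<sigma> x \<epsilon> d = flag (set bs)"
  proof -
    have "(\<lambda>b. if b = d then 1 else if b \<in> B1 - set bs then - 1 else 0) = (\<lambda>b. if b = d then 1 else (0::int))"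
      unfolding bs(1) by auto
    then show ?thesis using sector_ray[of 1] unfolding flag_def by simp
  qed
  have ray1R: "ray \<iota> \<sigma> x \<epsilon> d \<in> R"
    using ray1 flag_sub[of "set bs"] flag_pdim[OF sub] distinct_card[OF bs(2)] k by (simp add: R_def)
  have ray2R: "ray \<iota> \<sigma> x \<epsilon> (- d) \<in> R" if s: "s > 0" "\<iota> x - s *\<^sub>R d \<in> \<iota> ` \<sigma>" for s
  proof -
    have "pdim \<iota> (ray \<iota> \<sigma> x \<epsilon> (- d)) = 1"
      using s unit[OF d_bl] eps by (intro ray_pdim[OF cell_inj[OF Qb sig(1)] cell_convex[OF Qb sig(1)] sig(2)]) auto
    moreover have "ray \<iota> \<sigma> x \<epsilon> (- d) \<in> star_complex"
      using sector_ray[of "- 1"] sector_mem[OF sig(1), of "\<lambda>b. if b = d then - 1 else 0"] by simp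
    moreover have "x \<in> ray \<iota> \<sigma> x \<epsilon> (- d)" using sig eps by (auto simp: ray_def intro!: bexI[of _ 0])
    ultimately show ?thesis by (simp add: R_def)
  qed
  have c0: "c \<rho> \<ge> 0" if "\<rho> \<in> R" for \<rho> using W(2) Rr[OF that] by blast
  have supp: "v \<bullet> (\<iota> z - \<iota> x) = 0" if r: "\<rho> \<in> R" "c \<rho> \<noteq> 0" "z \<in> \<rho>" and v: "v \<in> dirs (\<iota> ` \<sigma>)" "v \<bullet> d = 0" for \<rho> z v
  proof -
    have 0: "b \<bullet> (\<iota> z - \<iota> x) = 0" if "b \<in> B1" "b \<noteq> d" for b
      using W(2) Rr[OF r(1)] r(2,3) that bs(1) by blast
    have "v \<bullet> (\<iota> z - \<iota> x) = (\<Sum>b\<in>B1. (v \<bullet> b) *\<^sub>R b) \<bullet> (\<iota> z - \<iota> x)" by (simp add: dirs_expand[OF v(1)])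
    also have "\<dots> = (\<Sum>b\<in>B1. (v \<bullet> b) * (b \<bullet> (\<iota> z - \<iota> x)))" by (simp add: inner_sum_left)
    also have "\<dots> = 0"
    proof (rule sum.neutral, rule ballI)
      fix b assume "b \<in> B1"
      then show "(v \<bullet> b) * (b \<bullet> (\<iota> z - \<iota> x)) = 0" using 0 v(2) by (cases "b = d") auto
    qed
    finally show ?thesis .
  qed
  have nx: "\<exists>z\<in>\<rho>. z \<noteq> x" if "\<rho> \<in> R" for \<rho>
  proof (rule ccontr)
    assume "\<not> ?thesis"
    then have "\<rho> = {x}" using RD(2)[OF that] by blast
    then show False using RD(3)[OF that] by (simp add: pdim_def)
  qed
  have disj: "\<rho> \<inter> \<rho>' = {x}" if r: "\<rho> \<in> R" "\<rho>' \<in> R" "\<rho> \<noteq> \<rho>'" for \<rho> \<rho>'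
  proof (rule ccontr)
    assume ne: "\<rho> \<inter> \<rho>' \<noteq> {x}"
    have I: "\<rho> \<inter> \<rho>' \<in> star_complex" using complex_Int(2)[OF Q] RD r by blast
    have xI: "{x} \<subseteq> \<rho> \<inter> \<rho>'" using RD r by blast
    have "pdim \<iota> {x} \<noteq> pdim \<iota> (\<rho> \<inter> \<rho>')" using cell_eq_dim[OF Q I xQ xI] ne by auto
    then have "pdim \<iota> (\<rho> \<inter> \<rho>') \<ge> 1" using pdim_mono[OF xI, of \<iota>] by (simp add: pdim_def)
    moreover have "pdim \<iota> (\<rho> \<inter> \<rho>') \<le> 1" using pdim_mono[of "\<rho> \<inter> \<rho>'" \<rho> \<iota>] RD(3)[OF r(1)] by simp
    ultimately have d1: "pdim \<iota> (\<rho> \<inter> \<rho>') = 1" by simp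
    have "\<rho> \<inter> \<rho>' = \<rho>" using cell_eq_dim[OF Q RD(1)[OF r(1)] I] d1 RD(3)[OF r(1)] by simp
    moreover have "\<rho> \<inter> \<rho>' = \<rho>'" using cell_eq_dim[OF Q RD(1)[OF r(2)] I] d1 RD(3)[OF r(2)] by simp
    ultimately show False using r(3) by simp
  qed
  have ineq: "(\<Sum>\<rho>\<in>R. c \<rho> / dist (\<iota> (y \<rho>)) (\<iota> x) * f (y \<rho>)) \<le> (\<Sum>\<rho>\<in>R. c \<rho> / dist (\<iota> (y \<rho>)) (\<iota> x)) * f x"
    if f: "weakly_concave \<iota> Q0 n U Qb w f" and y: "\<forall>\<rho>\<in>R. y \<rho> \<in> \<rho> \<and> y \<rho> \<noteq> x" for y f
  proof (rule weakly_concave_star[OF _ _ U(2) xQ R_def RU _ _ _ _ W(1) c0 _ _ _ f])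
    show "y \<rho> \<in> \<rho>" "y \<rho> \<noteq> x" if "\<rho> \<in> R" for \<rho> using y that by blast+
    show "in_class \<iota> Q0 star_complex" "subdiv star_complex Qb" unfolding star_complex_def
      using in_class_refine[OF cls] subdiv_refine by blast+
    show "int (length (map tent bs)) = n - 1" using len by simp
    show "concave_PA \<iota> Q0 U g" if "g \<in> set (map tent bs)" for g using that concave_tent by auto
    show "PA_on \<iota> star_complex U g" if "g \<in> set (map tent bs)" for g
      using that PA_tent bs(1) B1(2) by auto
    show "c = mults \<iota> star_complex U n (map tent bs) (pullback \<iota> Qb w)" by (simp add: c_def wt_def)
    show "\<exists>\<rho>\<in>R. c \<rho> > 0" using W(3) ray1 ray1R by auto
  qed
  have bal: "(\<Sum>\<rho>\<in>R. (c \<rho> / dist (\<iota> (y \<rho>)) (\<iota> x)) *\<^sub>R (\<iota> (y \<rho>) - \<iota> x)) = 0"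
    if y': "\<forall>\<rho>\<in>R. y \<rho> \<in> \<rho> \<and> y \<rho> \<noteq> x" for y
  proof -
    have y: "y \<rho> \<in> \<rho>" "y \<rho> \<noteq> x" if "\<rho> \<in> R" for \<rho> using y' that by blast+
    have "(\<Sum>\<rho>\<in>R. (c \<rho> / dist (\<iota> (y \<rho>)) (\<iota> x)) *\<^sub>R (\<iota> (y \<rho>) - \<iota> x)) = (\<Sum>\<rho>\<in>R. c \<rho> *\<^sub>R nvec \<iota> \<rho> {x})"
    proof (rule sum.cong[OF refl])
      fix \<rho> assume r: "\<rho> \<in> R"
      have e: "\<iota> (y \<rho>) - \<iota> x = dist (\<iota> (y \<rho>)) (\<iota> x) *\<^sub>R nvec \<iota> \<rho> {x}"
        by (rule dist_nvec_point[OF Q RD(1)[OF r] xQ RD(2,3)[OF r] y[OF r]])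
      have "\<iota> (y \<rho>) \<noteq> \<iota> x" using cell_inj[OF Q RD(1)[OF r]] RD(2)[OF r] y[OF r] by (auto dest: inj_onD)
      then have "dist (\<iota> (y \<rho>)) (\<iota> x) \<noteq> 0" by simp
      then show "(c \<rho> / dist (\<iota> (y \<rho>)) (\<iota> x)) *\<^sub>R (\<iota> (y \<rho>) - \<iota> x) = c \<rho> *\<^sub>R nvec \<iota> \<rho> {x}"
        by (subst e) simp
    qed
    also have "\<dots> = 0"
      using minkowskiD[OF W(1) xQ] U unfolding R_def by (simp add: pdim_def)
    finally show ?thesis .
  qed
  have props: "x \<in> \<rho> \<and> \<rho> \<subseteq> U \<and> c \<rho> \<ge> 0 \<and> convex (\<iota> ` \<rho>) \<and> (\<exists>z\<in>\<rho>. z \<noteq> x) \<and>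
       (\<forall>z\<in>\<rho>. \<bar>d \<bullet> (\<iota> z - \<iota> x)\<bar> \<le> \<epsilon>) \<and> (\<exists>\<sigma>'\<in>Qb. \<rho> \<subseteq> \<sigma>')" if r: "\<rho> \<in> R" for \<rho>
    using RD(2)[OF r] RU[OF r] c0[OF r] cell_convex[OF Q RD(1)[OF r]] nx[OF r] bnd[OF r] d_bl by blast
  have cpos: "c (ray \<iota> \<sigma> x \<epsilon> d) > 0" using W(3) ray1 by simp
  show thesis
    by (rule that[of R c]; fact fin props supp ray1R cpos ray2R disj ineq bal)
qed

end

section \<open>Concavity on maximal cells\<close>

text \<open>Finitely many cells meet at x, so the radii from \<open>cell_near\<close> have a
  positive minimum.\<close>

lemma star_radius:
  assumes Q: "eucl_complex \<iota> Q" and W: "open W" "x \<in> W"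
  obtains \<delta> where "\<delta> > 0" "\<And>\<sigma> z. \<sigma> \<in> Q \<Longrightarrow> x \<in> \<sigma> \<Longrightarrow> z \<in> \<sigma> \<Longrightarrow> dist (\<iota> z) (\<iota> x) \<le> \<delta> \<Longrightarrow> z \<in> W"
proof -
  let ?F = "{\<sigma>\<in>Q. x \<in> \<sigma>}"
  have "\<forall>\<sigma>\<in>?F. \<exists>\<delta>>0. \<forall>z\<in>\<sigma>. dist (\<iota> z) (\<iota> x) \<le> \<delta> \<longrightarrow> z \<in> W"
  proof
    fix \<sigma> assume "\<sigma> \<in> ?F"
    then have s: "\<sigma> \<in> Q" "x \<in> \<sigma>" by auto
    show "\<exists>\<delta>>0. \<forall>z\<in>\<sigma>. dist (\<iota> z) (\<iota> x) \<le> \<delta> \<longrightarrow> z \<in> W"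
      using cell_near[OF Q s W] by metis
  qed
  then obtain D where D: "\<forall>\<sigma>\<in>?F. D \<sigma> > 0 \<and> (\<forall>z\<in>\<sigma>. dist (\<iota> z) (\<iota> x) \<le> D \<sigma> \<longrightarrow> z \<in> W)"
    using bchoice[of ?F "\<lambda>\<sigma> \<delta>. \<delta> > 0 \<and> (\<forall>z\<in>\<sigma>. dist (\<iota> z) (\<iota> x) \<le> \<delta> \<longrightarrow> z \<in> W)"] by blast
  define \<delta> where "\<delta> = Min (insert 1 (D ` ?F))"
  have fin: "finite (insert 1 (D ` ?F))" using finite_cells_at[OF Q, of x] by simp
  have pos: "\<delta> > 0" unfolding \<delta>_def using fin D by (subst Min_gr_iff) auto
  have le: "\<delta> \<le> D \<sigma>" if "\<sigma> \<in> Q" "x \<in> \<sigma>" for \<sigma> unfolding \<delta>_def using fin that by (intro Min_le) auto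
  have sub: "z \<in> W" if "\<sigma> \<in> Q" "x \<in> \<sigma>" "z \<in> \<sigma>" "dist (\<iota> z) (\<iota> x) \<le> \<delta>" for \<sigma> z
    using D le[OF that(1,2)] that by force
  show thesis by (rule that[of \<delta>]; fact pos sub)
qed

locale balanced_space =
  fixes \<iota> :: "'x::topological_space \<Rightarrow> 'v::euclidean_space" and Qb Q0 :: "'x set set" and n :: int
    and U :: "'x set" and w :: "'x set \<Rightarrow> real" and a :: 'v and \<beta> :: real
  assumes cls: "in_class \<iota> Q0 Qb" and aff: "\<And>z. a \<bullet> \<iota> z = \<beta>" "\<beta> \<noteq> 0" and U: "open U"
    and mink: "minkowski \<iota> Qb U n w" and wpos: "\<And>\<sigma>. \<sigma> \<in> restr \<iota> Qb U n \<Longrightarrow> w \<sigma> > 0"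
    and dim_le: "\<And>\<sigma>. \<sigma> \<in> Qb \<Longrightarrow> pdim \<iota> \<sigma> \<le> n"
begin

abbreviation wc :: "('x \<Rightarrow> real) \<Rightarrow> bool" where "wc f \<equiv> weakly_concave \<iota> Q0 n U Qb w f"

lemma Qb: "eucl_complex \<iota> Qb" using in_class_complex[OF cls] .

text \<open>Removes the bases from the interface: d is completed first within the directions of
  \<sigma>, then in the whole space.\<close>

lemma edge_star:
  fixes \<epsilon> :: real
  assumes sig: "\<sigma> \<in> Qb" "x \<in> \<sigma>" "pdim \<iota> \<sigma> = n" and x: "x \<in> U" and d: "norm d = 1"
    and inward: "s0 > 0" "\<iota> x + s0 *\<^sub>R d \<in> rel_interior (\<iota> ` \<sigma>)" and eps: "\<epsilon> > 0"
    and nbhd: "\<And>\<rho> z. \<rho> \<in> Qb \<Longrightarrow> x \<in> \<rho> \<Longrightarrow> z \<in> \<rho> \<Longrightarrow> dist (\<iota> z) (\<iota> x) \<le> DIM('v) * \<epsilon> \<Longrightarrow> z \<in> U"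
  obtains R c where "finite R"
    "\<And>\<rho>. \<rho> \<in> R \<Longrightarrow> x \<in> \<rho> \<and> \<rho> \<subseteq> U \<and> c \<rho> \<ge> 0 \<and> convex (\<iota> ` \<rho>) \<and> (\<exists>z\<in>\<rho>. z \<noteq> x) \<and>
       (\<forall>z\<in>\<rho>. \<bar>d \<bullet> (\<iota> z - \<iota> x)\<bar> \<le> \<epsilon>) \<and> (\<exists>\<sigma>'\<in>Qb. \<rho> \<subseteq> \<sigma>')"
    "\<And>\<rho> z v. \<rho> \<in> R \<Longrightarrow> c \<rho> \<noteq> 0 \<Longrightarrow> z \<in> \<rho> \<Longrightarrow> v \<in> dirs (\<iota> ` \<sigma>) \<Longrightarrow> v \<bullet> d = 0 \<Longrightarrow> v \<bullet> (\<iota> z - \<iota> x) = 0"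
    "ray \<iota> \<sigma> x \<epsilon> d \<in> R" "c (ray \<iota> \<sigma> x \<epsilon> d) > 0"
    "\<And>s. s > 0 \<Longrightarrow> \<iota> x - s *\<^sub>R d \<in> \<iota> ` \<sigma> \<Longrightarrow> ray \<iota> \<sigma> x \<epsilon> (- d) \<in> R"
    "\<And>\<rho> \<rho>'. \<rho> \<in> R \<Longrightarrow> \<rho>' \<in> R \<Longrightarrow> \<rho> \<noteq> \<rho>' \<Longrightarrow> \<rho> \<inter> \<rho>' = {x}"
    "\<And>y f. wc f \<Longrightarrow> \<forall>\<rho>\<in>R. y \<rho> \<in> \<rho> \<and> y \<rho> \<noteq> x \<Longrightarrow>
      (\<Sum>\<rho>\<in>R. c \<rho> / dist (\<iota> (y \<rho>)) (\<iota> x) * f (y \<rho>)) \<le> (\<Sum>\<rho>\<in>R. c \<rho> / dist (\<iota> (y \<rho>)) (\<iota> x)) * f x"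
    "\<And>y. \<forall>\<rho>\<in>R. y \<rho> \<in> \<rho> \<and> y \<rho> \<noteq> x \<Longrightarrow>
      (\<Sum>\<rho>\<in>R. (c \<rho> / dist (\<iota> (y \<rho>)) (\<iota> x)) *\<^sub>R (\<iota> (y \<rho>) - \<iota> x)) = 0"
proof -
  have "\<iota> x + s0 *\<^sub>R d \<in> \<iota> ` \<sigma>" using inward(2) rel_interior_subset by blast
  then have "\<iota> x + s0 *\<^sub>R d - \<iota> x \<in> dirs (\<iota> ` \<sigma>)" using sig(2) by (intro diff_in_dirs imageI)
  then have "(1 / s0) *\<^sub>R (\<iota> x + s0 *\<^sub>R d - \<iota> x) \<in> dirs (\<iota> ` \<sigma>)" by (intro subspace_scale[OF subspace_dirs])
  then have dd: "{d} \<subseteq> dirs (\<iota> ` \<sigma>)" using inward(1) by simp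
  have dn: "norm b = 1" if "b \<in> {d}" for b using that d by simp
  have df: "finite {d}" by simp
  obtain B1 where B1: "{d} \<subseteq> B1" "B1 \<subseteq> dirs (\<iota> ` \<sigma>)" "finite B1" "pairwise orthogonal B1"
    "\<And>b. b \<in> B1 \<Longrightarrow> norm b = 1" "span B1 = dirs (\<iota> ` \<sigma>)"
    by (rule orthonormal_extend[OF subspace_dirs dd df pairwise_singleton dn], assumption, rule that; assumption)
  obtain B where B: "B1 \<subseteq> B" "finite B" "pairwise orthogonal B" "\<And>b. b \<in> B \<Longrightarrow> norm b = 1" "span B = UNIV"
    by (rule orthonormal_extend[OF subspace_UNIV subset_UNIV B1(3,4,5)], assumption, rule that; assumption)
  obtain bl where bl: "set bl = B" using finite_list[OF B(2)] by blast
  interpret balanced_star \<iota> Qb x \<epsilon> bl Q0 n U w a \<beta> \<sigma> d B1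
  proof unfold_locales
    show "eucl_complex \<iota> Qb" by (rule Qb)
    show "\<epsilon> > 0" by fact
    show "pairwise orthogonal (set bl)" "span (set bl) = UNIV" using B bl by simp_all
    show "norm b = 1" if "b \<in> set bl" for b using that B bl by simp
    show "in_class \<iota> Q0 Qb" "\<beta> \<noteq> 0" "open U" "x \<in> U" "minkowski \<iota> Qb U n w" by (fact cls aff(2) U x mink)+
    show "a \<bullet> \<iota> z = \<beta>" for z by (fact aff(1))
    show "w \<sigma> > 0" if "\<sigma> \<in> restr \<iota> Qb U n" for \<sigma> using wpos that .
    show "\<sigma> \<in> Qb" "x \<in> \<sigma>" "pdim \<iota> \<sigma> = n" by fact+
    show "d \<in> B1" "B1 \<subseteq> set bl" "span B1 = dirs (\<iota> ` \<sigma>)" using B1 B bl by auto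
    show "\<exists>s>0. \<iota> x + s *\<^sub>R d \<in> rel_interior (\<iota> ` \<sigma>)" using inward by blast
    show "z \<in> U" if "\<rho> \<in> Qb" "x \<in> \<rho>" "z \<in> \<rho>" "dist (\<iota> z) (\<iota> x) \<le> DIM('v) * \<epsilon>" for \<rho> z
      using nbhd that by blast
  qed
  show thesis by (rule star_edges, rule that; assumption)
qed

lemma maximal_cell_unique:
  assumes "\<sigma> \<in> Qb" "pdim \<iota> \<sigma> = n" "q \<in> \<sigma>" "\<iota> q \<in> rel_interior (\<iota> ` \<sigma>)" "\<rho> \<in> Qb" "q \<in> \<rho>"
  shows "\<rho> = \<sigma>"
proof -
  have "\<sigma> \<subseteq> \<rho>" by (rule cell_contains_mincell[OF Qb assms(1,3-6)])
  moreover have "pdim \<iota> \<sigma> = pdim \<iota> \<rho>" using pdim_mono[OF calculation, of \<iota>] dim_le[OF assms(5)] assms(2) by simp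
  ultimately show ?thesis using cell_eq_dim[OF Qb assms(5,1)] by simp
qed

text \<open>The part v of u orthogonal to d is itself a vector to which the hypothesis applies, so v
  \<bullet> v = v \<bullet> u = 0.\<close>

lemma line_component:
  fixes u d :: 'v
  assumes "\<And>v. v \<in> dirs S \<Longrightarrow> v \<bullet> d = 0 \<Longrightarrow> v \<bullet> u = 0" "u \<in> dirs S" "d \<in> dirs S" "norm d = 1"
  shows "u = (d \<bullet> u) *\<^sub>R d"
proof -
  define v where "v = u - (d \<bullet> u) *\<^sub>R d"
  have dd: "d \<bullet> d = 1" using assms(4) by (simp add: norm_eq_1)
  have 1: "v \<in> dirs S" unfolding v_def using assms by (intro subspace_diff subspace_scale) auto
  have 2: "v \<bullet> d = 0" by (simp add: v_def inner_diff_left dd) (simp add: inner_commute)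
  have "v \<bullet> u = 0" using assms(1) 1 2 by blast
  moreover have "v \<bullet> v = v \<bullet> u - (d \<bullet> u) * (v \<bullet> d)"
    by (subst (2) v_def) (simp add: inner_diff_right)
  ultimately have "v \<bullet> v = 0" using 2 by simp
  then show ?thesis by (simp add: v_def)
qed

text \<open>The only cell of \<open>Qb\<close> at q is \<sigma>, so every weighted edge lies on the
  line through q with direction d; as distinct edges share only q, it is one of the two rays.
  Balancing makes their weights equal, and z and z' serve as test points.\<close>

lemma weakly_concave_interior:
  fixes \<epsilon> :: real
  assumes f: "wc f" and sig: "\<sigma> \<in> Qb" "pdim \<iota> \<sigma> = n" and q: "q \<in> \<sigma>" "q \<in> U" "\<iota> q \<in> rel_interior (\<iota> ` \<sigma>)"
    and z: "z \<in> \<sigma>" "z' \<in> \<sigma>" "\<iota> q = (1 - t) *\<^sub>R \<iota> z + t *\<^sub>R \<iota> z'" "0 < t" "t < 1"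
    and \<epsilon>: "\<epsilon> > 0" "dist (\<iota> z) (\<iota> q) \<le> \<epsilon>" "dist (\<iota> z') (\<iota> q) \<le> \<epsilon>"
    and nbhd: "\<And>y. y \<in> \<sigma> \<Longrightarrow> dist (\<iota> y) (\<iota> q) \<le> DIM('v) * \<epsilon> \<Longrightarrow> y \<in> U"
  shows "f q \<ge> (1 - t) * f z + t * f z'"
proof (cases "\<iota> z = \<iota> q")
  case True
  have "t *\<^sub>R \<iota> q = t *\<^sub>R \<iota> z'" using z(3) True by (simp add: algebra_simps)
  then have e: "\<iota> z' = \<iota> q" using z(4) by simp
  have "z = q" by (rule inj_onD[OF cell_inj[OF Qb sig(1)] True z(1) q(1)])
  moreover have "z' = q" by (rule inj_onD[OF cell_inj[OF Qb sig(1)] e z(2) q(1)])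
  ultimately show ?thesis by (simp add: algebra_simps)
next
  case False
  define r where "r = dist (\<iota> z) (\<iota> q)"
  have r: "r > 0" using False by (simp add: r_def)
  define d where "d = (1 / r) *\<^sub>R (\<iota> z - \<iota> q)"
  have d1: "norm d = 1" using r by (simp add: d_def r_def dist_norm)
  have zd: "\<iota> z = \<iota> q + r *\<^sub>R d" using r by (simp add: d_def)
  \<comment> \<open>The distance from q to z', dictated by the position of q between z and
    z'.\<close>
  define r' where "r' = (1 - t) * r / t"
  have r': "r' > 0" using r z by (simp add: r'_def)
  have "t *\<^sub>R \<iota> z' = t *\<^sub>R \<iota> q - ((1 - t) * r) *\<^sub>R d" using z(3) unfolding zd by (simp add: algebra_simps)
  then have "(1 / t) *\<^sub>R (t *\<^sub>R \<iota> z') = (1 / t) *\<^sub>R (t *\<^sub>R \<iota> q - ((1 - t) * r) *\<^sub>R d)" by simp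
  then have zd': "\<iota> z' = \<iota> q - r' *\<^sub>R d" using z(4) by (simp add: r'_def scaleR_diff_right)
  have le: "r \<le> \<epsilon>" "r' \<le> \<epsilon>" using \<epsilon>(2,3) r' d1 zd' by (auto simp: r_def dist_norm)
  have "\<iota> z - (1/2) *\<^sub>R (\<iota> z - \<iota> q) \<in> rel_interior (\<iota> ` \<sigma>)"
    by (rule rel_interior_convex_shrink[OF cell_convex[OF Qb sig(1)] q(3)]) (use z in auto)
  moreover have "\<iota> z - (1/2) *\<^sub>R (\<iota> z - \<iota> q) = \<iota> q + (r / 2) *\<^sub>R d"
    unfolding zd by (simp flip: scaleR_diff_left)
  ultimately have inw: "\<iota> q + (r / 2) *\<^sub>R d \<in> rel_interior (\<iota> ` \<sigma>)" by simp
  have uniq: "\<rho> = \<sigma>" if "\<rho> \<in> Qb" "q \<in> \<rho>" for \<rho> using maximal_cell_unique[OF sig q(1,3) that] .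
  have nb: "z \<in> U" if "\<rho> \<in> Qb" "q \<in> \<rho>" "z \<in> \<rho>" "dist (\<iota> z) (\<iota> q) \<le> DIM('v) * \<epsilon>" for \<rho> z
    using nbhd uniq that by blast
  have r2: "r / 2 > 0" using r by simp
  obtain R c where R: "finite R"
    "\<And>\<rho>. \<rho> \<in> R \<Longrightarrow> q \<in> \<rho> \<and> \<rho> \<subseteq> U \<and> c \<rho> \<ge> 0 \<and> convex (\<iota> ` \<rho>) \<and> (\<exists>z\<in>\<rho>. z \<noteq> q) \<and>
       (\<forall>z\<in>\<rho>. \<bar>d \<bullet> (\<iota> z - \<iota> q)\<bar> \<le> \<epsilon>) \<and> (\<exists>\<sigma>'\<in>Qb. \<rho> \<subseteq> \<sigma>')"
    "\<And>\<rho> z v. \<rho> \<in> R \<Longrightarrow> c \<rho> \<noteq> 0 \<Longrightarrow> z \<in> \<rho> \<Longrightarrow> v \<in> dirs (\<iota> ` \<sigma>) \<Longrightarrow> v \<bullet> d = 0 \<Longrightarrow> v \<bullet> (\<iota> z - \<iota> q) = 0"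
    "ray \<iota> \<sigma> q \<epsilon> d \<in> R" "c (ray \<iota> \<sigma> q \<epsilon> d) > 0"
    "\<And>s. s > 0 \<Longrightarrow> \<iota> q - s *\<^sub>R d \<in> \<iota> ` \<sigma> \<Longrightarrow> ray \<iota> \<sigma> q \<epsilon> (- d) \<in> R"
    "\<And>\<rho> \<rho>'. \<rho> \<in> R \<Longrightarrow> \<rho>' \<in> R \<Longrightarrow> \<rho> \<noteq> \<rho>' \<Longrightarrow> \<rho> \<inter> \<rho>' = {q}"
    "\<And>y f. wc f \<Longrightarrow> \<forall>\<rho>\<in>R. y \<rho> \<in> \<rho> \<and> y \<rho> \<noteq> q \<Longrightarrow>
      (\<Sum>\<rho>\<in>R. c \<rho> / dist (\<iota> (y \<rho>)) (\<iota> q) * f (y \<rho>)) \<le> (\<Sum>\<rho>\<in>R. c \<rho> / dist (\<iota> (y \<rho>)) (\<iota> q)) * f q"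
    "\<And>y. \<forall>\<rho>\<in>R. y \<rho> \<in> \<rho> \<and> y \<rho> \<noteq> q \<Longrightarrow>
      (\<Sum>\<rho>\<in>R. (c \<rho> / dist (\<iota> (y \<rho>)) (\<iota> q)) *\<^sub>R (\<iota> (y \<rho>) - \<iota> q)) = 0"
    by (rule edge_star[OF sig(1) q(1) sig(2) q(2) d1 r2 inw \<epsilon>(1) nb], assumption+, rule that; assumption)
  let ?a = "ray \<iota> \<sigma> q \<epsilon> d" and ?b = "ray \<iota> \<sigma> q \<epsilon> (- d)"
  have za: "z \<in> ?a" using zd z(1) r le by (auto simp: ray_def intro!: bexI[of _ r])
  have zb: "z' \<in> ?b" using zd' z(2) r' le by (auto simp: ray_def intro!: bexI[of _ r'])
  have znq: "z \<noteq> q" "z' \<noteq> q" using zd zd' r r' d1 by auto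
  have bR: "?b \<in> R" using R(6)[OF r'] zd' z(2) by (metis imageI)
  have d0: "d \<noteq> 0" using d1 by auto
  have ab: "?a \<noteq> ?b"
  proof
    assume "?a = ?b"
    then obtain s where "s \<ge> 0" "\<iota> z = \<iota> q + s *\<^sub>R (- d)" using za by (auto simp: ray_def)
    then have "(r + s) *\<^sub>R d = 0" using zd by (simp add: scaleR_add_left)
    then show False using d0 r \<open>s \<ge> 0\<close> by simp
  qed
  have ddir: "d \<in> dirs (\<iota> ` \<sigma>)" unfolding d_def using z q by (intro subspace_scale[OF subspace_dirs] diff_in_dirs imageI)
  have zero: "c \<rho> = 0" if r: "\<rho> \<in> R" "\<rho> \<noteq> ?a" "\<rho> \<noteq> ?b" for \<rho>
  proof (rule ccontr)
    assume c: "c \<rho> \<noteq> 0"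
    obtain p \<sigma>' where p: "p \<in> \<rho>" "p \<noteq> q" "\<sigma>' \<in> Qb" "\<rho> \<subseteq> \<sigma>'" "q \<in> \<rho>" "\<bar>d \<bullet> (\<iota> p - \<iota> q)\<bar> \<le> \<epsilon>" using R(2)[OF r(1)] by blast
    then have "\<sigma>' = \<sigma>" using uniq by blast
    then have ps: "p \<in> \<sigma>" using p by blast
    have e: "\<iota> p - \<iota> q = (d \<bullet> (\<iota> p - \<iota> q)) *\<^sub>R d"
      by (rule line_component[OF R(3)[OF r(1) c p(1)] _ ddir d1]) (use ps q in \<open>auto intro: diff_in_dirs\<close>)
    have "p \<in> ?a \<or> p \<in> ?b"
    proof (cases "d \<bullet> (\<iota> p - \<iota> q) \<ge> 0")
      case True
      then have "p \<in> ?a" unfolding ray_def using ps p(6) e by (auto intro!: bexI[of _ "d \<bullet> (\<iota> p - \<iota> q)"] simp: algebra_simps)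
      then show ?thesis ..
    next
      case False
      have "\<iota> p = \<iota> q + (- (d \<bullet> (\<iota> p - \<iota> q))) *\<^sub>R (- d)" using e by (simp add: algebra_simps)
      moreover have "- (d \<bullet> (\<iota> p - \<iota> q)) \<in> {0..\<epsilon>}" using False p(6) by auto
      ultimately have "p \<in> ?b" unfolding ray_def using ps by blast
      then show ?thesis ..
    qed
    then show False using R(7)[OF r(1) R(4) r(2)] R(7)[OF r(1) bR r(3)] p by blast
  qed
  define y where "y \<rho> = (if \<rho> = ?a then z else if \<rho> = ?b then z' else SOME p. p \<in> \<rho> \<and> p \<noteq> q)" for \<rho>
  have y: "y \<rho> \<in> \<rho> \<and> y \<rho> \<noteq> q" if "\<rho> \<in> R" for \<rho>
  proof (cases "\<rho> = ?a \<or> \<rho> = ?b")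
    case True then show ?thesis using za zb znq ab by (auto simp: y_def)
  next
    case False
    have "\<exists>p. p \<in> \<rho> \<and> p \<noteq> q" using R(2)[OF that] by blast
    from someI_ex[OF this] show ?thesis using False by (simp add: y_def)
  qed
  have ya: "y ?a = z" "y ?b = z'" using ab by (auto simp: y_def)
  have two: "(\<Sum>\<rho>\<in>R. h \<rho>) = h ?a + h ?b" if h: "\<And>\<rho>. c \<rho> = 0 \<Longrightarrow> h \<rho> = 0" for h :: "'x set \<Rightarrow> 'b::comm_monoid_add"
  proof -
    have "(\<Sum>\<rho>\<in>R. h \<rho>) = (\<Sum>\<rho>\<in>{?a, ?b}. h \<rho>)"
      by (rule sum.mono_neutral_right[OF R(1)]) (use R(4) bR zero h in auto)
    then show ?thesis using ab by simp
  qed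
  have dz: "dist (\<iota> z) (\<iota> q) = r" "dist (\<iota> z') (\<iota> q) = r'" using zd zd' r r' d1 by (simp_all add: dist_norm)
  have "(c ?a / r) *\<^sub>R (r *\<^sub>R d) + (c ?b / r') *\<^sub>R (- (r' *\<^sub>R d)) = 0"
    using R(9)[of y] y unfolding two[of "\<lambda>\<rho>. (c \<rho> / dist (\<iota> (y \<rho>)) (\<iota> q)) *\<^sub>R (\<iota> (y \<rho>) - \<iota> q)", simplified] ya dz
    by (simp add: zd zd')
  then have "(c ?a - c ?b) *\<^sub>R d = 0" using r r' by (simp add: scaleR_diff_left)
  then have cc: "c ?b = c ?a" using d0 by simp
  have "c ?a / r * f z + c ?a / r' * f z' \<le> (c ?a / r + c ?a / r') * f q"
    using R(8)[OF f, of y] y two[of "\<lambda>\<rho>. c \<rho> / dist (\<iota> (y \<rho>)) (\<iota> q) * f (y \<rho>)"]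
      two[of "\<lambda>\<rho>. c \<rho> / dist (\<iota> (y \<rho>)) (\<iota> q)"] by (simp add: ya dz cc)
  \<comment> \<open>With c the common weight of the two rays, this factor turns c / r and c / r'
    into 1 - t and t.\<close>
  then have "(r * (1 - t) / c ?a) * (c ?a / r * f z + c ?a / r' * f z') \<le> (r * (1 - t) / c ?a) * ((c ?a / r + c ?a / r') * f q)"
    using r z(5) R(5) by (intro mult_left_mono) auto
  moreover have "(r * (1 - t) / c ?a) * (c ?a / r * A + c ?a / r' * B) = (1 - t) * A + t * B" for A B
    using r z(4,5) R(5) unfolding r'_def by (simp add: field_simps)
  moreover have "(r * (1 - t) / c ?a) * ((c ?a / r + c ?a / r') * A) = A" for A
    using r z(4,5) R(5) unfolding r'_def by (simp add: field_simps)
  ultimately show ?thesis by simp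
qed

text \<open>The inequality at x is applied with q at distance t D on the ray and fixed test points
  on the other edges. The weight of the ray appears divided by t D, so clearing it leaves an error
  linear in t. All data are chosen before f and therefore serve a whole sequence.\<close>

lemma weakly_concave_ray:
  assumes sig: "\<sigma> \<in> Qb" "pdim \<iota> \<sigma> = n" and x: "x \<in> \<sigma>" "x \<in> U" and p: "\<iota> p \<in> rel_interior (\<iota> ` \<sigma>)" "\<iota> p \<noteq> \<iota> x"
  obtains T R \<omega> y where "T > 0" "finite (R :: 'x set set)" "\<And>\<rho>. \<rho> \<in> R \<Longrightarrow> \<omega> \<rho> \<ge> 0 \<and> y \<rho> \<in> U"
    "\<And>f t q. wc f \<Longrightarrow> 0 < t \<Longrightarrow> t \<le> T \<Longrightarrow> q \<in> \<sigma> \<Longrightarrow> \<iota> q = \<iota> x + t *\<^sub>R (\<iota> p - \<iota> x) \<Longrightarrow>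
       f q \<le> f x + t * (\<Sum>\<rho>\<in>R. \<omega> \<rho> * (f x - f (y \<rho>)))"
    "\<And>\<rho> \<tau> \<kappa>. \<rho> \<in> R \<Longrightarrow> \<omega> \<rho> \<noteq> 0 \<Longrightarrow> \<tau> \<in> Qb \<Longrightarrow> x \<in> \<tau> \<Longrightarrow> \<iota> x \<in> rel_interior (\<iota> ` \<tau>) \<Longrightarrow> \<tau> \<noteq> \<sigma> \<Longrightarrow>
       \<kappa> \<in> Qb \<Longrightarrow> y \<rho> \<in> \<kappa> \<Longrightarrow> pdim \<iota> \<kappa> > pdim \<iota> \<tau>"
proof -
  obtain N where N: "open N" "x \<in> N" "\<And>\<sigma>. \<sigma> \<in> Qb \<Longrightarrow> \<sigma> \<inter> N \<noteq> {} \<Longrightarrow> x \<in> \<sigma>" by (rule star_nbhd[OF Qb], rule that; assumption)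
  obtain \<delta> where \<delta>: "\<delta> > 0" "\<And>\<sigma> z. \<sigma> \<in> Qb \<Longrightarrow> x \<in> \<sigma> \<Longrightarrow> z \<in> \<sigma> \<Longrightarrow> dist (\<iota> z) (\<iota> x) \<le> \<delta> \<Longrightarrow> z \<in> U"
    by (rule star_radius[OF Qb U x(2)], rule that; assumption)
  define \<epsilon> where "\<epsilon> = \<delta> / DIM('v)"
  have \<epsilon>: "\<epsilon> > 0" "DIM('v) * \<epsilon> = \<delta>" using \<delta>(1) by (auto simp: \<epsilon>_def)
  define D where "D = dist (\<iota> p) (\<iota> x)"
  have D: "D > 0" using p(2) by (simp add: D_def)
  define d where "d = (1 / D) *\<^sub>R (\<iota> p - \<iota> x)"
  have d1: "norm d = 1" using D by (simp add: d_def D_def dist_norm)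
  have pd: "\<iota> p - \<iota> x = D *\<^sub>R d" using D by (simp add: d_def)
  have inw: "\<iota> x + D *\<^sub>R d \<in> rel_interior (\<iota> ` \<sigma>)" using p(1) pd by (metis add.commute diff_add_cancel)
  have pS: "\<iota> p \<in> \<iota> ` \<sigma>" using p(1) rel_interior_subset by blast
  have ddir: "d \<in> dirs (\<iota> ` \<sigma>)" unfolding d_def by (rule subspace_scale[OF subspace_dirs diff_in_dirs[OF pS imageI[OF x(1)]]])
  obtain R c where R: "finite R"
    "\<And>\<rho>. \<rho> \<in> R \<Longrightarrow> x \<in> \<rho> \<and> \<rho> \<subseteq> U \<and> c \<rho> \<ge> 0 \<and> convex (\<iota> ` \<rho>) \<and> (\<exists>z\<in>\<rho>. z \<noteq> x) \<and>
       (\<forall>z\<in>\<rho>. \<bar>d \<bullet> (\<iota> z - \<iota> x)\<bar> \<le> \<epsilon>) \<and> (\<exists>\<sigma>'\<in>Qb. \<rho> \<subseteq> \<sigma>')"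
    "\<And>\<rho> z v. \<rho> \<in> R \<Longrightarrow> c \<rho> \<noteq> 0 \<Longrightarrow> z \<in> \<rho> \<Longrightarrow> v \<in> dirs (\<iota> ` \<sigma>) \<Longrightarrow> v \<bullet> d = 0 \<Longrightarrow> v \<bullet> (\<iota> z - \<iota> x) = 0"
    "ray \<iota> \<sigma> x \<epsilon> d \<in> R" "c (ray \<iota> \<sigma> x \<epsilon> d) > 0"
    "\<And>s. s > 0 \<Longrightarrow> \<iota> x - s *\<^sub>R d \<in> \<iota> ` \<sigma> \<Longrightarrow> ray \<iota> \<sigma> x \<epsilon> (- d) \<in> R"
    "\<And>\<rho> \<rho>'. \<rho> \<in> R \<Longrightarrow> \<rho>' \<in> R \<Longrightarrow> \<rho> \<noteq> \<rho>' \<Longrightarrow> \<rho> \<inter> \<rho>' = {x}"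
    "\<And>y f. wc f \<Longrightarrow> \<forall>\<rho>\<in>R. y \<rho> \<in> \<rho> \<and> y \<rho> \<noteq> x \<Longrightarrow>
      (\<Sum>\<rho>\<in>R. c \<rho> / dist (\<iota> (y \<rho>)) (\<iota> x) * f (y \<rho>)) \<le> (\<Sum>\<rho>\<in>R. c \<rho> / dist (\<iota> (y \<rho>)) (\<iota> x)) * f x"
    by (rule edge_star[OF sig(1) x(1) sig(2) x(2) d1 D inw \<epsilon>(1) \<delta>(2)[folded \<epsilon>(2)]], assumption+, rule that; assumption)
  let ?a = "ray \<iota> \<sigma> x \<epsilon> d"
  have near: "\<exists>y. y \<in> \<rho> \<and> y \<noteq> x \<and> y \<in> N" if r: "\<rho> \<in> R" for \<rho>
  proof -
    obtain z \<sigma>' where z: "z \<in> \<rho>" "z \<noteq> x" "x \<in> \<rho>" "convex (\<iota> ` \<rho>)" "\<sigma>' \<in> Qb" "\<rho> \<subseteq> \<sigma>'" using R(2)[OF r] by blast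
    have zs: "z \<in> \<sigma>'" "x \<in> \<sigma>'" using z by blast+
    obtain l y where ly: "l > 0" "l \<le> 1" "y \<in> \<sigma>' \<inter> N" "\<iota> y = \<iota> x + l *\<^sub>R (\<iota> z - \<iota> x)"
      by (rule cell_segment_near[OF Qb z(5) zs(2) N(1,2) zs(1)], rule that; assumption)
    have "(1 - l) *\<^sub>R \<iota> x + l *\<^sub>R \<iota> z \<in> \<iota> ` \<rho>" using z ly by (intro convexD) auto
    then obtain y' where y': "y' \<in> \<rho>" "\<iota> y' = \<iota> y" using ly(4) by (auto simp: algebra_simps)
    have "y' = y" using y' ly(3) z(6) cell_inj[OF Qb z(5)] by (auto dest: inj_onD)
    moreover have "\<iota> z \<noteq> \<iota> x" using zs z(2) cell_inj[OF Qb z(5)] by (auto dest: inj_onD)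
    then have "y \<noteq> x" using ly by auto
    ultimately show ?thesis using y' ly(3) by blast
  qed
  \<comment> \<open>Test points inside the star neighbourhood N: every cell through such a point
    contains x, which makes its stratum comparable with that of x.\<close>
  define y where "y \<rho> = (SOME y. y \<in> \<rho> \<and> y \<noteq> x \<and> y \<in> N)" for \<rho>
  have y: "y \<rho> \<in> \<rho>" "y \<rho> \<noteq> x" "y \<rho> \<in> N" if "\<rho> \<in> R" for \<rho>
    using someI_ex[OF near[OF that]] unfolding y_def by blast+
  let ?c0 = "c ?a"
  define \<omega> where "\<omega> \<rho> = c \<rho> / dist (\<iota> (y \<rho>)) (\<iota> x) * D / ?c0" for \<rho>
  define R' where "R' = R - {?a}"
  have T: "\<epsilon> / D > 0" using \<epsilon> D by simp
  have finR': "finite R'" using R(1) by (simp add: R'_def)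
  have nonneg: "\<omega> \<rho> \<ge> 0 \<and> y \<rho> \<in> U" if "\<rho> \<in> R'" for \<rho>
    using that R(2)[of \<rho>] y(1)[of \<rho>] D R(5) by (auto simp: R'_def \<omega>_def)
  have ineq: "f q \<le> f x + t * (\<Sum>\<rho>\<in>R'. \<omega> \<rho> * (f x - f (y \<rho>)))"
    if f: "wc f" and t: "0 < t" "t \<le> \<epsilon> / D" and q: "q \<in> \<sigma>" "\<iota> q = \<iota> x + t *\<^sub>R (\<iota> p - \<iota> x)" for f t q
  proof -
    have q': "\<iota> q = \<iota> x + (t * D) *\<^sub>R d" using q(2) pd by simp
    have tD: "t * D > 0" "t * D \<le> \<epsilon>" using t D by (auto simp: field_simps)
    then have qa: "q \<in> ?a" using q(1) q' by (auto simp: ray_def intro!: bexI[of _ "t * D"])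
    have dq: "dist (\<iota> q) (\<iota> x) = t * D" using q' tD(1) d1 by (simp add: dist_norm)
    have qx: "q \<noteq> x" using dq tD by auto
    define y' where "y' = y(?a := q)"
    have y': "y' \<rho> \<in> \<rho>" "y' \<rho> \<noteq> x" if "\<rho> \<in> R" for \<rho> using y[OF that] qa qx by (auto simp: y'_def)
    have spl: "(\<Sum>\<rho>\<in>R. h \<rho>) = h ?a + (\<Sum>\<rho>\<in>R'. h \<rho>)" for h :: "'x set \<Rightarrow> real"
      unfolding R'_def by (rule sum.remove[OF R(1,4)])
    have "(\<Sum>\<rho>\<in>R. c \<rho> / dist (\<iota> (y' \<rho>)) (\<iota> x) * f (y' \<rho>)) \<le> (\<Sum>\<rho>\<in>R. c \<rho> / dist (\<iota> (y' \<rho>)) (\<iota> x)) * f x"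
      by (rule R(8)[OF f]) (use y' in blast)
    moreover have "(\<Sum>\<rho>\<in>R'. c \<rho> / dist (\<iota> (y' \<rho>)) (\<iota> x) * f (y' \<rho>)) = (\<Sum>\<rho>\<in>R'. c \<rho> / dist (\<iota> (y \<rho>)) (\<iota> x) * f (y \<rho>))"
      "(\<Sum>\<rho>\<in>R'. c \<rho> / dist (\<iota> (y' \<rho>)) (\<iota> x)) = (\<Sum>\<rho>\<in>R'. c \<rho> / dist (\<iota> (y \<rho>)) (\<iota> x))"
      by (rule sum.cong[OF refl], simp add: y'_def R'_def)+
    moreover have "y' ?a = q" by (simp add: y'_def)
    ultimately have *: "?c0 / (t * D) * f q + (\<Sum>\<rho>\<in>R'. c \<rho> / dist (\<iota> (y \<rho>)) (\<iota> x) * f (y \<rho>))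
       \<le> (?c0 / (t * D) + (\<Sum>\<rho>\<in>R'. c \<rho> / dist (\<iota> (y \<rho>)) (\<iota> x))) * f x"
      unfolding spl by (simp add: dq)
    then have "?c0 / (t * D) * f q \<le> ?c0 / (t * D) * f x + (\<Sum>\<rho>\<in>R'. c \<rho> / dist (\<iota> (y \<rho>)) (\<iota> x) * (f x - f (y \<rho>)))"
    proof -
      have "(\<Sum>\<rho>\<in>R'. c \<rho> / dist (\<iota> (y \<rho>)) (\<iota> x) * (f x - f (y \<rho>))) =
        (\<Sum>\<rho>\<in>R'. c \<rho> / dist (\<iota> (y \<rho>)) (\<iota> x)) * f x - (\<Sum>\<rho>\<in>R'. c \<rho> / dist (\<iota> (y \<rho>)) (\<iota> x) * f (y \<rho>))"
        by (simp only: right_diff_distrib sum_subtractf sum_distrib_right)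
      then show ?thesis using * by (simp only: distrib_right)
    qed
    then have "(t * D / ?c0) * (?c0 / (t * D) * f q) \<le> (t * D / ?c0) * (?c0 / (t * D) * f x + (\<Sum>\<rho>\<in>R'. c \<rho> / dist (\<iota> (y \<rho>)) (\<iota> x) * (f x - f (y \<rho>))))"
      using tD R(5) by (intro mult_left_mono) auto
    then have "f q \<le> f x + (t * D / ?c0) * (\<Sum>\<rho>\<in>R'. c \<rho> / dist (\<iota> (y \<rho>)) (\<iota> x) * (f x - f (y \<rho>)))"
      using tD R(5) t D by (simp add: distrib_left)
    also have "(t * D / ?c0) * (\<Sum>\<rho>\<in>R'. c \<rho> / dist (\<iota> (y \<rho>)) (\<iota> x) * (f x - f (y \<rho>))) = t * (\<Sum>\<rho>\<in>R'. \<omega> \<rho> * (f x - f (y \<rho>)))"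
      unfolding \<omega>_def sum_distrib_left by (rule sum.cong[OF refl]) (simp add: mult_ac)
    finally show ?thesis .
  qed
  \<comment> \<open>If a weighted test point stayed in \<tau>, the support condition would make d a
    direction of \<tau>. As x is relatively interior to \<tau>, the ray would begin inside \<tau>
    and at once enter the relative interior of \<sigma>, which a proper face cannot meet.\<close>
  have higher: "pdim \<iota> \<kappa> > pdim \<iota> \<tau>"
    if r: "\<rho> \<in> R'" "\<omega> \<rho> \<noteq> 0" and \<tau>: "\<tau> \<in> Qb" "x \<in> \<tau>" "\<iota> x \<in> rel_interior (\<iota> ` \<tau>)" "\<tau> \<noteq> \<sigma>" and \<kappa>: "\<kappa> \<in> Qb" "y \<rho> \<in> \<kappa>" for \<rho> \<tau> \<kappa>
  proof -
    have rR: "\<rho> \<in> R" using r by (simp add: R'_def)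
    have c0: "c \<rho> \<noteq> 0" using r(2) by (auto simp: \<omega>_def)
    have "x \<in> \<kappa>" using N(3)[OF \<kappa>(1)] \<kappa>(2) y(3)[OF rR] by blast
    then have tk: "\<tau> \<subseteq> \<kappa>" by (rule cell_contains_mincell[OF Qb \<tau>(1-3) \<kappa>(1)])
    have ts: "\<tau> \<subseteq> \<sigma>" by (rule cell_contains_mincell[OF Qb \<tau>(1-3) sig(1) x(1)])
    have "\<tau> \<noteq> \<kappa>"
    proof
      assume "\<tau> = \<kappa>"
      then have yt: "y \<rho> \<in> \<tau>" using \<kappa> by simp
      then have ys: "y \<rho> \<in> \<sigma>" using ts by blast
      define v where "v = \<iota> (y \<rho>) - \<iota> x"
      have vt: "v \<in> dirs (\<iota> ` \<tau>)" unfolding v_def using yt \<tau>(2) by (intro diff_in_dirs imageI)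
      have "v = (d \<bullet> v) *\<^sub>R d" unfolding v_def
        by (rule line_component[OF R(3)[OF rR c0 y(1)[OF rR]] _ ddir d1]) (use ys x in \<open>auto intro: diff_in_dirs\<close>)
      moreover have "v \<noteq> 0" unfolding v_def using ys x(1) y(2)[OF rR] cell_inj[OF Qb sig(1)] by (auto dest: inj_onD)
      ultimately have dv: "d \<bullet> v \<noteq> 0" "v = (d \<bullet> v) *\<^sub>R d" by auto
      have "(1 / (d \<bullet> v)) *\<^sub>R v \<in> dirs (\<iota> ` \<tau>)" using vt by (intro subspace_scale[OF subspace_dirs])
      then have dt: "d \<in> dirs (\<iota> ` \<tau>)" using dv by (metis divide_self_if inverse_eq_divide scaleR_one scaleR_scaleR mult.commute times_divide_eq_right mult.right_neutral)
      obtain e where e: "e > 0" "\<And>t. t \<in> dirs (\<iota> ` \<tau>) \<Longrightarrow> norm t \<le> e \<Longrightarrow> \<iota> x + t \<in> \<iota> ` \<tau>"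
        by (rule rel_interior_dirs[OF \<tau>(3)], rule that; assumption)
      define l where "l = min 1 (e / D)"
      have l: "0 < l" "l \<le> 1" "l * D \<le> e" using e(1) D by (auto simp: l_def min_def field_simps)
      have "\<iota> x + (l * D) *\<^sub>R d \<in> \<iota> ` \<tau>" using l D d1 dt by (intro e(2) subspace_scale[OF subspace_dirs]) auto
      moreover have "\<iota> x - l *\<^sub>R (\<iota> x - (\<iota> x + D *\<^sub>R d)) \<in> rel_interior (\<iota> ` \<sigma>)"
        by (rule rel_interior_convex_shrink[OF cell_convex[OF Qb sig(1)] inw _ l(1,2)]) (use x in blast)
      ultimately have "\<iota> ` \<tau> \<inter> rel_interior (\<iota> ` \<sigma>) \<noteq> {}" by auto
      then have "\<iota> ` \<tau> = \<iota> ` \<sigma>" using face_of_disjoint_rel_interior[OF cell_face[OF Qb sig(1) \<tau>(1) ts]] by blast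
      then show False using \<tau>(4) inj_on_image_eq_iff[OF cell_inj[OF Qb sig(1)] ts] by blast
    qed
    then have "pdim \<iota> \<tau> \<noteq> pdim \<iota> \<kappa>" using cell_eq_dim[OF Qb \<kappa>(1) \<tau>(1) tk] by blast
    then show ?thesis using pdim_mono[OF tk, of \<iota>] by simp
  qed
  show thesis by (rule that[of "\<epsilon> / D" R' \<omega> y]; fact T finR' nonneg ineq higher)
qed

end

section \<open>Elementary facts on small parameters, cones and cubes\<close>

lemma nonneg_if_linear_le:
  fixes c e :: real
  assumes "T > 0" "\<And>s. 0 < s \<Longrightarrow> s \<le> T \<Longrightarrow> s * c \<le> e"
  shows "0 \<le> e"
proof (rule ccontr)
  assume "\<not> 0 \<le> e"
  then have e: "e < 0" by simp
  have "T * c \<le> e" using assms by simp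
  then have "T * c < 0" using e by simp
  then have c: "c < 0" using assms(1) by (simp add: mult_less_0_iff)
  \<comment> \<open>Since c < 0, this bound on s gives s c \<ge> e / 2 > e.\<close>
  define s where "s = min T (e / (2 * c))"
  have s: "s > 0" "s \<le> T" "s \<le> e / (2 * c)" using assms(1) e c by (auto simp: s_def divide_neg_neg)
  have "s * c \<ge> e / (2 * c) * c" by (rule mult_right_mono_neg[OF s(3)]) (use c in simp)
  then have "s * c \<ge> e / 2" using c by simp
  then show False using assms(2)[OF s(1,2)] e by simp
qed

text \<open>A half-space with x on its boundary is a cone at x and admits every length; the others
  contain a ball around x. Finitely many half-spaces give one length for all directions.\<close>

lemma polyhedron_local_cone:
  fixes P :: "'v::euclidean_space set"
  assumes "polyhedron P" "x \<in> P"
  obtains \<kappa> where "\<kappa> > 0" "\<And>v. v \<in> P \<Longrightarrow> v \<noteq> x \<Longrightarrow> x + (\<kappa> / norm (v - x)) *\<^sub>R (v - x) \<in> P"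
proof -
  obtain F where F: "finite F" "P = \<Inter>F" "\<forall>h\<in>F. \<exists>a b. a \<noteq> 0 \<and> h = {v. a \<bullet> v \<le> b}"
    using assms(1) unfolding polyhedron_def by blast
  have "\<forall>h\<in>F. \<exists>k>0. \<forall>v\<in>h. \<forall>s. v \<noteq> x \<and> 0 \<le> s \<and> s \<le> k \<longrightarrow> x + (s / norm (v - x)) *\<^sub>R (v - x) \<in> h"
  proof
    fix h assume h: "h \<in> F"
    then obtain a b where ab: "a \<noteq> 0" "h = {v. a \<bullet> v \<le> b}" using F by blast
    have xh: "a \<bullet> x \<le> b" using assms(2) F(2) h ab by blast
    show "\<exists>k>0. \<forall>v\<in>h. \<forall>s. v \<noteq> x \<and> 0 \<le> s \<and> s \<le> k \<longrightarrow> x + (s / norm (v - x)) *\<^sub>R (v - x) \<in> h"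
    proof (cases "a \<bullet> x = b")
      case True
      have "x + (s / norm (v - x)) *\<^sub>R (v - x) \<in> h" if "v \<in> h" "v \<noteq> x" "0 \<le> s" for v s
      proof -
        have "a \<bullet> (v - x) \<le> 0" using that(1) ab True by (simp add: inner_diff_right)
        then have "(s / norm (v - x)) * (a \<bullet> (v - x)) \<le> 0" using that(3) by (intro mult_nonneg_nonpos) auto
        then show ?thesis using ab True by (simp add: inner_add_right)
      qed
      then show ?thesis by (intro exI[of _ 1]) auto
    next
      case False
      \<comment> \<open>The distance from x to the bounding hyperplane.\<close>
      define k where "k = (b - a \<bullet> x) / norm a"
      have k: "k > 0" using False xh ab by (simp add: k_def)
      have "x + (s / norm (v - x)) *\<^sub>R (v - x) \<in> h" if "v \<noteq> x" "0 \<le> s" "s \<le> k" for v s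
      proof -
        have "a \<bullet> ((s / norm (v - x)) *\<^sub>R (v - x)) \<le> norm a * norm ((s / norm (v - x)) *\<^sub>R (v - x))"
          by (rule norm_cauchy_schwarz)
        also have "\<dots> = norm a * s" using that by simp
        also have "\<dots> \<le> norm a * k" using that by (simp add: mult_left_mono)
        also have "\<dots> = b - a \<bullet> x" using ab by (simp add: k_def)
        finally show ?thesis using ab by (simp add: inner_add_right)
      qed
      then show ?thesis using k by blast
    qed
  qed
  then obtain k where k: "\<forall>h\<in>F. k h > 0 \<and> (\<forall>v\<in>h. \<forall>s. v \<noteq> x \<and> 0 \<le> s \<and> s \<le> k h \<longrightarrow> x + (s / norm (v - x)) *\<^sub>R (v - x) \<in> h)"
    using bchoice[of F "\<lambda>h k. k > 0 \<and> (\<forall>v\<in>h. \<forall>s. v \<noteq> x \<and> 0 \<le> s \<and> s \<le> k \<longrightarrow> x + (s / norm (v - x)) *\<^sub>R (v - x) \<in> h)"] by blast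
  define \<kappa> where "\<kappa> = Min (insert 1 (k ` F))"
  have fin: "finite (insert 1 (k ` F))" using F(1) by simp
  have pos: "\<kappa> > 0" unfolding \<kappa>_def using fin k by (subst Min_gr_iff) auto
  have le: "\<kappa> \<le> k h" if "h \<in> F" for h unfolding \<kappa>_def using fin that by (intro Min_le) auto
  have "x + (\<kappa> / norm (v - x)) *\<^sub>R (v - x) \<in> P" if "v \<in> P" "v \<noteq> x" for v
    unfolding F(2)
  proof
    fix h assume h: "h \<in> F"
    then have "v \<in> h" using that F(2) by blast
    then show "x + (\<kappa> / norm (v - x)) *\<^sub>R (v - x) \<in> h" using k h le[OF h] pos that(2) by simp
  qed
  then show thesis using that pos by blast
qed

lemma dist_cbox_le:
  fixes x v :: "'v::euclidean_space" and r :: real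
  assumes "v \<in> cbox (x - r *\<^sub>R One) (x + r *\<^sub>R One)"
  shows "dist v x \<le> DIM('v) * r"
proof -
  have "norm (v - x) \<le> (\<Sum>i\<in>Basis. \<bar>(v - x) \<bullet> i\<bar>)" by (rule norm_le_l1)
  also have "\<dots> \<le> (\<Sum>i\<in>(Basis::'v set). r)"
  proof (rule sum_mono)
    fix i :: 'v assume i: "i \<in> Basis"
    then have "x \<bullet> i - r \<le> v \<bullet> i" "v \<bullet> i \<le> x \<bullet> i + r"
      using assms by (auto simp: mem_box inner_diff_left inner_add_left)
    then show "\<bar>(v - x) \<bullet> i\<bar> \<le> r" by (simp add: inner_diff_left abs_le_iff)
  qed
  also have "\<dots> = DIM('v) * r" by simp
  finally show ?thesis by (simp add: dist_norm)
qed

section \<open>Concavity on small polytopes inside a maximal cell\<close>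

context balanced_space
begin

definition pt :: "'x set \<Rightarrow> 'v \<Rightarrow> 'x" where "pt \<sigma> = inv_into \<sigma> \<iota>"

lemma pt_simps:
  assumes "\<sigma> \<in> Qb"
  shows "\<And>v. v \<in> \<iota> ` \<sigma> \<Longrightarrow> pt \<sigma> v \<in> \<sigma>" "\<And>v. v \<in> \<iota> ` \<sigma> \<Longrightarrow> \<iota> (pt \<sigma> v) = v" "\<And>z. z \<in> \<sigma> \<Longrightarrow> pt \<sigma> (\<iota> z) = z"
  unfolding pt_def using cell_inj[OF Qb assms] by (auto simp: inv_into_into f_inv_into_f inv_into_f_f)

text \<open>A full-dimensional piece of the cell so small that the stars used at its points stay in
  U; the two bounds by \<epsilon> are the distance hypotheses of
  \<open>weakly_concave_interior\<close>. It is a polytope so that lower bounds extend from finitely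
  many vertices.\<close>

definition patch :: "'x set \<Rightarrow> 'v set \<Rightarrow> bool" where
  "patch \<sigma> P \<longleftrightarrow> polytope P \<and> P \<subseteq> \<iota> ` \<sigma> \<and> dirs P = dirs (\<iota> ` \<sigma>) \<and> rel_interior P \<subseteq> rel_interior (\<iota> ` \<sigma>) \<and>
     (\<exists>\<epsilon>::real. \<epsilon> > 0 \<and> (\<forall>v\<in>P. (\<forall>u\<in>P. dist u v \<le> \<epsilon>) \<and> (\<forall>z\<in>\<sigma>. dist (\<iota> z) v \<le> DIM('v) * \<epsilon> \<longrightarrow> z \<in> U)))"

lemma patch_exists:
  assumes sig: "\<sigma> \<in> Qb" "x \<in> \<sigma>" and x: "x \<in> U"
  obtains P \<kappa> where "patch \<sigma> P" "\<iota> x \<in> P" "\<kappa> > 0" "\<And>v. v \<in> \<iota> ` \<sigma> \<Longrightarrow> dist v (\<iota> x) \<le> \<kappa> \<Longrightarrow> v \<in> P"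
    "\<iota> x \<in> rel_interior (\<iota> ` \<sigma>) \<Longrightarrow> \<iota> x \<in> rel_interior P"
proof -
  obtain \<delta> where \<delta>: "\<delta> > 0" "\<And>z. z \<in> \<sigma> \<Longrightarrow> dist (\<iota> z) (\<iota> x) \<le> \<delta> \<Longrightarrow> z \<in> U"
    by (rule cell_near[OF Qb sig U x], rule that; assumption)
  let ?N = "real DIM('v)"
  have N: "?N \<ge> 1" by (simp add: DIM_positive Suc_leI)
  \<comment> \<open>A cube of half side r has radius at most N r, so two of its points are at most 2
    N r apart. Taking this as \<epsilon>, the star around any of them stays within N r + N (2 N r)
    \<le> 3 N N r = \<delta> of x.\<close>
  define r where "r = \<delta> / (3 * ?N * ?N)"
  have r: "r > 0" using \<delta>(1) N by (simp add: r_def)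
  let ?l = "\<iota> x - r *\<^sub>R One" and ?u = "\<iota> x + r *\<^sub>R One"
  define P where "P = \<iota> ` \<sigma> \<inter> cbox ?l ?u"
  have c: "convex (\<iota> ` \<sigma>)" using cell_convex[OF Qb sig(1)] .
  have xbox: "\<iota> x \<in> box ?l ?u" using r by (simp add: mem_box inner_diff_left inner_add_left)
  have poly: "polytope P" unfolding P_def
    by (rule polyhedron_Int_polytope[OF cell_polyhedron[OF Qb sig(1)] polytope_interval])
  have ne: "rel_interior (\<iota> ` \<sigma>) \<inter> box ?l ?u \<noteq> {}"
  proof -
    have "\<iota> x \<in> closure (rel_interior (\<iota> ` \<sigma>))"
      using sig(2) convex_closure_rel_interior[OF c] closure_subset[of "\<iota> ` \<sigma>"] by blast
    then show ?thesis using xbox open_Int_closure_eq_empty[OF open_box[of ?l ?u], of "rel_interior (\<iota> ` \<sigma>)"]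
      by (auto simp: Int_commute)
  qed
  have ib: "rel_interior (cbox ?l ?u) = box ?l ?u"
    using rel_interior_nonempty_interior[of "cbox ?l ?u"] xbox by (auto simp: interior_cbox)
  have ri: "rel_interior P = rel_interior (\<iota> ` \<sigma>) \<inter> box ?l ?u"
    unfolding P_def using convex_rel_interior_inter_two[OF c convex_box(1)[of ?l ?u]] ne ib by simp
  have xP: "\<iota> x \<in> P" using sig(2) xbox box_subset_cbox[of ?l ?u] by (auto simp: P_def)
  have "aff_dim P = aff_dim (\<iota> ` \<sigma>)" unfolding P_def
    by (rule aff_dim_convex_Int_nonempty_interior[OF c]) (use xbox sig(2) in \<open>auto simp: interior_cbox\<close>)
  then have dP: "dirs P = dirs (\<iota> ` \<sigma>)" using xP by (intro dirs_subset_eq) (auto simp: P_def)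
  have rN: "?N * r + ?N * (2 * ?N * r) \<le> \<delta>"
  proof -
    have "?N * r \<le> ?N * ?N * r" using N r by simp
    then have "?N * r + ?N * (2 * ?N * r) \<le> 3 * ?N * ?N * r" by (simp add: algebra_simps)
    also have "\<dots> = \<delta>" using N by (simp add: r_def)
    finally show ?thesis .
  qed
  have dist: "dist v (\<iota> x) \<le> ?N * r" if "v \<in> P" for v using that unfolding P_def by (intro dist_cbox_le) auto
  have big: "(\<forall>u\<in>P. dist u v \<le> 2 * ?N * r) \<and> (\<forall>z\<in>\<sigma>. dist (\<iota> z) v \<le> ?N * (2 * ?N * r) \<longrightarrow> z \<in> U)" if v: "v \<in> P" for v
  proof (intro conjI ballI impI)
    show "dist u v \<le> 2 * ?N * r" if "u \<in> P" for u
      using dist[OF that] dist[OF v] dist_triangle2[of u v "\<iota> x"] by (simp add: dist_commute)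
    show "z \<in> U" if "z \<in> \<sigma>" "dist (\<iota> z) v \<le> ?N * (2 * ?N * r)" for z
      using \<delta>(2)[OF that(1)] dist_triangle[of "\<iota> z" "\<iota> x" v] that(2) dist[OF v] rN by linarith
  qed
  have "2 * ?N * r > 0" using N r by simp
  then have "patch \<sigma> P" unfolding patch_def using poly dP ri big by (intro conjI exI[of _ "2 * ?N * r"]) (auto simp: P_def)
  moreover have "v \<in> P" if "v \<in> \<iota> ` \<sigma>" "dist v (\<iota> x) \<le> r" for v
  proof -
    have "v \<in> cbox ?l ?u"
      unfolding mem_box
    proof
      fix i :: 'v assume i: "i \<in> Basis"
      have "\<bar>(v - \<iota> x) \<bullet> i\<bar> \<le> r" using Basis_le_norm[OF i, of "v - \<iota> x"] that(2) by (simp add: dist_norm)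
      then show "?l \<bullet> i \<le> v \<bullet> i \<and> v \<bullet> i \<le> ?u \<bullet> i" using i by (simp add: inner_diff_left inner_add_left abs_le_iff)
    qed
    then show ?thesis using that by (simp add: P_def)
  qed
  moreover have "\<iota> x \<in> rel_interior P" if "\<iota> x \<in> rel_interior (\<iota> ` \<sigma>)" using that ri xbox by simp
  ultimately show thesis using that r xP by blast
qed

lemma patchD:
  assumes "patch \<sigma> P"
  shows "polytope P" "P \<subseteq> \<iota> ` \<sigma>" "dirs P = dirs (\<iota> ` \<sigma>)" "rel_interior P \<subseteq> rel_interior (\<iota> ` \<sigma>)" "convex P"
  using assms polytope_imp_convex unfolding patch_def by blast+

lemma patch_U: assumes "patch \<sigma> P" "z \<in> \<sigma>" "\<iota> z \<in> P" shows "z \<in> U"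
proof -
  obtain \<epsilon> :: real where "\<epsilon> > 0" "\<forall>v\<in>P. \<forall>z\<in>\<sigma>. dist (\<iota> z) v \<le> DIM('v) * \<epsilon> \<longrightarrow> z \<in> U"
    using assms(1) unfolding patch_def by blast
  moreover from this(1) have "dist (\<iota> z) (\<iota> z) \<le> DIM('v) * \<epsilon>" by simp
  ultimately show ?thesis using assms by blast
qed

lemma patch_concave_interior:
  assumes f: "wc f" and sig: "\<sigma> \<in> Qb" "pdim \<iota> \<sigma> = n" and P: "patch \<sigma> P"
    and uv: "u \<in> P" "v \<in> P" "0 \<le> t" "t \<le> 1" "(1 - t) *\<^sub>R u + t *\<^sub>R v \<in> rel_interior P"
  shows "f (pt \<sigma> ((1 - t) *\<^sub>R u + t *\<^sub>R v)) \<ge> (1 - t) * f (pt \<sigma> u) + t * f (pt \<sigma> v)"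
proof (cases "t = 0 \<or> t = 1")
  case True then show ?thesis by auto
next
  case False
  note Pd = patchD[OF P]
  let ?m = "(1 - t) *\<^sub>R u + t *\<^sub>R v"
  obtain \<epsilon> :: real where \<epsilon>: "\<epsilon> > 0" "\<forall>v\<in>P. (\<forall>u\<in>P. dist u v \<le> \<epsilon>) \<and> (\<forall>z\<in>\<sigma>. dist (\<iota> z) v \<le> DIM('v) * \<epsilon> \<longrightarrow> z \<in> U)"
    using P unfolding patch_def by blast
  have mP: "?m \<in> P" using uv(5) rel_interior_subset by blast
  have S: "?m \<in> \<iota> ` \<sigma>" "u \<in> \<iota> ` \<sigma>" "v \<in> \<iota> ` \<sigma>" using mP uv Pd(2) by blast+
  note A = pt_simps(1,2)[OF sig(1) S(1)] pt_simps(1,2)[OF sig(1) S(2)] pt_simps(1,2)[OF sig(1) S(3)]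
  show ?thesis
  proof (rule weakly_concave_interior[OF f sig A(1) _ _ A(3,5) _ _ _ \<epsilon>(1)])
    show "pt \<sigma> ?m \<in> U" using patch_U[OF P A(1)] A(2) mP by simp
    show "\<iota> (pt \<sigma> ?m) \<in> rel_interior (\<iota> ` \<sigma>)" using A(2) uv(5) Pd(4) by auto
    show "\<iota> (pt \<sigma> ?m) = (1 - t) *\<^sub>R \<iota> (pt \<sigma> u) + t *\<^sub>R \<iota> (pt \<sigma> v)" using A by simp
    show "0 < t" "t < 1" using False uv by auto
    show "dist (\<iota> (pt \<sigma> u)) (\<iota> (pt \<sigma> ?m)) \<le> \<epsilon>" "dist (\<iota> (pt \<sigma> v)) (\<iota> (pt \<sigma> ?m)) \<le> \<epsilon>" using A \<epsilon>(2) mP uv by auto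
    show "y \<in> U" if "y \<in> \<sigma>" "dist (\<iota> y) (\<iota> (pt \<sigma> ?m)) \<le> DIM('v) * \<epsilon>" for y using A(2) \<epsilon>(2) mP that by auto
  qed
qed

text \<open>Push u, v and their combination m towards p by a fraction s. Concavity at relatively
  interior points bounds the pushed values at u and v from below by the chords to p, while
  \<open>weakly_concave_ray\<close> bounds the pushed value at m from above by the value at m plus
  O(s). Then s tends to 0.\<close>

lemma patch_concave:
  assumes f: "wc f" and sig: "\<sigma> \<in> Qb" "pdim \<iota> \<sigma> = n" and P: "patch \<sigma> P"
    and uv: "u \<in> P" "v \<in> P" "0 \<le> t" "t \<le> 1"
  shows "f (pt \<sigma> ((1 - t) *\<^sub>R u + t *\<^sub>R v)) \<ge> (1 - t) * f (pt \<sigma> u) + t * f (pt \<sigma> v)"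
proof -
  note Pd = patchD[OF P]
  let ?m = "(1 - t) *\<^sub>R u + t *\<^sub>R v" and ?\<phi> = "\<lambda>v. f (pt \<sigma> v)"
  have mP: "?m \<in> P" using Pd(5) uv by (intro convexD) auto
  have "rel_interior P \<noteq> {}" using rel_interior_eq_empty[OF Pd(5)] uv by blast
  then obtain p where p: "p \<in> rel_interior P" by blast
  then have pP: "p \<in> P" using rel_interior_subset by blast
  show ?thesis
  proof (cases "?m \<in> rel_interior P")
    case True then show ?thesis using patch_concave_interior[OF f sig P uv] by blast
  next
    case False
    have mp: "p \<noteq> ?m" using False p by blast
    have S: "?m \<in> \<iota> ` \<sigma>" "p \<in> \<iota> ` \<sigma>" using mP pP Pd(2) by blast+
    note A = pt_simps(1,2)[OF sig(1) S(1)] pt_simps(1,2)[OF sig(1) S(2)]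
    have mU: "pt \<sigma> ?m \<in> U" using patch_U[OF P A(1)] A(2) mP by simp
    have pri: "\<iota> (pt \<sigma> p) \<in> rel_interior (\<iota> ` \<sigma>)" using A(4) p Pd(4) by auto
    have pne: "\<iota> (pt \<sigma> p) \<noteq> \<iota> (pt \<sigma> ?m)" using A mp by simp
    obtain T R \<omega> y where R: "T > 0"
      "\<And>f t q. wc f \<Longrightarrow> 0 < t \<Longrightarrow> t \<le> T \<Longrightarrow> q \<in> \<sigma> \<Longrightarrow> \<iota> q = \<iota> (pt \<sigma> ?m) + t *\<^sub>R (\<iota> (pt \<sigma> p) - \<iota> (pt \<sigma> ?m)) \<Longrightarrow>
         f q \<le> f (pt \<sigma> ?m) + t * (\<Sum>\<rho>\<in>(R::'x set set). \<omega> \<rho> * (f (pt \<sigma> ?m) - f (y \<rho>)))"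
      by (rule weakly_concave_ray[OF sig A(1) mU pri pne], rule that; assumption)
    let ?K = "\<Sum>\<rho>\<in>R. \<omega> \<rho> * (f (pt \<sigma> ?m) - f (y \<rho>))" and ?A = "(1 - t) * ?\<phi> u + t * ?\<phi> v"
    have seg: "(1 - s) *\<^sub>R b + s *\<^sub>R p \<in> rel_interior P" if "b \<in> P" "0 < s" "s \<le> 1" for b s
    proof -
      have "b - s *\<^sub>R (b - p) \<in> rel_interior P" by (rule rel_interior_convex_shrink[OF Pd(5) p that])
      then show ?thesis by (simp add: algebra_simps)
    qed
    have main: "s * (?\<phi> p - ?A - ?K) \<le> ?\<phi> ?m - ?A" if s: "0 < s" "s \<le> min 1 T" for s
    proof -
      let ?us = "(1 - s) *\<^sub>R u + s *\<^sub>R p" and ?vs = "(1 - s) *\<^sub>R v + s *\<^sub>R p" and ?ms = "(1 - s) *\<^sub>R ?m + s *\<^sub>R p"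
      have s1: "s \<le> 1" "0 \<le> s" using s by auto
      have us: "?us \<in> rel_interior P" and vs: "?vs \<in> rel_interior P" and ms: "?ms \<in> rel_interior P"
        using seg[OF uv(1) s(1) s1(1)] seg[OF uv(2) s(1) s1(1)] seg[OF mP s(1) s1(1)] by simp_all
      have usP: "?us \<in> P" "?vs \<in> P" "?ms \<in> P" using us vs ms rel_interior_subset by blast+
      have e: "?ms = (1 - t) *\<^sub>R ?us + t *\<^sub>R ?vs" by (simp add: algebra_simps)
      have "?\<phi> ?ms \<ge> (1 - t) * ?\<phi> ?us + t * ?\<phi> ?vs"
        using patch_concave_interior[OF f sig P usP(1,2) uv(3,4)] e ms by metis
      moreover have "?\<phi> ?us \<ge> (1 - s) * ?\<phi> u + s * ?\<phi> p" using patch_concave_interior[OF f sig P uv(1) pP s1(2,1) us] .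
      then have "(1 - t) * ?\<phi> ?us \<ge> (1 - t) * ((1 - s) * ?\<phi> u + s * ?\<phi> p)" using uv(4) by (intro mult_left_mono) auto
      moreover have "?\<phi> ?vs \<ge> (1 - s) * ?\<phi> v + s * ?\<phi> p" using patch_concave_interior[OF f sig P uv(2) pP s1(2,1) vs] .
      then have "t * ?\<phi> ?vs \<ge> t * ((1 - s) * ?\<phi> v + s * ?\<phi> p)" using uv(3) by (intro mult_left_mono) auto
      moreover have "?\<phi> ?ms \<le> ?\<phi> ?m + s * ?K"
      proof (rule R(2)[OF f s(1)])
        have "?ms \<in> \<iota> ` \<sigma>" using usP(3) Pd(2) by blast
        note B = pt_simps(1,2)[OF sig(1) this]
        show "pt \<sigma> ?ms \<in> \<sigma>" by (rule B)
        show "\<iota> (pt \<sigma> ?ms) = \<iota> (pt \<sigma> ?m) + s *\<^sub>R (\<iota> (pt \<sigma> p) - \<iota> (pt \<sigma> ?m))"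
          unfolding A B by (simp add: algebra_simps)
      qed (use s in simp)
      ultimately have "?\<phi> ?m + s * ?K \<ge> (1 - t) * ((1 - s) * ?\<phi> u + s * ?\<phi> p) + t * ((1 - s) * ?\<phi> v + s * ?\<phi> p)" by linarith
      also have "(1 - t) * ((1 - s) * ?\<phi> u + s * ?\<phi> p) + t * ((1 - s) * ?\<phi> v + s * ?\<phi> p) = ?A + s * (?\<phi> p - ?A)"
        by (simp add: algebra_simps)
      finally show ?thesis by (simp add: right_diff_distrib)
    qed
    have "0 \<le> ?\<phi> ?m - ?A" by (rule nonneg_if_linear_le[of "min 1 T", OF _ main]) (use R(1) in auto)
    then show ?thesis by simp
  qed
qed

end

section \<open>Equicontinuity and convergence\<close>

text \<open>The equicontinuity neighbourhoods serve twice: each meets C, which gives the Cauchy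
  property at its centre, and finitely many of them cover K.\<close>

lemma equicontinuous_convergence:
  fixes f :: "nat \<Rightarrow> 'x::topological_space \<Rightarrow> real"
  assumes eq: "\<And>x e. x \<in> U \<Longrightarrow> e > 0 \<Longrightarrow> \<exists>W. open W \<and> x \<in> W \<and> (\<forall>z\<in>W \<inter> U. \<forall>i. \<bar>f i z - f i x\<bar> \<le> e)"
    and U: "open U" and C: "C \<subseteq> U" "U \<subseteq> closure C" "\<And>x. x \<in> C \<Longrightarrow> convergent (\<lambda>i. f i x)"
  obtains F where "\<And>x. x \<in> U \<Longrightarrow> (\<lambda>i. f i x) \<longlonglongrightarrow> F x"
    "\<And>K. compact K \<Longrightarrow> K \<subseteq> U \<Longrightarrow> uniform_limit K f F sequentially"
proof -
  have "convergent (\<lambda>i. f i x)" if x: "x \<in> U" for x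
  proof -
    have "Cauchy (\<lambda>i. f i x)"
    proof (rule metric_CauchyI)
      fix e :: real assume e: "e > 0"
      obtain W where W: "open W" "x \<in> W" "\<forall>z\<in>W \<inter> U. \<forall>i. \<bar>f i z - f i x\<bar> \<le> e / 4" using eq[OF x, of "e / 4"] e by auto
      have "x \<in> closure C" using x C(2) by blast
      then have "C \<inter> (W \<inter> U) \<noteq> {}"
        using open_Int_closure_eq_empty[of "W \<inter> U" C] W(1,2) U x by blast
      then obtain z where z: "z \<in> C" "z \<in> W \<inter> U" by blast
      have "Cauchy (\<lambda>i. f i z)" using C(3)[OF z(1)] by (rule convergent_Cauchy)
      then obtain M where M: "\<And>m n. m \<ge> M \<Longrightarrow> n \<ge> M \<Longrightarrow> dist (f m z) (f n z) < e / 4"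
        using metric_CauchyD[of "\<lambda>i. f i z" "e / 4"] e by auto
      have "dist (f m x) (f n x) < e" if "m \<ge> M" "n \<ge> M" for m n
      proof -
        have "\<bar>f m z - f m x\<bar> \<le> e / 4" "\<bar>f n z - f n x\<bar> \<le> e / 4" using W(3) z(2) by blast+
        then show ?thesis using M[OF that] e unfolding dist_real_def by linarith
      qed
      then show "\<exists>M. \<forall>m\<ge>M. \<forall>n\<ge>M. dist (f m x) (f n x) < e" by blast
    qed
    then show ?thesis by (simp add: Cauchy_convergent_iff)
  qed
  then have lim: "(\<lambda>i. f i x) \<longlonglongrightarrow> lim (\<lambda>i. f i x)" if "x \<in> U" for x using that by (simp add: convergent_LIMSEQ_iff)
  define F where "F x = lim (\<lambda>i. f i x)" for x
  have "uniform_limit K f F sequentially" if K: "compact K" "K \<subseteq> U" for K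
  proof (rule uniform_limitI)
    fix e :: real assume e: "e > 0"
    have "\<forall>x\<in>K. \<exists>W. open W \<and> x \<in> W \<and> (\<forall>z\<in>W \<inter> U. \<forall>i. \<bar>f i z - f i x\<bar> \<le> e / 4)"
    proof
      fix x assume "x \<in> K"
      then have "x \<in> U" using K(2) by blast
      then show "\<exists>W. open W \<and> x \<in> W \<and> (\<forall>z\<in>W \<inter> U. \<forall>i. \<bar>f i z - f i x\<bar> \<le> e / 4)"
        using eq[of x "e / 4"] e by simp
    qed
    then obtain W where W: "\<And>x. x \<in> K \<Longrightarrow> open (W x) \<and> x \<in> W x \<and> (\<forall>z\<in>W x \<inter> U. \<forall>i. \<bar>f i z - f i x\<bar> \<le> e / 4)"
      by metis
    obtain D where D: "D \<subseteq> K" "finite D" "K \<subseteq> (\<Union>x\<in>D. W x)"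
      by (rule compactE_image[OF K(1), of K W]) (use W in auto)
    have "\<forall>\<^sub>F i in sequentially. \<forall>x\<in>D. dist (f i x) (F x) < e / 4"
      using D K(2) e lim unfolding F_def by (intro eventually_ball_finite ballI tendstoD) auto
    then show "\<forall>\<^sub>F i in sequentially. \<forall>x\<in>K. dist (f i x) (F x) < e"
    proof eventually_elim
      case (elim i)
      show ?case
      proof
        fix z assume z: "z \<in> K"
        then obtain x where x: "x \<in> D" "z \<in> W x" using D(3) by blast
        have xK: "x \<in> K" using x D by blast
        have le: "\<bar>f j z - f j x\<bar> \<le> e / 4" for j using W[OF xK] x(2) z K(2) by blast
        have "(\<lambda>j. \<bar>f j z - f j x\<bar>) \<longlonglongrightarrow> \<bar>F z - F x\<bar>"
          using lim z xK K(2) unfolding F_def by (intro tendsto_rabs tendsto_diff) auto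
        then have "\<bar>F z - F x\<bar> \<le> e / 4" using le by (intro LIMSEQ_le_const2) auto
        moreover have "dist (f i x) (F x) < e / 4" using elim x by blast
        ultimately show "dist (f i z) (F z) < e" using le[of i] e unfolding dist_real_def by linarith
      qed
    qed
  qed
  then show thesis using that[of F] lim by (simp add: F_def)
qed

section \<open>Bounds and equicontinuity of the given sequence\<close>

locale convergent_family = balanced_space +
  fixes f :: "nat \<Rightarrow> 'a \<Rightarrow> real" and C :: "'a set"
  assumes wcf: "\<And>i. wc (f i)" and cover: "\<And>z. \<exists>\<sigma>\<in>Qb. z \<in> \<sigma> \<and> pdim \<iota> \<sigma> = n"
    and C: "C \<subseteq> U" "U \<subseteq> closure C" "\<And>z. z \<in> C \<Longrightarrow> convergent (\<lambda>i. f i z)"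
begin

text \<open>The two bounds are kept apart because upper bounds are deduced from lower bounds at
  other points.\<close>

definition bdd_lo :: "'a \<Rightarrow> bool" where "bdd_lo z \<longleftrightarrow> (\<exists>M. \<forall>i. f i z \<ge> M)"

definition bdd_up :: "'a \<Rightarrow> bool" where "bdd_up z \<longleftrightarrow> (\<exists>M. \<forall>i. f i z \<le> M)"

lemma C_bdd: assumes "z \<in> C" shows "bdd_lo z" "bdd_up z"
proof -
  have "Bseq (\<lambda>i. f i z)" using C(3)[OF assms] by (rule convergent_imp_Bseq)
  then obtain K where "\<And>i. \<bar>f i z\<bar> \<le> K" unfolding Bseq_def by auto
  then have "\<forall>i. f i z \<ge> - K" "\<forall>i. f i z \<le> K" by (auto simp: abs_le_iff minus_le_iff)
  then show "bdd_lo z" "bdd_up z" unfolding bdd_lo_def bdd_up_def by blast+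
qed

text \<open>Every point lies in an n-cell, and \<sigma> is the only cell at y, so a neighbourhood of
  y contains points of \<sigma> only.\<close>

lemma interior_open:
  assumes "\<sigma> \<in> Qb" "pdim \<iota> \<sigma> = n" "y \<in> \<sigma>" "\<iota> y \<in> rel_interior (\<iota> ` \<sigma>)"
  obtains N where "open N" "y \<in> N" "N \<subseteq> \<sigma>"
proof -
  obtain N where N: "open N" "y \<in> N" "\<And>\<sigma>. \<sigma> \<in> Qb \<Longrightarrow> \<sigma> \<inter> N \<noteq> {} \<Longrightarrow> y \<in> \<sigma>"
    by (rule star_nbhd[OF Qb], rule that; assumption)
  have "z \<in> \<sigma>" if z: "z \<in> N" for z
  proof -
    obtain \<rho> where r: "\<rho> \<in> Qb" "z \<in> \<rho>" using cover by blast
    then have "y \<in> \<rho>" using N(3)[OF r(1)] z by blast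
    then show ?thesis using maximal_cell_unique[OF assms r(1)] r(2) by simp
  qed
  then show thesis using that N by blast
qed

text \<open>A point over the relative interior of a maximal cell has a neighbourhood in X inside the
  cell, so the density of C in U passes to the patch.\<close>

lemma patch_dense:
  assumes sig: "\<sigma> \<in> Qb" "pdim \<iota> \<sigma> = n" and P: "patch \<sigma> P" and v: "v \<in> rel_interior P" and e: "e > 0"
  obtains z where "z \<in> C" "z \<in> \<sigma>" "\<iota> z \<in> rel_interior P" "dist (\<iota> z) v < e"
proof -
  note Pd = patchD[OF P]
  have vP: "v \<in> P" using v rel_interior_subset by blast
  have vS: "v \<in> \<iota> ` \<sigma>" using vP Pd(2) by blast
  note A = pt_simps(1,2)[OF sig(1) vS]
  have yU: "pt \<sigma> v \<in> U" using patch_U[OF P A(1)] A(2) vP by simp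
  have yri: "\<iota> (pt \<sigma> v) \<in> rel_interior (\<iota> ` \<sigma>)" using A(2) v Pd(4) by auto
  obtain N where N: "open N" "pt \<sigma> v \<in> N" "N \<subseteq> \<sigma>" by (rule interior_open[OF sig A(1) yri], rule that; assumption)
  have "openin (top_of_set (affine hull P)) (rel_interior P)" by (rule openin_rel_interior)
  then obtain e' where e': "e' > 0" "\<And>u. u \<in> affine hull P \<Longrightarrow> dist u v < e' \<Longrightarrow> u \<in> rel_interior P"
    using v unfolding openin_euclidean_subtopology_iff by blast
  let ?W = "N \<inter> U \<inter> \<iota> -` ball v (min e e')"
  have "open (\<iota> -` ball v (min e e'))" using iota_continuous[OF Qb] by (intro open_vimage) auto
  then have oW: "open ?W" using N(1) U by (intro open_Int) auto
  have yW: "pt \<sigma> v \<in> ?W" using N(2) yU A(2) e e'(1) by simp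
  have "pt \<sigma> v \<in> closure C" using yU C(2) by blast
  then have "?W \<inter> C \<noteq> {}" using open_Int_closure_eq_empty[OF oW, of C] yW by blast
  then obtain z where z: "z \<in> C" "z \<in> N" "dist (\<iota> z) v < e" "dist (\<iota> z) v < e'" by (auto simp: dist_commute)
  have zs: "z \<in> \<sigma>" using z N by blast
  have "\<iota> z - v \<in> dirs P" unfolding Pd(3) using zs vS by (intro diff_in_dirs imageI)
  then have "\<iota> z \<in> affine hull P" using affine_hull_dirs[OF vP] by simp
  then have "\<iota> z \<in> rel_interior P" using e'(2) z(4) by blast
  then show thesis using that z zs by blast
qed

text \<open>By concavity the points at which the sequence is bounded below form a convex set; it is dense.\<close>

lemma bdd_lo_interior:
  assumes sig: "\<sigma> \<in> Qb" "pdim \<iota> \<sigma> = n" and z: "z \<in> \<sigma>" "\<iota> z \<in> rel_interior (\<iota> ` \<sigma>)" "z \<in> U"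
  shows "bdd_lo z"
proof -
  obtain P where P: "patch \<sigma> P" "\<iota> z \<in> rel_interior P"
    by (rule patch_exists[OF sig(1) z(1,3)], rule that) (use z(2) in auto)
  note Pd = patchD[OF P(1)]
  let ?S = "{v \<in> rel_interior P. bdd_lo (pt \<sigma> v)}" and ?D = "{v \<in> rel_interior P. pt \<sigma> v \<in> C}"
  have riP: "rel_interior P \<subseteq> P" by (rule rel_interior_subset)
  have cri: "convex (rel_interior P)" using convex_rel_interior[OF Pd(5)] .
  have cS: "convex ?S"
    unfolding convex_alt
  proof (intro ballI allI impI)
    fix u v and t :: real assume uv: "u \<in> ?S" "v \<in> ?S" and t: "0 \<le> t \<and> t \<le> 1"
    have m: "(1 - t) *\<^sub>R u + t *\<^sub>R v \<in> rel_interior P" using cri uv t by (intro convexD) auto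
    have P': "u \<in> P" "v \<in> P" using uv riP by blast+
    obtain M1 M2 where M: "\<And>i. f i (pt \<sigma> u) \<ge> M1" "\<And>i. f i (pt \<sigma> v) \<ge> M2" using uv unfolding bdd_lo_def by blast
    have "f i (pt \<sigma> ((1 - t) *\<^sub>R u + t *\<^sub>R v)) \<ge> (1 - t) * M1 + t * M2" for i
    proof -
      have "(1 - t) * M1 \<le> (1 - t) * f i (pt \<sigma> u)" "t * M2 \<le> t * f i (pt \<sigma> v)" using M t by (auto intro: mult_left_mono)
      then show ?thesis using patch_concave_interior[OF wcf sig P(1) P' _ _ m, of i] t by linarith
    qed
    then show "(1 - t) *\<^sub>R u + t *\<^sub>R v \<in> ?S" using m unfolding bdd_lo_def by blast
  qed
  have DS: "?D \<subseteq> ?S" using C_bdd by blast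
  have "rel_interior P \<subseteq> closure ?D"
  proof
    fix v assume v: "v \<in> rel_interior P"
    show "v \<in> closure ?D"
      unfolding closure_approachable
    proof (intro allI impI)
      fix e :: real assume e: "e > 0"
      obtain y where y: "y \<in> C" "y \<in> \<sigma>" "\<iota> y \<in> rel_interior P" "dist (\<iota> y) v < e"
        by (rule patch_dense[OF sig P(1) v e], rule that; assumption)
      then show "\<exists>u\<in>?D. dist u v < e" using pt_simps(3)[OF sig(1) y(2)] by (intro bexI[of _ "\<iota> y"]) auto
    qed
  qed
  also have "closure ?D \<subseteq> closure (convex hull ?D)" by (intro closure_mono hull_subset)
  finally have sub: "rel_interior P \<subseteq> closure (convex hull ?D)" .
  \<comment> \<open>The convex hull of the dense set has closure P, hence the relative interior of
    P, and so it contains that relative interior without taking closures.\<close>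
  have "closure (rel_interior P) \<subseteq> closure (convex hull ?D)" using closure_mono[OF sub] by simp
  then have "P \<subseteq> closure (convex hull ?D)" using convex_closure_rel_interior[OF Pd(5)] closure_subset by blast
  moreover have "convex hull ?D \<subseteq> P" using riP Pd(5) by (intro hull_minimal) auto
  then have "closure (convex hull ?D) \<subseteq> P" using polytope_imp_compact[OF Pd(1)] by (simp add: closure_minimal compact_imp_closed)
  ultimately have "closure (convex hull ?D) = P" by blast
  then have "rel_interior P = rel_interior (convex hull ?D)"
    using convex_rel_interior_closure[OF convex_convex_hull, of ?D] by simp
  also have "\<dots> \<subseteq> convex hull ?D" by (rule rel_interior_subset)
  also have "\<dots> \<subseteq> ?S" using DS cS by (rule hull_minimal)
  finally have "\<iota> z \<in> ?S" using P(2) by blast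
  then show ?thesis using pt_simps(3)[OF sig(1) z(1)] by simp
qed

text \<open>Solved for f(x), \<open>weakly_concave_ray\<close> reads (1 + t \<Sum> \<omega>) f(x)
  \<ge> f(q) + t \<Sum> \<omega> f(y). The point q is covered by \<open>bdd_lo_interior\<close>, and
  each y with nonzero coefficient by induction on the codimension of the stratum.\<close>

lemma bdd_lo_U: assumes "x \<in> U" shows "bdd_lo x"
proof -
  have "bdd_lo x" if "x \<in> U" "\<tau> \<in> Qb" "x \<in> \<tau>" "\<iota> x \<in> rel_interior (\<iota> ` \<tau>)" for x \<tau>
    using that
  proof (induction "nat (n - pdim \<iota> \<tau>)" arbitrary: x \<tau> rule: less_induct)
    case less
    obtain \<sigma> where s: "\<sigma> \<in> Qb" "x \<in> \<sigma>" "pdim \<iota> \<sigma> = n" using cover by blast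
    show ?case
    proof (cases "\<tau> = \<sigma>")
      case True
      then show ?thesis using bdd_lo_interior s less by blast
    next
      case False
      have ne: "\<sigma> \<noteq> {}" using s by blast
      obtain p where p: "p \<in> \<sigma>" "\<iota> p \<in> rel_interior (\<iota> ` \<sigma>)" by (rule rel_interior_cell[OF Qb s(1) ne], rule that; assumption)
      have px: "\<iota> p \<noteq> \<iota> x"
      proof
        assume "\<iota> p = \<iota> x"
        then have "p = x" by (rule inj_onD[OF cell_inj[OF Qb s(1)] _ p(1) s(2)])
        then have "\<tau> = \<sigma>" using maximal_cell_unique[OF s(1,3) p less.prems(2)] less.prems(3) by simp
        then show False using False by simp
      qed
      obtain T R \<omega> y where R: "T > 0" "finite (R :: 'a set set)" "\<And>\<rho>. \<rho> \<in> R \<Longrightarrow> \<omega> \<rho> \<ge> 0 \<and> y \<rho> \<in> U"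
        "\<And>f t q. wc f \<Longrightarrow> 0 < t \<Longrightarrow> t \<le> T \<Longrightarrow> q \<in> \<sigma> \<Longrightarrow> \<iota> q = \<iota> x + t *\<^sub>R (\<iota> p - \<iota> x) \<Longrightarrow>
           f q \<le> f x + t * (\<Sum>\<rho>\<in>R. \<omega> \<rho> * (f x - f (y \<rho>)))"
        "\<And>\<rho> \<tau> \<kappa>. \<rho> \<in> R \<Longrightarrow> \<omega> \<rho> \<noteq> 0 \<Longrightarrow> \<tau> \<in> Qb \<Longrightarrow> x \<in> \<tau> \<Longrightarrow> \<iota> x \<in> rel_interior (\<iota> ` \<tau>) \<Longrightarrow> \<tau> \<noteq> \<sigma> \<Longrightarrow>
           \<kappa> \<in> Qb \<Longrightarrow> y \<rho> \<in> \<kappa> \<Longrightarrow> pdim \<iota> \<kappa> > pdim \<iota> \<tau>"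
        by (rule weakly_concave_ray[OF s(1,3,2) less.prems(1) p(2) px], rule that; assumption)
      have lo: "bdd_lo (y \<rho>)" if r: "\<rho> \<in> R" "\<omega> \<rho> \<noteq> 0" for \<rho>
      proof -
        obtain \<sigma>0 where "\<sigma>0 \<in> Qb" "y \<rho> \<in> \<sigma>0" using cover by blast
        then obtain \<kappa> where k: "\<kappa> \<in> Qb" "y \<rho> \<in> \<kappa>" "\<iota> (y \<rho>) \<in> rel_interior (\<iota> ` \<kappa>)" using mincell[OF Qb] by metis
        have "pdim \<iota> \<kappa> > pdim \<iota> \<tau>" by (rule R(5)[OF r less.prems(2-4) False k(1,2)])
        then have "nat (n - pdim \<iota> \<kappa>) < nat (n - pdim \<iota> \<tau>)" using dim_le[OF k(1)] by simp
        then show ?thesis using less.hyps R(3)[OF r(1)] k by blast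
      qed
      \<comment> \<open>The product is bounded instead of f itself: where \<omega> vanishes, the
        stratum of the test point is not controlled.\<close>
      have "\<forall>\<rho>\<in>R. \<exists>M. \<forall>i. \<omega> \<rho> * f i (y \<rho>) \<ge> \<omega> \<rho> * M"
      proof
        fix \<rho> assume r: "\<rho> \<in> R"
        show "\<exists>M. \<forall>i. \<omega> \<rho> * f i (y \<rho>) \<ge> \<omega> \<rho> * M"
        proof (cases "\<omega> \<rho> = 0")
          case False
          then obtain M where "\<forall>i. f i (y \<rho>) \<ge> M" using lo[OF r] unfolding bdd_lo_def by blast
          then show ?thesis using R(3)[OF r] by (meson mult_left_mono)
        qed simp
      qed
      then obtain M where M: "\<And>\<rho> i. \<rho> \<in> R \<Longrightarrow> \<omega> \<rho> * f i (y \<rho>) \<ge> \<omega> \<rho> * M \<rho>" by metis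
      have convs: "convex (\<iota> ` \<sigma>)" by (rule cell_convex[OF Qb s(1)])
      have ri: "\<iota> x + s *\<^sub>R (\<iota> p - \<iota> x) \<in> rel_interior (\<iota> ` \<sigma>)" if "0 < s" "s \<le> 1" for s
      proof -
        have "\<iota> x - s *\<^sub>R (\<iota> x - \<iota> p) \<in> rel_interior (\<iota> ` \<sigma>)"
          by (rule rel_interior_convex_shrink[OF convs p(2) _ that]) (use s in blast)
        then show ?thesis by (simp add: algebra_simps)
      qed
      obtain \<delta> where \<delta>: "\<delta> > 0" "\<And>z. z \<in> \<sigma> \<Longrightarrow> dist (\<iota> z) (\<iota> x) \<le> \<delta> \<Longrightarrow> z \<in> U"
        by (rule cell_near[OF Qb s(1,2) U less.prems(1)], rule that; assumption)
      \<comment> \<open>The three terms secure, in this order, the relative interior of \<sigma>,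
        the ray inequality, and membership in U.\<close>
      define t where "t = min (min 1 T) (\<delta> / dist (\<iota> p) (\<iota> x))"
      have D: "dist (\<iota> p) (\<iota> x) > 0" using px by simp
      have tD: "t \<le> \<delta> / dist (\<iota> p) (\<iota> x)" by (simp add: t_def)
      have t: "t > 0" "t \<le> T" "t \<le> 1" "t * dist (\<iota> p) (\<iota> x) \<le> \<delta>"
        using R(1) \<delta>(1) D tD[unfolded pos_le_divide_eq[OF D]] by (simp_all add: t_def)
      let ?v = "\<iota> x + t *\<^sub>R (\<iota> p - \<iota> x)"
      have vri: "?v \<in> rel_interior (\<iota> ` \<sigma>)" by (rule ri[OF t(1,3)])
      then have "?v \<in> \<iota> ` \<sigma>" using rel_interior_subset by blast
      note A = pt_simps(1,2)[OF s(1) this]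
      have "pt \<sigma> ?v \<in> U" using t(1,4) by (intro \<delta>(2)[OF A(1)]) (simp add: A(2) dist_norm)
      then have "bdd_lo (pt \<sigma> ?v)" using bdd_lo_interior[OF s(1,3) A(1)] A(2) vri by simp
      then obtain M0 where M0: "\<And>i. f i (pt \<sigma> ?v) \<ge> M0" unfolding bdd_lo_def by blast
      let ?W = "\<Sum>\<rho>\<in>R. \<omega> \<rho>"
      have W: "?W \<ge> 0" using R(3) by (intro sum_nonneg) blast
      then have W1: "1 + t * ?W > 0" using t(1) by (simp add: add_pos_nonneg)
      have "f i x \<ge> (M0 + t * (\<Sum>\<rho>\<in>R. \<omega> \<rho> * M \<rho>)) / (1 + t * ?W)" for i
      proof -
        have "f i (pt \<sigma> ?v) \<le> f i x + t * (\<Sum>\<rho>\<in>R. \<omega> \<rho> * (f i x - f i (y \<rho>)))"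
          by (rule R(4)[OF wcf t(1,2) A])
        also have "(\<Sum>\<rho>\<in>R. \<omega> \<rho> * (f i x - f i (y \<rho>))) = ?W * f i x - (\<Sum>\<rho>\<in>R. \<omega> \<rho> * f i (y \<rho>))"
          by (simp only: right_diff_distrib sum_subtractf sum_distrib_right)
        finally have "f i (pt \<sigma> ?v) + t * (\<Sum>\<rho>\<in>R. \<omega> \<rho> * f i (y \<rho>)) \<le> (1 + t * ?W) * f i x"
          by (simp add: algebra_simps)
        moreover have "(\<Sum>\<rho>\<in>R. \<omega> \<rho> * M \<rho>) \<le> (\<Sum>\<rho>\<in>R. \<omega> \<rho> * f i (y \<rho>))" by (intro sum_mono M)
        then have "t * (\<Sum>\<rho>\<in>R. \<omega> \<rho> * M \<rho>) \<le> t * (\<Sum>\<rho>\<in>R. \<omega> \<rho> * f i (y \<rho>))" using t(1) by simp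
        ultimately have "M0 + t * (\<Sum>\<rho>\<in>R. \<omega> \<rho> * M \<rho>) \<le> (1 + t * ?W) * f i x" using M0[of i] by linarith
        then show ?thesis using W1 by (simp add: pos_divide_le_eq mult.commute)
      qed
      then show ?thesis unfolding bdd_lo_def by blast
    qed
  qed
  moreover obtain \<sigma>0 where "\<sigma>0 \<in> Qb" "x \<in> \<sigma>0" using cover by blast
  then obtain \<tau> where "\<tau> \<in> Qb" "x \<in> \<tau>" "\<iota> x \<in> rel_interior (\<iota> ` \<tau>)" using mincell[OF Qb] by metis
  ultimately show ?thesis using assms by blast
qed

text \<open>A point z of C in the relative interior of the patch lies between x and w = z + \<eta>
  (z - x). Concavity gives f(z) \<ge> (1 - t) f(x) + t f(w), where f(z) is bounded above by
  convergence and f(w) below by \<open>bdd_lo_U\<close>.\<close>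

lemma bdd_up_U: assumes x: "x \<in> U" shows "bdd_up x"
proof -
  obtain \<sigma> where s: "\<sigma> \<in> Qb" "x \<in> \<sigma>" "pdim \<iota> \<sigma> = n" using cover by blast
  obtain P where P: "patch \<sigma> P" "\<iota> x \<in> P" by (rule patch_exists[OF s(1,2) x], rule that; assumption)
  note Pd = patchD[OF P(1)]
  obtain p where p: "p \<in> rel_interior P" using rel_interior_eq_empty[OF Pd(5)] P(2) by blast
  obtain z where z: "z \<in> C" "z \<in> \<sigma>" "\<iota> z \<in> rel_interior P"
    using patch_dense[OF s(1,3) P(1) p zero_less_one] by metis
  have zP: "\<iota> z \<in> P" using z rel_interior_subset by blast
  obtain e where e: "e > 0" "\<And>t. t \<in> dirs P \<Longrightarrow> norm t \<le> e \<Longrightarrow> \<iota> z + t \<in> P"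
    by (rule rel_interior_dirs[OF z(3)], rule that; assumption)
  define \<eta> where "\<eta> = e / (norm (\<iota> z - \<iota> x) + 1)"
  have "norm (\<iota> z - \<iota> x) + 1 > 0" by (simp add: add_nonneg_pos)
  then have \<eta>: "\<eta> > 0" "\<eta> * norm (\<iota> z - \<iota> x) \<le> e" using e(1) by (simp_all add: \<eta>_def field_simps)
  let ?w = "\<iota> z + \<eta> *\<^sub>R (\<iota> z - \<iota> x)"
  have wP: "?w \<in> P" using \<eta> zP P(2) by (intro e(2) subspace_scale[OF subspace_dirs] diff_in_dirs) auto
  have wS: "?w \<in> \<iota> ` \<sigma>" using wP Pd(2) by blast
  note A = pt_simps(1,2)[OF s(1) wS]
  have wU: "pt \<sigma> ?w \<in> U" using patch_U[OF P(1) A(1)] A(2) wP by simp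
  obtain M where M: "\<And>i. f i (pt \<sigma> ?w) \<ge> M" using bdd_lo_U[OF wU] unfolding bdd_lo_def by blast
  obtain K where K: "\<And>i. f i z \<le> K" using C_bdd(2)[OF z(1)] unfolding bdd_up_def by blast
  \<comment> \<open>The parameter at which the segment from x to w passes through z.\<close>
  define t where "t = 1 / (1 + \<eta>)"
  have t: "0 \<le> t" "t \<le> 1" "1 - t > 0" using \<eta>(1) by (auto simp: t_def field_simps)
  have "(1 - t) *\<^sub>R \<iota> x + t *\<^sub>R ?w = \<iota> x + (t * (1 + \<eta>)) *\<^sub>R (\<iota> z - \<iota> x)" by (simp add: algebra_simps)
  also have "t * (1 + \<eta>) = 1" using \<eta>(1) by (simp add: t_def)
  finally have e1: "(1 - t) *\<^sub>R \<iota> x + t *\<^sub>R ?w = \<iota> z" by simp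
  have "f i x \<le> (K - t * M) / (1 - t)" for i
  proof -
    have "f i z \<ge> (1 - t) * f i x + t * f i (pt \<sigma> ?w)"
      using patch_concave[OF wcf s(1,3) P(1) P(2) wP t(1,2), of i] unfolding e1
      using pt_simps(3)[OF s(1) z(2)] pt_simps(3)[OF s(1,2)] by simp
    moreover have "t * M \<le> t * f i (pt \<sigma> ?w)" using t M by (intro mult_left_mono) auto
    ultimately have "(1 - t) * f i x \<le> K - t * M" using K[of i] by linarith
    then show ?thesis using t(3) by (simp add: pos_le_divide_eq mult.commute)
  qed
  then show ?thesis unfolding bdd_up_def by blast
qed

text \<open>The constant depends on \<^term>\<open>x\<close> and blows up towards the boundary of a stratum, so this only gives
  equicontinuity at each single point.\<close>

lemma lipschitz_at:
  assumes x: "x \<in> U" and s: "\<sigma> \<in> Qb" "x \<in> \<sigma>" "pdim \<iota> \<sigma> = n"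
  obtains K \<kappa> where "K \<ge> 0" "\<kappa> > 0" "\<And>i z. z \<in> \<sigma> \<Longrightarrow> dist (\<iota> z) (\<iota> x) \<le> \<kappa> \<Longrightarrow> \<bar>f i z - f i x\<bar> \<le> K * dist (\<iota> z) (\<iota> x)"
proof -
  obtain P \<kappa>0 where P: "patch \<sigma> P" "\<iota> x \<in> P" "\<kappa>0 > 0" "\<And>v. v \<in> \<iota> ` \<sigma> \<Longrightarrow> dist v (\<iota> x) \<le> \<kappa>0 \<Longrightarrow> v \<in> P"
    by (rule patch_exists[OF s(1,2) x], rule that; assumption)
  note Pd = patchD[OF P(1)]
  have U_P: "pt \<sigma> v \<in> U" if "v \<in> P" for v
  proof -
    have "v \<in> \<iota> ` \<sigma>" using that Pd(2) by blast
    note A = pt_simps(1,2)[OF s(1) this]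
    show ?thesis using patch_U[OF P(1) A(1)] A(2) that by simp
  qed
  have ptx: "pt \<sigma> (\<iota> z) = z" if "z \<in> \<sigma>" for z using pt_simps(3)[OF s(1) that] .
  obtain V where V: "finite V" "P = convex hull V" using Pd(1) unfolding polytope_def by blast
  have "\<forall>v\<in>V. \<exists>M. \<forall>i. f i (pt \<sigma> v) \<ge> M" using bdd_lo_U U_P V hull_subset[of V convex] unfolding bdd_lo_def by blast
  then obtain m where m: "\<And>v i. v \<in> V \<Longrightarrow> f i (pt \<sigma> v) \<ge> m v" by metis
  obtain Mu where Mu: "\<And>i. f i x \<le> Mu" using bdd_up_U[OF x] unfolding bdd_up_def by blast
  \<comment> \<open>M bounds f(x) from above and -f at the vertices of P; concavity spreads the
    lower bound -M over P.\<close>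
  define M where "M = max 0 (max Mu (- Min (insert 0 (m ` V))))"
  have M0: "M \<ge> 0" by (simp add: M_def)
  have fx: "f i x \<le> M" for i using Mu[of i] by (simp add: M_def)
  have lo: "f i (pt \<sigma> v) \<ge> - M" if v: "v \<in> P" for v i
  proof -
    have "convex_on P (\<lambda>v. - f i (pt \<sigma> v))"
    proof (rule convex_onI[OF _ Pd(5)])
      fix t :: real and u v assume a: "0 < t" "t < 1" "u \<in> P" "v \<in> P"
      have "(1 - t) * f i (pt \<sigma> u) + t * f i (pt \<sigma> v) \<le> f i (pt \<sigma> ((1 - t) *\<^sub>R u + t *\<^sub>R v))"
        by (rule patch_concave[OF wcf s(1,3) P(1) a(3,4)]) (use a in auto)
      then show "- f i (pt \<sigma> ((1 - t) *\<^sub>R u + t *\<^sub>R v)) \<le> (1 - t) * - f i (pt \<sigma> u) + t * - f i (pt \<sigma> v)" by simp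
    qed
    moreover have "- f i (pt \<sigma> v) \<le> M" if "v \<in> V" for v
    proof -
      have "Min (insert 0 (m ` V)) \<le> m v" using V(1) that by (intro Min_le) auto
      then show ?thesis using m[OF that, of i] by (simp add: M_def)
    qed
    ultimately have "- f i (pt \<sigma> v) \<le> M" using convex_on_convex_hull_bound[of V "\<lambda>v. - f i (pt \<sigma> v)" M] v V(2) by blast
    then show ?thesis by simp
  qed
  show thesis
  proof (cases "n = 0")
    case True
    \<comment> \<open>In dimension 0 there is no second point p to aim at; the cell is a single
      point.\<close>
    have "z = x" if "z \<in> \<sigma>" for z
    proof -
      have "aff_dim (\<iota> ` \<sigma>) = 0" using s(3) True by (simp add: pdim_def)
      then obtain c where "\<iota> ` \<sigma> = {c}" using aff_dim_eq_0[of "\<iota> ` \<sigma>"] by auto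
      then have "\<iota> z = \<iota> x" using that s(2) by (metis imageI singletonD)
      then show ?thesis by (rule inj_onD[OF cell_inj[OF Qb s(1)] _ that s(2)])
    qed
    then show thesis using that[of 0 1] by simp
  next
    case False
    have "aff_dim (rel_interior P) = aff_dim P" by (rule rel_interior_aff_dim[OF Pd(5)])
    also have "\<dots> = n"
    proof -
      have "P \<noteq> {}" "\<iota> ` \<sigma> \<noteq> {}" using P(2) s(2) by blast+
      then show ?thesis using aff_dim_dirs[of P] aff_dim_dirs[of "\<iota> ` \<sigma>"] s(3) Pd(3) by (simp add: pdim_def)
    qed
    finally have "rel_interior P \<noteq> {\<iota> x}" using False by auto
    moreover have "rel_interior P \<noteq> {}" using rel_interior_eq_empty[OF Pd(5)] P(2) by blast
    ultimately obtain p where p: "p \<in> rel_interior P" "p \<noteq> \<iota> x" by blast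
    have pP: "p \<in> P" using p rel_interior_subset by blast
    have pS: "p \<in> \<iota> ` \<sigma>" using pP Pd(2) by blast
    note Ap = pt_simps(1,2)[OF s(1) pS]
    have pri: "\<iota> (pt \<sigma> p) \<in> rel_interior (\<iota> ` \<sigma>)" using Ap p Pd(4) by auto
    have pne: "\<iota> (pt \<sigma> p) \<noteq> \<iota> x" using Ap p by simp
    obtain T R \<omega> y where R: "T > 0" "finite (R :: 'a set set)" "\<And>\<rho>. \<rho> \<in> R \<Longrightarrow> \<omega> \<rho> \<ge> 0 \<and> y \<rho> \<in> U"
      "\<And>f t q. wc f \<Longrightarrow> 0 < t \<Longrightarrow> t \<le> T \<Longrightarrow> q \<in> \<sigma> \<Longrightarrow> \<iota> q = \<iota> x + t *\<^sub>R (\<iota> (pt \<sigma> p) - \<iota> x) \<Longrightarrow>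
         f q \<le> f x + t * (\<Sum>\<rho>\<in>R. \<omega> \<rho> * (f x - f (y \<rho>)))"
      by (rule weakly_concave_ray[OF s(1,3,2) x pri pne], rule that; assumption)
    have "\<forall>\<rho>\<in>R. \<exists>M. \<forall>i. f i (y \<rho>) \<ge> M" using bdd_lo_U R(3) unfolding bdd_lo_def by blast
    then obtain m' where m': "\<And>\<rho> i. \<rho> \<in> R \<Longrightarrow> f i (y \<rho>) \<ge> m' \<rho>" by metis
    define K1 where "K1 = max 0 (\<Sum>\<rho>\<in>R. \<omega> \<rho> * (M - m' \<rho>))"
    have K1: "(\<Sum>\<rho>\<in>R. \<omega> \<rho> * (f i x - f i (y \<rho>))) \<le> K1" for i
    proof -
      have "(\<Sum>\<rho>\<in>R. \<omega> \<rho> * (f i x - f i (y \<rho>))) \<le> (\<Sum>\<rho>\<in>R. \<omega> \<rho> * (M - m' \<rho>))"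
      proof (intro sum_mono mult_left_mono)
        fix \<rho> assume "\<rho> \<in> R"
        then show "f i x - f i (y \<rho>) \<le> M - m' \<rho>" "\<omega> \<rho> \<ge> 0" using fx[of i] m'[of \<rho> i] R(3) by auto
      qed
      then show ?thesis by (simp add: K1_def)
    qed
    obtain \<eta> where \<eta>: "\<eta> > 0" "\<And>t. t \<in> dirs P \<Longrightarrow> norm t \<le> \<eta> \<Longrightarrow> p + t \<in> P"
      by (rule rel_interior_dirs[OF p(1)], rule that; assumption)
    obtain \<kappa>1 where \<kappa>1: "\<kappa>1 > 0" "\<And>v. v \<in> P \<Longrightarrow> v \<noteq> \<iota> x \<Longrightarrow> \<iota> x + (\<kappa>1 / norm (v - \<iota> x)) *\<^sub>R (v - \<iota> x) \<in> P"
      by (rule polyhedron_local_cone[OF polytope_imp_polyhedron[OF Pd(1)] P(2)], rule that; assumption)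
    \<comment> \<open>\<open>\<kappa>0\<close> keeps z in P, \<open>\<kappa>1\<close> gives D /
      \<open>\<kappa>1\<close> \<le> 1 in the lower estimate, and the last two terms give 2 t \<le>
      1 and t \<le> T for t = D / (2 \<eta>) in the upper one.\<close>
    define \<kappa> where "\<kappa> = min (min \<kappa>0 \<kappa>1) (min \<eta> (2 * \<eta> * T))"
    have \<kappa>: "\<kappa> > 0" "\<kappa> \<le> \<kappa>0" "\<kappa> \<le> \<kappa>1" "\<kappa> \<le> \<eta>" "\<kappa> \<le> 2 * \<eta> * T"
      using P(3) \<kappa>1(1) \<eta>(1) R(1) by (auto simp: \<kappa>_def)
    define K where "K = max (2 * M / \<kappa>1) ((2 * K1 + 4 * M) / (2 * \<eta>))"
    have K0: "K \<ge> 0" using M0 \<kappa>1(1) by (auto simp: K_def le_max_iff_disj)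
    have main: "\<bar>f i z - f i x\<bar> \<le> K * dist (\<iota> z) (\<iota> x)" if z: "z \<in> \<sigma>" "dist (\<iota> z) (\<iota> x) \<le> \<kappa>" for i z
    proof (cases "\<iota> z = \<iota> x")
      case True
      then have "z = x" by (rule inj_onD[OF cell_inj[OF Qb s(1)] _ z(1) s(2)])
      then show ?thesis by simp
    next
      case False
      define D where "D = dist (\<iota> z) (\<iota> x)"
      have D: "D > 0" "D = norm (\<iota> z - \<iota> x)" "D \<le> \<kappa>" using False z by (auto simp: D_def dist_norm)
      have zP: "\<iota> z \<in> P" using P(4) z \<kappa> by auto
      \<comment> \<open>z lies between x and the point w of P in the same direction at distance
        \<open>\<kappa>1\<close> from x; moreover f(w) \<ge> -M and f(x) \<le> M.\<close>
      have lower: "f i z \<ge> f i x - (2 * M / \<kappa>1) * D"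
      proof -
        let ?w = "\<iota> x + (\<kappa>1 / D) *\<^sub>R (\<iota> z - \<iota> x)"
        have wP: "?w \<in> P" using \<kappa>1(2)[OF zP False] D by simp
        define t where "t = D / \<kappa>1"
        have t: "0 \<le> t" "t \<le> 1" "t * (\<kappa>1 / D) = 1" using D \<kappa>(3) \<kappa>1(1) by (auto simp: t_def field_simps)
        have "(1 - t) *\<^sub>R \<iota> x + t *\<^sub>R ?w = \<iota> x + (t * (\<kappa>1 / D)) *\<^sub>R (\<iota> z - \<iota> x)" by (simp add: algebra_simps)
        then have e: "(1 - t) *\<^sub>R \<iota> x + t *\<^sub>R ?w = \<iota> z" unfolding t(3) by simp
        have "f i z \<ge> (1 - t) * f i x + t * f i (pt \<sigma> ?w)"
          using patch_concave[OF wcf s(1,3) P(1) P(2) wP t(1,2), of i] unfolding e ptx[OF z(1)] ptx[OF s(2)] .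
        moreover have "t * f i (pt \<sigma> ?w) \<ge> t * (- M)" using lo[OF wP, of i] t(1) by (intro mult_left_mono) auto
        moreover have "t * f i x \<le> t * M" using fx[of i] t(1) by (intro mult_left_mono) auto
        ultimately have "f i z \<ge> f i x - 2 * (t * M)" by (simp add: algebra_simps)
        then show ?thesis by (simp add: t_def mult_ac)
      qed
      \<comment> \<open>The point q = x + t (p - x) is the midpoint of z and its reflection w, which
        lies in P because w = (1 - 2 t) x + 2 t p' with p' at distance \<eta> from p. Hence f(z)
        \<le> 2 f(q) - f(w), where f(q) \<le> f(x) + t \<open>K1\<close> and f(w) \<ge> f(x) - 4 t
        M.\<close>
      have upper: "f i z \<le> f i x + ((2 * K1 + 4 * M) / (2 * \<eta>)) * D"
      proof -
        define t where "t = D / (2 * \<eta>)"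
        have t: "0 < t" "2 * t \<le> 1" "t \<le> T" "t \<le> 1" using D \<kappa>(4,5) \<eta>(1) by (auto simp: t_def field_simps)
        define p' where "p' = p + (- (1 / (2 * t))) *\<^sub>R (\<iota> z - \<iota> x)"
        have "norm ((- (1 / (2 * t))) *\<^sub>R (\<iota> z - \<iota> x)) = D / (2 * t)" using D t(1) by simp
        also have "\<dots> = \<eta>" using D \<eta>(1) by (simp add: t_def)
        finally have n: "norm ((- (1 / (2 * t))) *\<^sub>R (\<iota> z - \<iota> x)) \<le> \<eta>" by simp
        have p'P: "p' \<in> P" unfolding p'_def
          using n by (intro \<eta>(2) subspace_scale[OF subspace_dirs] diff_in_dirs zP P(2)) auto
        let ?w = "(1 - 2 * t) *\<^sub>R \<iota> x + (2 * t) *\<^sub>R p'" and ?q = "\<iota> x + t *\<^sub>R (p - \<iota> x)"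
        have wP: "?w \<in> P" using Pd(5) P(2) p'P t by (intro convexD) auto
        have "?q = (1 - t) *\<^sub>R \<iota> x + t *\<^sub>R p" by (simp add: algebra_simps)
        then have qP: "?q \<in> P" using convexD[OF Pd(5) P(2) pP, of "1 - t" t] t by simp
        have "(2 * t) *\<^sub>R p' = (2 * t) *\<^sub>R p - (\<iota> z - \<iota> x)" using t(1) by (simp add: p'_def algebra_simps)
        then have we: "?w = (1 - 2 * t) *\<^sub>R \<iota> x + ((2 * t) *\<^sub>R p - (\<iota> z - \<iota> x))" by simp
        have "(1 - 1/2) *\<^sub>R \<iota> z + (1/2) *\<^sub>R ?w = (1/2) *\<^sub>R (\<iota> z + ?w)" by (simp add: scaleR_add_right)
        also have "\<iota> z + ?w = 2 *\<^sub>R ?q" unfolding we by (simp add: algebra_simps scaleR_2)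
        finally have e: "(1 - 1/2) *\<^sub>R \<iota> z + (1/2) *\<^sub>R ?w = ?q" by simp
        have qS: "?q \<in> \<iota> ` \<sigma>" using qP Pd(2) by blast
        note Aq = pt_simps(1,2)[OF s(1) qS]
        have half: "(1 - 1/2) * f i z + (1/2) * f i (pt \<sigma> ?w) \<le> f i (pt \<sigma> ?q)"
          using patch_concave[OF wcf s(1,3) P(1) zP wP, of "1/2" i] unfolding e ptx[OF z(1)] by simp
        have wlo: "f i (pt \<sigma> ?w) \<ge> (1 - 2 * t) * f i x + 2 * t * f i (pt \<sigma> p')"
          using patch_concave[OF wcf s(1,3) P(1) P(2) p'P, of "2 * t" i] t unfolding ptx[OF s(2)] by simp
        have "2 * t * f i (pt \<sigma> p') \<ge> 2 * t * (- M)" using lo[OF p'P, of i] t by (intro mult_left_mono) auto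
        moreover have "2 * t * f i x \<le> 2 * t * M" using fx[of i] t by (intro mult_left_mono) auto
        ultimately have w2: "f i (pt \<sigma> ?w) \<ge> f i x - 4 * (t * M)" using wlo by (simp add: algebra_simps)
        have "f i (pt \<sigma> ?q) \<le> f i x + t * (\<Sum>\<rho>\<in>R. \<omega> \<rho> * (f i x - f i (y \<rho>)))"
          by (rule R(4)[OF wcf t(1,3) Aq(1)]) (simp add: Aq(2) Ap(2))
        moreover have "t * (\<Sum>\<rho>\<in>R. \<omega> \<rho> * (f i x - f i (y \<rho>))) \<le> t * K1" using K1[of i] t(1) by (intro mult_left_mono) auto
        ultimately have "f i z \<le> f i x + t * (2 * K1 + 4 * M)" using half w2 by (simp add: algebra_simps)
        then show ?thesis by (simp add: t_def mult.commute)
      qed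
      have "(2 * M / \<kappa>1) * D \<le> K * D" "((2 * K1 + 4 * M) / (2 * \<eta>)) * D \<le> K * D"
        unfolding K_def by (intro mult_right_mono max.cobounded1 max.cobounded2 less_imp_le[OF D(1)])+
      then have "\<bar>f i z - f i x\<bar> \<le> K * D" using lower upper by linarith
      then show ?thesis by (simp add: D_def)
    qed
    show thesis by (rule that[of K \<kappa>]; fact K0 \<kappa>(1) main)
  qed
qed

lemma equicontinuous_at:
  assumes x: "x \<in> U" and e: "e > 0"
  shows "\<exists>W. open W \<and> x \<in> W \<and> (\<forall>z\<in>W \<inter> U. \<forall>i. \<bar>f i z - f i x\<bar> \<le> e)"
proof -
  obtain N where N: "open N" "x \<in> N" "\<And>\<sigma>. \<sigma> \<in> Qb \<Longrightarrow> \<sigma> \<inter> N \<noteq> {} \<Longrightarrow> x \<in> \<sigma>"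
    by (rule star_nbhd[OF Qb], rule that; assumption)
  let ?F = "{\<sigma>\<in>Qb. x \<in> \<sigma> \<and> pdim \<iota> \<sigma> = n}"
  have fin: "finite ?F" by (rule finite_subset[OF _ finite_cells_at[OF Qb, of x]]) blast
  have "\<forall>\<sigma>\<in>?F. \<exists>\<delta>>0. \<forall>i. \<forall>z\<in>\<sigma>. dist (\<iota> z) (\<iota> x) \<le> \<delta> \<longrightarrow> \<bar>f i z - f i x\<bar> \<le> e"
  proof
    fix \<sigma> assume "\<sigma> \<in> ?F"
    then have s: "\<sigma> \<in> Qb" "x \<in> \<sigma>" "pdim \<iota> \<sigma> = n" by auto
    obtain K \<kappa> where K: "K \<ge> 0" "\<kappa> > 0" "\<And>i z. z \<in> \<sigma> \<Longrightarrow> dist (\<iota> z) (\<iota> x) \<le> \<kappa> \<Longrightarrow> \<bar>f i z - f i x\<bar> \<le> K * dist (\<iota> z) (\<iota> x)"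
      by (rule lipschitz_at[OF x s], rule that; assumption)
    \<comment> \<open>K + 1 is positive even if K = 0.\<close>
    define \<delta> where "\<delta> = min \<kappa> (e / (K + 1))"
    have d: "\<delta> > 0" "\<delta> \<le> \<kappa>" "\<delta> \<le> e / (K + 1)" using K e by (auto simp: \<delta>_def)
    have "\<bar>f i z - f i x\<bar> \<le> e" if z: "z \<in> \<sigma>" "dist (\<iota> z) (\<iota> x) \<le> \<delta>" for i z
    proof -
      have "\<bar>f i z - f i x\<bar> \<le> K * dist (\<iota> z) (\<iota> x)" using K(3) z d by simp
      also have "\<dots> \<le> (K + 1) * dist (\<iota> z) (\<iota> x)" by (intro mult_right_mono) auto
      also have "\<dots> \<le> (K + 1) * (e / (K + 1))" using z d K by (intro mult_left_mono) auto
      also have "\<dots> = e" using K(1) by simp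
      finally show ?thesis .
    qed
    then show "\<exists>\<delta>>0. \<forall>i. \<forall>z\<in>\<sigma>. dist (\<iota> z) (\<iota> x) \<le> \<delta> \<longrightarrow> \<bar>f i z - f i x\<bar> \<le> e" using d(1) by blast
  qed
  then obtain D where D: "\<forall>\<sigma>\<in>?F. D \<sigma> > 0 \<and> (\<forall>i. \<forall>z\<in>\<sigma>. dist (\<iota> z) (\<iota> x) \<le> D \<sigma> \<longrightarrow> \<bar>f i z - f i x\<bar> \<le> e)"
    using bchoice[of ?F "\<lambda>\<sigma> \<delta>. \<delta> > 0 \<and> (\<forall>i. \<forall>z\<in>\<sigma>. dist (\<iota> z) (\<iota> x) \<le> \<delta> \<longrightarrow> \<bar>f i z - f i x\<bar> \<le> e)"] by blast
  define \<delta> where "\<delta> = Min (insert 1 (D ` ?F))"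
  have fin': "finite (insert 1 (D ` ?F))" using fin by simp
  have pos: "\<delta> > 0" unfolding \<delta>_def using fin' D by (subst Min_gr_iff) auto
  have le: "\<delta> \<le> D \<sigma>" if "\<sigma> \<in> ?F" for \<sigma> unfolding \<delta>_def using fin' that by (intro Min_le) auto
  let ?W = "N \<inter> \<iota> -` ball (\<iota> x) \<delta>"
  have "open (\<iota> -` ball (\<iota> x) \<delta>)" using iota_continuous[OF Qb] by (intro open_vimage) auto
  then have "open ?W" using N(1) by blast
  moreover have "x \<in> ?W" using N(2) pos by simp
  moreover have "\<bar>f i z - f i x\<bar> \<le> e" if z: "z \<in> ?W" for i z
  proof -
    obtain \<sigma> where s: "\<sigma> \<in> Qb" "z \<in> \<sigma>" "pdim \<iota> \<sigma> = n" using cover by blast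
    then have "\<sigma> \<in> ?F" using N(3)[OF s(1)] z by blast
    moreover have "dist (\<iota> z) (\<iota> x) \<le> \<delta>" using z by (simp add: dist_commute)
    ultimately show ?thesis using D le[of \<sigma>] s(2) by force
  qed
  ultimately show ?thesis by blast
qed

end

section \<open>Passage to the limit, and purity of the balancing complex\<close>

lemma weakly_concave_limit:
  assumes "\<And>i::nat. weakly_concave \<iota> Q0 n U Qb b (f i)" "\<And>x. x \<in> U \<Longrightarrow> (\<lambda>i. f i x) \<longlonglongrightarrow> F x"
  shows "weakly_concave \<iota> Q0 n U Qb b F"
  unfolding weakly_concave_def
proof (intro allI impI)
  fix x I xs \<nu> assume cc: "balanced_cc \<iota> Q0 n U Qb b x I xs \<nu>"
  then have U: "x \<in> U" "\<And>i. i \<in> I \<Longrightarrow> xs i \<in> U" unfolding balanced_cc_def by blast+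
  have "(\<lambda>k. \<Sum>i\<in>I. \<nu> i * f k (xs i)) \<longlonglongrightarrow> (\<Sum>i\<in>I. \<nu> i * F (xs i))"
    using assms(2) U(2) by (intro tendsto_sum tendsto_mult tendsto_const) auto
  moreover have "(\<lambda>k. f k x) \<longlonglongrightarrow> F x" using assms(2) U(1) by blast
  moreover have "(\<Sum>i\<in>I. \<nu> i * f k (xs i)) \<le> f k x" for k using assms(1)[of k] cc unfolding weakly_concave_def by blast
  ultimately show "(\<Sum>i\<in>I. \<nu> i * F (xs i)) \<le> F x" by (intro LIMSEQ_le) auto
qed

text \<open>Purity is stated for \<open>Q0\<close>. Local finiteness puts each nonempty cell of
  \<open>Q0\<close> into a maximal one, which has dimension n, and \<open>subdiv_full_dim\<close>
  carries dimensions through the common subdivision to \<open>Qb\<close>.\<close>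

lemma pure_dim_transfer:
  assumes Q0: "eucl_complex \<iota> Q0" and pd: "pure_dim \<iota> Q0 n" and Qb: "in_class \<iota> Q0 Qb"
  shows "\<sigma> \<in> Qb \<Longrightarrow> pdim \<iota> \<sigma> \<le> n" "\<exists>\<sigma>\<in>Qb. z \<in> \<sigma> \<and> pdim \<iota> \<sigma> = n"
proof -
  obtain Q2 where Q2: "eucl_complex \<iota> Qb" "eucl_complex \<iota> Q2" "subdiv Q2 Qb" "subdiv Q2 Q0"
    using Qb unfolding in_class_def by blast
  have above: "\<exists>\<rho>\<in>Q0. \<sigma> \<subseteq> \<rho> \<and> pdim \<iota> \<rho> = n" if s: "\<sigma> \<in> Q0" "\<sigma> \<noteq> {}" for \<sigma>
  proof -
    let ?A = "{\<rho>\<in>Q0. \<sigma> \<subseteq> \<rho> \<and> True}"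
    have "finite ?A" by (rule finite_cells_above[OF Q0 s(2)])
    moreover have "\<sigma> \<in> ?A" using s by simp
    ultimately obtain \<rho> where r: "\<rho> \<in> ?A" "\<sigma> \<subseteq> \<rho>" "\<And>\<tau>. \<tau> \<in> ?A \<Longrightarrow> \<rho> \<subseteq> \<tau> \<Longrightarrow> \<tau> = \<rho>"
      using finite_has_maximal2[of ?A \<sigma>] by (metis (no_types, lifting))
    have "\<forall>\<tau>\<in>Q0. \<rho> \<subseteq> \<tau> \<longrightarrow> \<tau> = \<rho>" using r by blast
    then have "pdim \<iota> \<rho> = n" using pd r(1) unfolding pure_dim_def by blast
    then show ?thesis using r by blast
  qed
  \<comment> \<open>Types are nonempty, so some nonempty cell has dimension n and n \<ge> 0. The
    empty cell, of dimension -1, then obeys the bound.\<close>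
  obtain z0 :: 'a where True by blast
  have n0: "n \<ge> 0"
  proof -
    obtain \<sigma> where "\<sigma> \<in> Q0" "z0 \<in> \<sigma>" using complex_cover[OF Q0] by blast
    then obtain \<rho> where "\<rho> \<in> Q0" "\<sigma> \<subseteq> \<rho>" "pdim \<iota> \<rho> = n" using above[of \<sigma>] by blast
    then show ?thesis using pdim_nonneg[of \<rho> \<iota>] \<open>z0 \<in> \<sigma>\<close> by blast
  qed
  have le2: "pdim \<iota> \<sigma> \<le> n" if s: "\<sigma> \<in> Q2" "\<sigma> \<noteq> {}" for \<sigma>
  proof -
    obtain \<rho> where r: "\<rho> \<in> Q0" "\<sigma> \<subseteq> \<rho>" using Q2(4) s unfolding subdiv_def by blast
    then have "\<rho> \<noteq> {}" using s by blast
    then obtain \<rho>' where "\<rho>' \<in> Q0" "\<rho> \<subseteq> \<rho>'" "pdim \<iota> \<rho>' = n" using above[OF r(1)] by blast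
    then show ?thesis using pdim_mono[of \<sigma> \<rho>' \<iota>] r by auto
  qed
  show le: "pdim \<iota> \<sigma> \<le> n" if s: "\<sigma> \<in> Qb" for \<sigma>
  proof (cases "\<sigma> = {}")
    case True then show ?thesis using n0 by (simp add: pdim_def)
  next
    case False
    then obtain y where y: "y \<in> \<sigma>" by blast
    obtain \<rho> where "\<rho> \<in> Q2" "y \<in> \<rho>" "\<rho> \<subseteq> \<sigma>" "pdim \<iota> \<rho> = pdim \<iota> \<sigma>"
      by (rule subdiv_full_dim[OF Q2(1,2,3) s y], rule that; assumption)
    then show ?thesis using le2[of \<rho>] by auto
  qed
  show "\<exists>\<sigma>\<in>Qb. z \<in> \<sigma> \<and> pdim \<iota> \<sigma> = n"
  proof -
    obtain \<sigma>0 where "\<sigma>0 \<in> Q0" "z \<in> \<sigma>0" using complex_cover[OF Q0] by blast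
    then obtain \<sigma> where s: "\<sigma> \<in> Q0" "z \<in> \<sigma>" "pdim \<iota> \<sigma> = n" using above[of \<sigma>0] by blast
    obtain \<rho> where r: "\<rho> \<in> Q2" "z \<in> \<rho>" "\<rho> \<subseteq> \<sigma>" "pdim \<iota> \<rho> = pdim \<iota> \<sigma>"
      by (rule subdiv_full_dim[OF Q0 Q2(2,4) s(1,2)], rule that; assumption)
    obtain \<tau> where t: "\<tau> \<in> Qb" "\<rho> \<subseteq> \<tau>" using Q2(3) r(1) unfolding subdiv_def by blast
    have "pdim \<iota> \<tau> = n" using pdim_mono[OF t(2), of \<iota>] le[OF t(1)] r(4) s(3) by simp
    then show ?thesis using t r(2) by blast
  qed
qed

theorem theorem6p15:
  fixes \<iota> :: "'x::second_countable_topology \<Rightarrow> 'v::euclidean_space"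
    and Q0 Qb :: "'x set set" and n :: int and U C :: "'x set"
    and b :: "'x set \<Rightarrow> real" and f :: "nat \<Rightarrow> 'x \<Rightarrow> real"
  assumes "eucl_poly_space \<iota> Q0"
    and "pure_dim \<iota> Q0 n"
    and "open U"
    and "balancing \<iota> Q0 n U Qb b"
    and "\<And>i. weakly_concave \<iota> Q0 n U Qb b (f i)"
    and "C \<subseteq> U" and "U \<subseteq> closure C"
    and "\<And>x. x \<in> C \<Longrightarrow> convergent (\<lambda>i. f i x)"
  shows "\<exists>F. (\<forall>x\<in>U. (\<lambda>i. f i x) \<longlonglongrightarrow> F x) \<and>
             weakly_concave \<iota> Q0 n U Qb b F \<and>
             (\<forall>K. compact K \<and> K \<subseteq> U \<longrightarrow> uniform_limit K f F sequentially)"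
proof -
  obtain a \<beta> where a: "\<beta> \<noteq> 0" "\<forall>x. a \<bullet> \<iota> x = \<beta>" and Q0: "eucl_complex \<iota> Q0"
    using assms(1) unfolding eucl_poly_space_def by blast
  have bal: "in_class \<iota> Q0 Qb" "minkowski \<iota> Qb U n b" "\<And>\<sigma>. \<sigma> \<in> restr \<iota> Qb U n \<Longrightarrow> b \<sigma> > 0"
    using assms(4) unfolding balancing_def by blast+
  note pure = pure_dim_transfer[OF Q0 assms(2) bal(1)]
  interpret convergent_family \<iota> Qb Q0 n U b a \<beta> f C
    by unfold_locales (use a bal pure assms in blast)+
  obtain F where F: "\<And>x. x \<in> U \<Longrightarrow> (\<lambda>i. f i x) \<longlonglongrightarrow> F x"
    "\<And>K. compact K \<Longrightarrow> K \<subseteq> U \<Longrightarrow> uniform_limit K f F sequentially"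
    by (rule equicontinuous_convergence[OF equicontinuous_at assms(3,6,7,8)], assumption+, rule that; assumption)
  have "weakly_concave \<iota> Q0 n U Qb b F" by (rule weakly_concave_limit[OF assms(5) F(1)])
  then show ?thesis using F by blast
qed

end
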